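(* Let $p$ be a prime and let $A, B, C \subset \mathbb{F}_p$ with $|A|=|B|=|C| \leq \sqrt{p}$. Then for any fixed $d \in \mathbb{F}_p$ with $d \neq 0$, $$\max(|AB|, |(A+d)C|) \gg |A|^{1+1/26}.$$ In particular, for $A \subset \mathbb{F}_p$ with $|A| \leq \sqrt{p}$, $$|A(A+1)| \gg |A|^{1+1/26}$$ and $$\max(|AA|, |(A+1)(A+1)|) \gg |A|^{1+1/26}.$$
   Context: $\mathbb{F}_p$ is the field with $p$ elements, $p$ prime. For subsets $X, Y$ of a field and an element $d$, $XY = \{xy : x \in X, y \in Y\}$ and $X + d = \{x + d : x \in X\}$; $|X|$ is the cardinality of $X$. The notation $X \gg Y$ means that there is an absolute constant $c>0$ (here independent of $p, A, B, C, d$) such that $|X| \geq c|Y|$. *)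

theory Defs
  imports Complex_Main "HOL-Number_Theory.Residues"
begin

(* The field with p elements has to be a value depending on the number p, not a type:
   the implied constants are chosen before p.

   For subsets of the carrier of a ring R, the product set XY is the library's
   X <#> Y (taken in R) and the translate X + d is the library's additive coset X +> d. *)
abbreviation Fp :: "nat \<Rightarrow> int ring" where
  "Fp p \<equiv> residue_ring (int p)"

end

theory Submission
  imports Defs "Subresultants.Subresultant_Gcd" "Berlekamp_Zassenhaus.Unique_Factorization_Poly"
    "Berlekamp_Zassenhaus.Finite_Field" "HOL-Analysis.Convex" "HOL-Real_Asymp.Real_Asymp"
begin

text \<open>Let \<open>N = |A|\<close> and let \<open>M\<close> bound \<open>|AB|\<close> and \<open>|(A + d)C|\<close>. By Cauchy-Schwarz there are about
  \<open>N\<^sup>6 / M\<^sup>2\<close> pairs of triples with \<open>a b = a' b'\<close> and \<open>(a + d) c = (a' + d) c' = t\<close>, and then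
  \<open>b / c - b' / c' = d (b - b') / t\<close> takes at most \<open>M\<close> values for given \<open>b, b'\<close>. A second application of
  Cauchy-Schwarz bounds the square of the number of these pairs by \<open>N\<^sup>2 M\<close> times the number of solutions of
  \<open>b (w\<^sub>1 - w\<^sub>2) = b' (w\<^sub>1' - w\<^sub>2')\<close> with \<open>b, b'\<close> in \<open>B\<close> and all \<open>w\<close> in \<open>1 / C\<close>. The bound
  \<open>N\<^bsup>5 - 1/5\<^esup>\<close> for that number, instead of the trivial \<open>N\<^sup>5\<close>, gives \<open>M \<ge> c N\<^bsup>1 + 1/25\<^esup>\<close>.

  The solutions are the crossings between two families of \<open>N\<^sup>3\<close> lines in three-space whose
  directions \<open>(1, s, s\<^sup>2)\<close> lie on a conic. Discarding poor lines, a few lines of the first family meet every line of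
  the second one often, so a polynomial of small degree vanishing on these few lines vanishes on both
  families. On an irreducible factor \<open>f\<close> with many crossings, both tangent directions on the conic are tangent
  to second order at each crossing, hence modulo \<open>f\<close>; so through a generic point of a line of the surface there
  runs a second line of the surface. Consequently \<open>f\<close> divides a polynomial that expresses that the line with
  direction on the conic from a point to a given line \<open>l\<close> is tangent to the surface. Evaluated on another line
  \<open>l'\<close> of the same family, this forces almost all lines crossing \<open>l'\<close> to cross \<open>l\<close>, whereas two lines of
  the family have at most \<open>N\<close> common transversals.\<close>

text \<open>The condition |A| \<le> sqrt p enters through the characteristic alone: the surfaces
  that are differentiated have degree at most 27 h < N^2 \<le> p, so vanishing derivatives and
  differential equations have the same consequences as in characteristic zero. Directions on a conic
  are what turns the equation into incidences. Two lines in space meet if an expression in slopes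
  and intercepts vanishes; for directions (1, s, s^2) the factor s - s' cancels from it and c' - c =
  (s + s') (b' - b) remains, which can be made to express the bilinear equation being counted. The
  obstacle is that crossings with a line only count zeros of a polynomial on it if they happen at
  distinct points, that is, if the lines of one family are pairwise skew. Over F_p this cannot be
  expected, so the lines are placed over the rational function field F_p(\<kappa>), where a crossing
  inside a family would be an algebraic relation for \<kappa>. If K bounds the number of solutions,
  the two Cauchy-Schwarz steps give N^12 \<le> const M^5 N^2 K outside an easy case, so a saving of
  N^e over K = N^5 adds e/5 to the exponent of M.\<close>

hide_const (open) up_ring.coeff up_ring.monom

subsection \<open>Total degree\<close>

text \<open>\<open>insert 0\<close> gives the zero polynomial the value 0. Applied to
  \<open>degree\<close> this is the total degree in two variables, applied once more the total
  degree in three.\<close>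

definition lift_deg :: "('b::zero \<Rightarrow> nat) \<Rightarrow> 'b poly \<Rightarrow> nat" where
  "lift_deg w f = Max (insert 0 ((\<lambda>i. i + w (coeff f i)) ` {i. coeff f i \<noteq> 0}))"

lemma finite_coeff_support: "finite {i. coeff f i \<noteq> 0}"
  by (rule finite_subset[of _ "{..degree f}"]) (auto intro: le_degree)

lemma lift_deg_le_iff: "lift_deg w f \<le> n \<longleftrightarrow> (\<forall>i. coeff f i \<noteq> 0 \<longrightarrow> i + w (coeff f i) \<le> n)"
  unfolding lift_deg_def using finite_coeff_support[of f] by (subst Max_le_iff) auto

lemma lift_deg_ge: "coeff f i \<noteq> 0 \<Longrightarrow> i + w (coeff f i) \<le> lift_deg w f"
  using lift_deg_le_iff[of w f "lift_deg w f"] by blast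

lemma lift_deg_0 [simp]: "lift_deg w 0 = 0"
  by (simp add: lift_deg_def)

lemma degree_le_lift_deg: "degree f \<le> lift_deg w f"
proof (cases "f = 0")
  case False
  hence "coeff f (degree f) \<noteq> 0" by simp
  from lift_deg_ge[OF this] show ?thesis by (rule add_leD1)
qed auto

lemma lift_deg_coeff_le: "w 0 = 0 \<Longrightarrow> w (coeff f i) \<le> lift_deg w f"
  by (cases "coeff f i = 0") (use lift_deg_ge[of f i w] in auto)

text \<open>These rules survive the passage from \<open>w\<close> to \<open>lift_deg w\<close>, so
  the step that adds a variable is proved once and used twice.\<close>

locale total_degree =
  fixes w :: "'b::idom \<Rightarrow> nat"
  assumes zero [simp]: "w 0 = 0"
    and mult: "a \<noteq> 0 \<Longrightarrow> b \<noteq> 0 \<Longrightarrow> w (a * b) = w a + w b"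
    and add: "w (a + b) \<le> max (w a) (w b)"
begin

lemma one [simp]: "w 1 = 0"
  using mult[of 1 1] by simp

lemma uminus [simp]: "w (- a) = w a"
proof (cases "a = 0")
  case False
  have "w (-1) = 0" using mult[of "-1" "-1"] by simp
  thus ?thesis using mult[of "-1" a] False by simp
qed auto

lemma diff: "w (a - b) \<le> max (w a) (w b)"
  using add[of a "- b"] by simp

lemma mult_le: "w (a * b) \<le> w a + w b"
  by (cases "a = 0"; cases "b = 0") (auto simp: mult)

lemma of_nat [simp]: "w (of_nat n) = 0"
proof (induction n)
  case (Suc n) thus ?case using add[of 1 "of_nat n"] by simp
qed auto

lemma add_eq: "w b < w a \<Longrightarrow> w (a + b) = w a"
  using add[of a b] diff[of "a + b" b] by auto

lemma sum_le: "finite A \<Longrightarrow> (\<And>x. x \<in> A \<Longrightarrow> w (f x) \<le> n) \<Longrightarrow> w (sum f A) \<le> n"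
proof (induction A rule: finite_induct)
  case (insert x A)
  have "w (f x + sum f A) \<le> max (w (f x)) (w (sum f A))" by (rule add)
  with insert show ?case by (auto intro: order_trans)
qed auto

lemma sum_less: "finite A \<Longrightarrow> 0 < n \<Longrightarrow> (\<And>x. x \<in> A \<Longrightarrow> w (f x) < n) \<Longrightarrow> w (sum f A) < n"
proof -
  assume A: "finite A" "0 < n" and less: "\<And>x. x \<in> A \<Longrightarrow> w (f x) < n"
  have "w (sum f A) \<le> n - 1"
  proof (rule sum_le[OF A(1)])
    fix x assume "x \<in> A"
    from less[OF this] show "w (f x) \<le> n - 1" by linarith
  qed
  with A(2) show ?thesis by linarith
qed

text \<open>For \<ge>, leading forms do not cancel: among the coefficients of \<open>f\<close> and
  \<open>g\<close> that attain the total degree take those of largest index \<open>i\<close> and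
  \<open>k\<close>. In coefficient \<open>i + k\<close> of the product every other nonzero term has
  smaller weight.\<close>

lemma lift_mult:
  assumes f: "f \<noteq> 0" and g: "g \<noteq> 0"
  shows "lift_deg w (f * g) = lift_deg w f + lift_deg w g"
proof (rule antisym)
  show "lift_deg w (f * g) \<le> lift_deg w f + lift_deg w g"
    unfolding lift_deg_le_iff
  proof (intro allI impI)
    fix n assume "coeff (f * g) n \<noteq> 0"
    hence n: "n \<le> lift_deg w f + lift_deg w g"
      using le_degree[of "f * g" n] degree_mult_le[of f g] degree_le_lift_deg[of f w] degree_le_lift_deg[of g w]
      by linarith
    have "w (coeff (f * g) n) \<le> lift_deg w f + lift_deg w g - n"
      unfolding coeff_mult
    proof (rule sum_le)
      fix i assume i: "i \<in> {..n}"
      show "w (coeff f i * coeff g (n - i)) \<le> lift_deg w f + lift_deg w g - n"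
      proof (cases "coeff f i = 0 \<or> coeff g (n - i) = 0")
        case False
        thus ?thesis using lift_deg_ge[of f i w] lift_deg_ge[of g "n - i" w] i
          by (auto simp: mult)
      qed auto
    qed auto
    with n show "n + w (coeff (f * g) n) \<le> lift_deg w f + lift_deg w g" by linarith
  qed
next
  define top where "top = (\<lambda>(f::'b poly) i. coeff f i \<noteq> 0 \<and> i + w (coeff f i) = lift_deg w f)"
  have ex: "\<exists>i. top f i \<and> (\<forall>j>i. \<not> top f j)" if "f \<noteq> 0" for f
  proof -
    let ?S = "{i. top f i}"
    have fin: "finite ?S" by (rule finite_subset[OF _ finite_coeff_support[of f]]) (auto simp: top_def)
    have "Max (insert 0 ((\<lambda>i. i + w (coeff f i)) ` {i. coeff f i \<noteq> 0})) \<in>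
        insert 0 ((\<lambda>i. i + w (coeff f i)) ` {i. coeff f i \<noteq> 0})"
      using finite_coeff_support[of f] by (intro Max_in) auto
    hence "?S \<noteq> {}"
      unfolding lift_deg_def[symmetric]
    proof
      assume "lift_deg w f = 0"
      moreover have "coeff f (degree f) \<noteq> 0" using that by simp
      moreover from this have "degree f + w (coeff f (degree f)) \<le> lift_deg w f" by (rule lift_deg_ge)
      ultimately have "top f (degree f)" unfolding top_def by linarith
      thus ?thesis by auto
    qed (auto simp: top_def)
    from Max_in[OF fin this] Max_ge[OF fin] show ?thesis
      by (intro exI[of _ "Max ?S"]) (auto simp: not_le[symmetric])
  qed
  from ex[OF f] obtain i where i: "top f i" "\<And>j. j > i \<Longrightarrow> \<not> top f j" by auto
  from ex[OF g] obtain k where k: "top g k" "\<And>j. j > k \<Longrightarrow> \<not> top g j" by auto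
  let ?a = "coeff f i * coeff g k" and ?b = "\<Sum>j\<in>{..i + k} - {i}. coeff f j * coeff g (i + k - j)"
  have "coeff (f * g) (i + k) = ?a + ?b"
    unfolding coeff_mult by (subst sum.remove[of _ i]) auto
  have wa: "w ?a = lift_deg w f + lift_deg w g - (i + k)" "i + k \<le> lift_deg w f + lift_deg w g"
    using i(1) k(1) by (auto simp: top_def mult)
  have small: "coeff f j * coeff g (i + k - j) = 0 \<or> w (coeff f j * coeff g (i + k - j)) < w ?a"
    if j: "j \<in> {..i + k} - {i}" for j
  proof (cases "coeff f j = 0 \<or> coeff g (i + k - j) = 0")
    case False
    have le: "j + w (coeff f j) \<le> lift_deg w f" "(i + k - j) + w (coeff g (i + k - j)) \<le> lift_deg w g"
      using False lift_deg_ge by auto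
    have "j + w (coeff f j) \<noteq> lift_deg w f \<or> (i + k - j) + w (coeff g (i + k - j)) \<noteq> lift_deg w g"
      using i(2)[of j] k(2)[of "i + k - j"] j False unfolding top_def by (cases "j < i") auto
    moreover have "(i + k - j) + j = i + k" using j by auto
    ultimately have "w (coeff f j) + w (coeff g (i + k - j)) < lift_deg w f + lift_deg w g - (i + k)"
      using le wa(2) by linarith
    thus ?thesis using False wa by (simp add: mult)
  qed auto
  have "?a \<noteq> 0" using i k by (auto simp: top_def)
  have "?a + ?b \<noteq> 0 \<and> w (?a + ?b) = w ?a"
  proof (cases "w ?a = 0")
    \<comment> \<open>No weight is below 0, so here all the other summands are zero.\<close>
    case True
    with small have "?b = 0" by (intro sum.neutral) auto
    with \<open>?a \<noteq> 0\<close> show ?thesis by simp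
  next
    case False
    have "w ?b < w ?a" 
    proof (intro sum_less)
      fix j assume "j \<in> {..i + k} - {i}"
      from small[OF this] False show "w (coeff f j * coeff g (i + k - j)) < w ?a" by auto
    qed (use False in auto)
    from add_eq[OF this] False show ?thesis by auto
  qed
  with \<open>coeff (f * g) (i + k) = ?a + ?b\<close> have "coeff (f * g) (i + k) \<noteq> 0" "w (coeff (f * g) (i + k)) = w ?a"
    by auto
  from lift_deg_ge[OF this(1), of w] this(2) wa show "lift_deg w f + lift_deg w g \<le> lift_deg w (f * g)" by linarith
qed

lemma lift: "total_degree (lift_deg w)"
proof
  fix f g :: "'b poly"
  show "lift_deg w (f + g) \<le> max (lift_deg w f) (lift_deg w g)"
    unfolding lift_deg_le_iff
  proof (intro allI impI)
    fix i assume nz: "coeff (f + g) i \<noteq> 0"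
    have "w (coeff f i + coeff g i) \<le> max (w (coeff f i)) (w (coeff g i))" by (rule add)
    moreover have "coeff f i \<noteq> 0 \<Longrightarrow> i + w (coeff f i) \<le> lift_deg w f"
      "coeff g i \<noteq> 0 \<Longrightarrow> i + w (coeff g i) \<le> lift_deg w g" by (auto intro: lift_deg_ge)
    ultimately show "i + w (coeff (f + g) i) \<le> max (lift_deg w f) (lift_deg w g)"
      using nz by (cases "coeff f i = 0"; cases "coeff g i = 0") auto
  qed
qed (auto simp: lift_mult)

lemma lift_pderiv: "lift_deg w (pderiv f) \<le> lift_deg w f"
  unfolding lift_deg_le_iff
proof (intro allI impI)
  fix i assume "coeff (pderiv f) i \<noteq> 0"
  hence nz: "coeff f (Suc i) \<noteq> 0" by (auto simp: coeff_pderiv)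
  have "w (coeff (pderiv f) i) \<le> w (of_nat (Suc i)) + w (coeff f (Suc i))"
    unfolding coeff_pderiv by (rule mult_le)
  with lift_deg_ge[OF nz, of w] show "i + w (coeff (pderiv f) i) \<le> lift_deg w f" by (simp only: of_nat)
qed

end

lemma lift_deg_map_poly:
  assumes "\<And>a. w (d a) \<le> w a" "d 0 = 0"
  shows "lift_deg w (map_poly d f) \<le> lift_deg w f"
  unfolding lift_deg_le_iff
proof (intro allI impI)
  fix i assume "coeff (map_poly d f) i \<noteq> 0"
  hence "coeff f i \<noteq> 0" using assms(2) by (auto simp: coeff_map_poly)
  from lift_deg_ge[OF this, of w] assms(1)[of "coeff f i"]
  show "i + w (coeff (map_poly d f) i) \<le> lift_deg w f" by (simp add: coeff_map_poly assms(2))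
qed

lemma degree_eval_le:
  fixes \<epsilon> :: "'b::comm_ring_1 \<Rightarrow> 'c::idom poly"
  assumes "\<And>a. degree (\<epsilon> a) \<le> w a" "\<epsilon> 0 = 0" "degree Y \<le> 1"
  shows "degree (poly (map_poly \<epsilon> f) Y) \<le> lift_deg w f"
  unfolding poly_altdef
proof (rule degree_sum_le)
  fix i
  show "degree (coeff (map_poly \<epsilon> f) i * Y ^ i) \<le> lift_deg w f"
  proof (cases "coeff f i = 0")
    case False
    have "degree (\<epsilon> (coeff f i) * Y ^ i) \<le> w (coeff f i) + i"
      using degree_mult_le[of "\<epsilon> (coeff f i)" "Y ^ i"] degree_power_le[of Y i] assms(1)[of "coeff f i"]
        assms(3) mult_le_mono1[OF assms(3), of i] by linarith
    with lift_deg_ge[OF False, of w] show ?thesis by (simp add: coeff_map_poly assms(2))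
  qed (simp add: coeff_map_poly assms(2))
qed auto

interpretation degree: total_degree "degree :: 'a::idom poly \<Rightarrow> nat"
  by unfold_locales (auto simp: degree_mult_eq intro: degree_add_le_max)

interpretation degree2: total_degree "lift_deg degree :: 'a::idom poly poly \<Rightarrow> nat"
  by (rule degree.lift)

abbreviation tdeg :: "'a::idom poly poly poly \<Rightarrow> nat" where
  "tdeg \<equiv> lift_deg (lift_deg degree)"

interpretation tdeg: total_degree "tdeg :: 'a::idom poly poly poly \<Rightarrow> nat"
  by (rule degree2.lift)

lemma tdeg_0_imp_unit:
  fixes f :: "'a::field poly poly poly"
  assumes "f \<noteq> 0" "tdeg f = 0"
  shows "f dvd 1"
proof -
  have "degree f = 0" using degree_le_lift_deg[of f "lift_deg degree"] assms(2) by linarith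
  then obtain g where g: "f = [:g:]" using degree_eq_zeroE by blast
  have "lift_deg degree g = 0" using lift_deg_coeff_le[of "lift_deg degree" f 0] assms(2) g by simp
  with degree_le_lift_deg[of g degree] have "degree g = 0" by linarith
  then obtain h where h: "g = [:h:]" using degree_eq_zeroE by blast
  have "degree h = 0" using lift_deg_coeff_le[of degree g 0] \<open>lift_deg degree g = 0\<close> h by simp
  then obtain a where a: "h = [:a:]" using degree_eq_zeroE by blast
  have "a \<noteq> 0" using assms(1) g h a by auto
  hence "f * [:[:[:inverse a:]:]:] = 1" by (simp add: g h a pCons_one)
  thus ?thesis by (metis dvd_triv_left)
qed

subsection \<open>Evaluation and partial derivatives in three variables\<close>

lemma comm_ring_hom_eval:
  assumes "comm_ring_hom c"
  shows "comm_ring_hom (\<lambda>p. poly (map_poly c p) x)"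
proof -
  interpret c: comm_ring_hom c by fact
  interpret m: map_poly_comm_ring_hom c ..
  show ?thesis by unfold_locales (auto simp: hom_distribs)
qed

text \<open>The variables, from the innermost to the outermost, are \<open>x\<close>, \<open>z\<close>, \<open>y\<close>; the middle
  coordinate \<open>y\<close> is the one that gets eliminated.\<close>

definition ev1 :: "('a::comm_ring_1 \<Rightarrow> 'r::comm_ring_1) \<Rightarrow> 'r \<Rightarrow> 'a poly \<Rightarrow> 'r" where
  "ev1 c X h = poly (map_poly c h) X"
definition ev2 :: "('a::comm_ring_1 \<Rightarrow> 'r::comm_ring_1) \<Rightarrow> 'r \<Rightarrow> 'r \<Rightarrow> 'a poly poly \<Rightarrow> 'r" where
  "ev2 c X Z g = poly (map_poly (ev1 c X) g) Z"
definition ev3 :: "('a::comm_ring_1 \<Rightarrow> 'r::comm_ring_1) \<Rightarrow> 'r \<Rightarrow> 'r \<Rightarrow> 'r \<Rightarrow> 'a poly poly poly \<Rightarrow> 'r" where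
  "ev3 c X Z Y f = poly (map_poly (ev2 c X Z) f) Y"

lemma ev1_hom: "comm_ring_hom c \<Longrightarrow> comm_ring_hom (ev1 c X)"
  unfolding ev1_def by (rule comm_ring_hom_eval)
lemma ev2_hom: "comm_ring_hom c \<Longrightarrow> comm_ring_hom (ev2 c X Z)"
  unfolding ev2_def by (rule comm_ring_hom_eval[OF ev1_hom])
lemma ev3_hom: "comm_ring_hom c \<Longrightarrow> comm_ring_hom (ev3 c X Z Y)"
  unfolding ev3_def by (rule comm_ring_hom_eval[OF ev2_hom])

lemma hom_eval:
  assumes "comm_ring_hom h" "comm_ring_hom c"
  shows "h (poly (map_poly c p) x) = poly (map_poly (h \<circ> c) p) (h x)"
proof -
  interpret h: comm_ring_hom h by fact
  interpret c: comm_ring_hom c by fact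
  show ?thesis by (induction p) (auto simp: map_poly_pCons hom_distribs)
qed

text \<open>Specialising a parameter commutes with substitution. This links a line to its points,
  and a line through a generic point to that point; the coefficient map \<open>c\<close> is kept
  arbitrary for this purpose.\<close>

lemma ev3_comp:
  assumes "comm_ring_hom h" "comm_ring_hom c"
  shows "h (ev3 c X Z Y f) = ev3 (h \<circ> c) (h X) (h Z) (h Y) f"
proof -
  have 1: "h \<circ> ev1 c X = ev1 (h \<circ> c) (h X)"
    unfolding ev1_def comp_def using hom_eval[OF assms] by (auto simp: comp_def)
  have 2: "h \<circ> ev2 c X Z = ev2 (h \<circ> c) (h X) (h Z)"
    using hom_eval[OF assms(1) ev1_hom[OF assms(2)]] unfolding ev2_def 1[symmetric] by (auto simp: comp_def)
  show ?thesis
    using hom_eval[OF assms(1) ev2_hom[OF assms(2)]] unfolding ev3_def 2[symmetric] by (auto simp: comp_def)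
qed

abbreviation dx :: "'a::idom poly poly poly \<Rightarrow> 'a poly poly poly" where
  "dx \<equiv> map_poly (map_poly pderiv)"
abbreviation dz :: "'a::idom poly poly poly \<Rightarrow> 'a poly poly poly" where
  "dz \<equiv> map_poly pderiv"
abbreviation dy :: "'a::idom poly poly poly \<Rightarrow> 'a poly poly poly" where
  "dy \<equiv> pderiv"

lemma tdeg_dx: "tdeg (dx f) \<le> tdeg f"
  by (intro lift_deg_map_poly) (auto intro: le_trans[OF degree_pderiv_le])
lemma tdeg_dz: "tdeg (dz f) \<le> tdeg f"
  by (intro lift_deg_map_poly) (auto simp: degree.lift_pderiv)
lemma tdeg_dy: "tdeg (dy f) \<le> tdeg f"
  by (rule degree2.lift_pderiv)

lemma pderiv_eval:
  fixes \<epsilon> :: "'b::idom \<Rightarrow> 'r::idom poly"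
  assumes "comm_ring_hom \<epsilon>"
  shows "pderiv (poly (map_poly \<epsilon> p) Y) =
    poly (map_poly (\<lambda>a. pderiv (\<epsilon> a)) p) Y + poly (map_poly \<epsilon> (pderiv p)) Y * pderiv Y"
proof -
  interpret \<epsilon>: comm_ring_hom \<epsilon> by fact
  interpret m: map_poly_comm_ring_hom \<epsilon> ..
  show ?thesis
    by (induction p) (auto simp: map_poly_pCons pderiv_add pderiv_mult pderiv_pCons hom_distribs algebra_simps)
qed

lemma eval_map_add_mult:
  assumes "a 0 = 0" "b 0 = 0"
  shows "poly (map_poly (\<lambda>g. a g * u + b g * v) p) Y
    = poly (map_poly a p) Y * u + poly (map_poly b p) Y * (v :: 'r::comm_ring_1)"
  by (induction p) (auto simp: map_poly_pCons assms algebra_simps)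

lemma map_poly_comp:
  assumes "a 0 = 0" "d 0 = 0"
  shows "map_poly (\<lambda>g. a (d g)) p = map_poly a (map_poly d p)"
  by (rule poly_eqI) (simp add: coeff_map_poly assms)

lemma pderiv_ev3:
  fixes c :: "'a::idom \<Rightarrow> 'r::idom poly"
  assumes c: "comm_ring_hom c" and const: "\<And>a. pderiv (c a) = 0"
  shows "pderiv (ev3 c X Z Y f) =
    ev3 c X Z Y (dx f) * pderiv X + ev3 c X Z Y (dz f) * pderiv Z + ev3 c X Z Y (dy f) * pderiv Y"
proof -
  interpret h1: comm_ring_hom "ev1 c X" by (rule ev1_hom[OF c])
  interpret h2: comm_ring_hom "ev2 c X Z" by (rule ev2_hom[OF c])
  have z: "map_poly (\<lambda>a. 0) h = 0" for h :: "'a poly" by (rule poly_eqI) (simp add: coeff_map_poly)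
  have 1: "pderiv (ev1 c X h) = ev1 c X (pderiv h) * pderiv X" for h
    unfolding ev1_def by (subst pderiv_eval[OF c]) (simp add: const z)
  have 2: "pderiv (ev2 c X Z g) = ev2 c X Z (map_poly pderiv g) * pderiv X + ev2 c X Z (pderiv g) * pderiv Z" for g
  proof -
    have "pderiv (ev2 c X Z g) = poly (map_poly (\<lambda>a. ev1 c X (pderiv a) * pderiv X + ev1 c X 0 * 0) g) Z
        + ev2 c X Z (pderiv g) * pderiv Z"
      unfolding ev2_def by (subst pderiv_eval[OF h1.comm_ring_hom_axioms]) (simp add: 1)
    also have "poly (map_poly (\<lambda>a. ev1 c X (pderiv a) * pderiv X + ev1 c X 0 * 0) g) Z
        = ev2 c X Z (map_poly pderiv g) * pderiv X"
      by (simp add: ev2_def map_poly_comp[symmetric] eval_map_add_mult[where b = "\<lambda>_. 0" and v = 0, simplified])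
    finally show ?thesis .
  qed
  have "pderiv (ev3 c X Z Y f) =
      poly (map_poly (\<lambda>g. ev2 c X Z (map_poly pderiv g) * pderiv X + ev2 c X Z (pderiv g) * pderiv Z) f) Y
        + ev3 c X Z Y (dy f) * pderiv Y"
    unfolding ev3_def by (subst pderiv_eval[OF h2.comm_ring_hom_axioms]) (simp add: 2)
  also have "poly (map_poly (\<lambda>g. ev2 c X Z (map_poly pderiv g) * pderiv X + ev2 c X Z (pderiv g) * pderiv Z) f) Y
      = ev3 c X Z Y (dx f) * pderiv X + ev3 c X Z Y (dz f) * pderiv Z"
    by (subst eval_map_add_mult) (simp_all add: ev3_def map_poly_comp)
  finally show ?thesis .
qed

lemma degree_ev3_le:
  fixes f :: "'a::field poly poly poly" and c :: "'a \<Rightarrow> 'r::idom poly"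
  assumes c: "comm_ring_hom c" "\<And>a. degree (c a) = 0"
    and XYZ: "degree X \<le> 1" "degree Z \<le> 1" "degree Y \<le> 1"
  shows "degree (ev3 c X Z Y f) \<le> tdeg f"
proof -
  interpret c: comm_ring_hom c by fact
  interpret h1: comm_ring_hom "ev1 c X" by (rule ev1_hom[OF c(1)])
  interpret h2: comm_ring_hom "ev2 c X Z" by (rule ev2_hom[OF c(1)])
  have 1: "degree (ev1 c X h) \<le> degree h" for h
  proof -
    have "degree (ev1 c X h) \<le> lift_deg (\<lambda>_. 0) h"
      unfolding ev1_def by (rule degree_eval_le) (auto simp: c XYZ(1)[unfolded One_nat_def])
    also have "\<dots> \<le> degree h" by (simp add: lift_deg_le_iff le_degree)
    finally show ?thesis .
  qed
  have 2: "degree (ev2 c X Z g) \<le> lift_deg degree g" for g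
    unfolding ev2_def by (rule degree_eval_le[OF 1 _ XYZ(2)]) simp
  show ?thesis
    unfolding ev3_def by (rule degree_eval_le[OF 2 _ XYZ(3)]) simp
qed

subsection \<open>Elimination of one variable\<close>

text \<open>The powers of \<open>y\<close> form a vector in the kernel of the Sylvester matrix whose
  entries are mapped by \<open>h\<close>. The argument allows leading coefficients to vanish under
  \<open>h\<close>, as may happen on a particular line.\<close>

lemma resultant_eq_0_at_common_root:
  fixes f g :: "'b::comm_ring_1 poly" and h :: "'b \<Rightarrow> 'r::idom"
  assumes h: "comm_ring_hom h" and "0 < degree f"
    and f: "poly (map_poly h f) y = 0" and g: "poly (map_poly h g) y = 0"
  shows "h (resultant f g) = 0"
proof -
  interpret comm_ring_hom h by fact
  interpret m: map_poly_comm_ring_hom h ..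
  define m n where "m = degree f" and "n = degree g"
  let ?M = "map_mat h (sylvester_mat f g)"
  have M: "?M \<in> carrier_mat (m + n) (m + n)"
    unfolding m_def n_def by (auto intro: sylvester_carrier_mat)
  define v where "v = vec (m + n) (\<lambda>j. y ^ (m + n - 1 - j))"
  have v: "v \<in> carrier_vec (m + n)" by (simp add: v_def)
  \<comment> \<open>A row of the matrix holds the coefficients of \<open>f\<close> or
    \<open>g\<close> times a monomial; its product with the vector of powers is the value of that
    multiple at \<open>y\<close>.\<close>
  have entry: "(\<Sum>j<m + n. h (coeff (q * monom 1 k) (m + n - 1 - j)) * y ^ (m + n - 1 - j)) = 0"
    if "degree q + k < m + n" "poly (map_poly h q) y = 0" for q :: "'b poly" and k
  proof -
    have "(\<Sum>j<m + n. h (coeff (q * monom 1 k) (m + n - 1 - j)) * y ^ (m + n - 1 - j))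
        = (\<Sum>j<m + n. h (coeff (q * monom 1 k) j) * y ^ j)"
      by (rule sum.reindex_bij_witness[of _ "\<lambda>j. m + n - 1 - j" "\<lambda>j. m + n - 1 - j"]) auto
    also have "\<dots> = (\<Sum>j\<le>m + n - 1. coeff (map_poly h (q * monom 1 k)) j * y ^ j)"
      by (rule sum.cong) (use assms(2) m_def in auto)
    also have "\<dots> = poly (map_poly h (q * monom 1 k)) y"
    proof (rule poly_as_sum_of_monoms'[THEN arg_cong[where f = "\<lambda>p. poly p y"], symmetric,
          unfolded poly_sum poly_monom, THEN trans, symmetric])
    qed (use that degree_mult_le[of q "monom 1 k"] degree_monom_le[of "1::'b" k]
          degree_map_poly_le[of h "q * monom 1 k"] in auto)
    also have "\<dots> = 0" using that(2) by (simp add: hom_distribs)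
    finally show ?thesis .
  qed
  have "?M *\<^sub>v v = 0\<^sub>v (m + n)"
  proof (rule eq_vecI)
    fix i assume "i < dim_vec (0\<^sub>v (m + n))"
    hence i: "i < m + n" by simp
    have "(?M *\<^sub>v v) $ i = (\<Sum>j<m + n. h (sylvester_mat f g $$ (i, j)) * y ^ (m + n - 1 - j))"
      using i M by (auto simp: scalar_prod_def v_def m_def n_def lessThan_atLeast0 intro!: sum.cong)
    also have "\<dots> = 0"
    proof (cases "i < n")
      case True
      have "sylvester_mat f g $$ (i, j) = coeff (f * monom 1 (n - 1 - i)) (m + n - 1 - j)" if "j < m + n" for j
      proof -
        have "sylvester_mat f g $$ (i, j) = coeff (monom 1 (n - i) * f) (m + n - j)"
          using sylvester_index_mat2[of i f g j] i that True by (simp add: m_def n_def)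
        also have "\<dots> = coeff (f * monom 1 (n - 1 - i)) (m + n - 1 - j)"
          using True that by (simp add: mult.commute[of f] coeff_monom_mult) (auto intro!: arg_cong[of _ _ "coeff f"])
        finally show ?thesis .
      qed
      hence "(\<Sum>j<m + n. h (sylvester_mat f g $$ (i, j)) * y ^ (m + n - 1 - j)) =
          (\<Sum>j<m + n. h (coeff (f * monom 1 (n - 1 - i)) (m + n - 1 - j)) * y ^ (m + n - 1 - j))" by simp
      also have "\<dots> = 0" by (rule entry) (use True f m_def in auto)
      finally show ?thesis .
    next
      case False
      have "sylvester_mat f g $$ (i, j) = coeff (g * monom 1 (m + n - 1 - i)) (m + n - 1 - j)" if "j < m + n" for j
      proof -
        have "sylvester_mat f g $$ (i, j) = coeff (monom 1 (m + n - i) * g) (m + n - j)"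
          using sylvester_index_mat2[of i f g j] i that False by (simp add: m_def n_def)
        also have "\<dots> = coeff (g * monom 1 (m + n - 1 - i)) (m + n - 1 - j)"
          using i that by (simp add: mult.commute[of g] coeff_monom_mult) (auto intro!: arg_cong[of _ _ "coeff g"])
        finally show ?thesis .
      qed
      hence "(\<Sum>j<m + n. h (sylvester_mat f g $$ (i, j)) * y ^ (m + n - 1 - j)) =
          (\<Sum>j<m + n. h (coeff (g * monom 1 (m + n - 1 - i)) (m + n - 1 - j)) * y ^ (m + n - 1 - j))" by simp
      also have "\<dots> = 0" by (rule entry) (use False i g n_def in auto)
      finally show ?thesis .
    qed
    finally show "(?M *\<^sub>v v) $ i = 0\<^sub>v (m + n) $ i" using i by simp
  qed (use M in auto)
  have "det ?M \<cdot>\<^sub>v v = (det ?M \<cdot>\<^sub>m 1\<^sub>m (m + n)) *\<^sub>v v"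
    using v by (intro eq_vecI) (auto simp: smult_scalar_prod_distrib[of _ "m + n"] one_carrier_mat)
  also have "\<dots> = adj_mat ?M *\<^sub>v (?M *\<^sub>v v)"
    using adj_mat[OF M] M v by (metis assoc_mult_mat_vec)
  also have "\<dots> = 0\<^sub>v (m + n)"
    using adj_mat(1)[OF M] \<open>?M *\<^sub>v v = _\<close> by (auto intro!: eq_vecI simp: scalar_prod_def)
  \<comment> \<open>The last entry of \<open>v\<close> is \<open>y ^ 0 = 1\<close>; it exists
    because \<open>f\<close> has positive degree.\<close>
  finally have "(det ?M \<cdot>\<^sub>v v) $ (m + n - 1) = 0" using assms(2) m_def by simp
  moreover have "m + n - 1 < m + n" using assms(2) m_def by simp
  moreover have "\<not> Suc (m + n - Suc 0) < m + n" by arith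
  ultimately have "det ?M = 0" by (auto simp: v_def)
  thus ?thesis by (simp add: resultant_def)
qed

lemma resultant_neq_0:
  fixes f g :: "'b::{factorial_ring_gcd,semiring_gcd_mult_normalize} poly"
  assumes "irreducible f" "\<not> f dvd g"
  shows "resultant f g \<noteq> 0"
proof -
  have "is_unit (gcd f g)"
    using assms irreducibleD'[OF assms(1), of "gcd f g"] by (meson dvd_trans gcd_dvd1 gcd_dvd2)
  hence "degree (gcd f g) = 0" by (auto simp: is_unit_poly_iff)
  thus ?thesis by (simp add: resultant_0_gcd)
qed

lemma degree_resultant_le:
  fixes f g :: "'a::idom poly poly poly"
  shows "degree (resultant f g) \<le> (tdeg f + tdeg g) * max (tdeg f) (tdeg g)"
proof -
  have co: "degree (coeff q i) \<le> tdeg q" for q :: "'a poly poly poly" and i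
    using degree_le_lift_deg[of "coeff q i" degree] lift_deg_coeff_le[of "lift_deg degree" q i] by simp
  have "degree (resultant f g) \<le> max (tdeg f) (tdeg g) * (degree f + degree g)"
    unfolding resultant_def
  proof (rule degree_det_le)
    fix i j assume "i < degree f + degree g" "j < degree f + degree g"
    thus "degree (sylvester_mat f g $$ (i, j)) \<le> max (tdeg f) (tdeg g)"
      using co[of f] co[of g] by (auto simp: sylvester_index_mat le_max_iff_disj)
  qed (rule sylvester_carrier_mat)
  also have "\<dots> \<le> max (tdeg f) (tdeg g) * (tdeg f + tdeg g)"
    using degree_le_lift_deg[of f "lift_deg degree"] degree_le_lift_deg[of g "lift_deg degree"]
    by (intro mult_le_mono add_le_mono) auto
  finally show ?thesis by (simp add: mult.commute)
qed

subsection \<open>Polynomials vanishing on many lines\<close>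

text \<open>The line with parameters \<open>(s, b, m, c)\<close> consists of the points \<open>(x, y, z) = (t, s t + b, m t + c)\<close>.\<close>

definition on_line :: "'a::field \<Rightarrow> 'a \<Rightarrow> 'a \<Rightarrow> 'a \<Rightarrow> 'a poly poly poly \<Rightarrow> 'a poly" where
  "on_line s b m c = ev3 (\<lambda>a. [:a:]) [:0, 1:] [:c, m:] [:b, s:]"

lemma const_hom: "comm_ring_hom (\<lambda>a::'a::comm_ring_1. [:a:])" ..

lemma on_line_hom: "comm_ring_hom (on_line s b m c)"
  unfolding on_line_def by (rule ev3_hom[OF const_hom])

lemma degree_on_line_le: "degree (on_line s b m c f) \<le> tdeg f"
  unfolding on_line_def by (rule degree_ev3_le[OF const_hom]) auto

lemma ev2_line: "ev2 (\<lambda>a. [:a:]) [:0, 1:] Z g = poly g (Z :: 'a::comm_ring_1 poly)"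
proof -
  have "ev1 (\<lambda>a. [:a:]) [:0, 1:] h = h" for h :: "'a poly"
    unfolding ev1_def by (induction h) (auto simp: map_poly_pCons)
  hence "map_poly (ev1 (\<lambda>a. [:a:]) [:0, 1:]) g = g" by (intro poly_eqI) (simp add: coeff_map_poly)
  thus ?thesis by (simp add: ev2_def)
qed

text \<open>A line z = m x + c on the plane curve \<open>R\<close> is a root of \<open>R\<close> in
  the domain of polynomials in x, so the degree in z alone bounds the number of lines.\<close>

lemma card_lines_le_degree:
  fixes R :: "'a::field poly poly"
  assumes "R \<noteq> 0" "\<And>m c. (m, c) \<in> S \<Longrightarrow> poly R [:c, m:] = 0"
  shows "finite S" "card S \<le> degree R"
proof -
  let ?h = "\<lambda>(m, c::'a). [:c, m::'a:]"
  have inj: "inj_on ?h S" by (auto intro!: inj_onI)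
  have sub: "?h ` S \<subseteq> {z. poly R z = 0}" using assms(2) by auto
  have fin: "finite {z. poly R z = 0}" by (rule poly_roots_finite[OF assms(1)])
  show "finite S" using finite_subset[OF sub fin] inj by (rule finite_imageD)
  have "card S = card (?h ` S)" by (simp add: card_image[OF inj])
  also have "\<dots> \<le> card {z. poly R z = 0}" by (rule card_mono[OF fin sub])
  also have "\<dots> \<le> degree R" by (rule card_poly_roots_bound[OF assms(1)])
  finally show "card S \<le> degree R" .
qed

text \<open>Eliminating y projects the common lines of the two surfaces to lines of the plane curve
  \<open>resultant f g\<close>. Counting them there requires distinct projections, hence the set
  \<open>S\<close> of pairs (m, c). If \<open>f\<close> did not involve y it would itself be such a
  plane curve, with too many lines on it.\<close>

lemma dvd_if_vanish_on_many_lines: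
  fixes f g :: "'a::field_gcd poly poly poly"
  assumes irr: "irreducible f"
    and S: "\<And>m c. (m, c) \<in> S \<Longrightarrow> \<exists>s b. on_line s b m c f = 0 \<and> on_line s b m c g = 0"
    and card: "(tdeg f + tdeg g) * max (tdeg f) (tdeg g) < card S"
  shows "f dvd g" "0 < degree f"
proof -
  interpret h: comm_ring_hom "ev2 (\<lambda>a::'a. [:a:]) X Z" for X Z by (rule ev2_hom[OF const_hom])
  have pos: "0 < tdeg f" using tdeg_0_imp_unit[of f] irr by (auto simp: irreducible_def)
  show deg: "0 < degree f"
  proof (rule ccontr)
    assume "\<not> 0 < degree f"
    then obtain R where R: "f = [:R:]" by (auto elim: degree_eq_zeroE)
    have "R \<noteq> 0" using irr R by auto
    moreover have "poly R [:c, m:] = 0" if "(m, c) \<in> S" for m c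
    proof -
      from S[OF that] obtain s b where "on_line s b m c f = 0" by blast
      moreover have "on_line s b m c f = ev2 (\<lambda>a. [:a:]) [:0, 1:] [:c, m:] R"
        unfolding R on_line_def ev3_def
        by (simp only: h.map_poly_pCons_hom map_poly_0 poly_pCons poly_0 mult_zero_right add_0_right)
      ultimately show ?thesis by (simp only: ev2_line)
    qed
    ultimately have "card S \<le> degree R" by (rule card_lines_le_degree)
    also have "\<dots> \<le> lift_deg degree R" by (rule degree_le_lift_deg)
    also have "\<dots> \<le> tdeg f" using lift_deg_coeff_le[of "lift_deg degree" f 0] by (simp add: R)
    also have "\<dots> \<le> (tdeg f + tdeg g) * max (tdeg f) (tdeg g)"
      using pos by (metis le_add1 max.cobounded1 mult_le_mono nat_mult_1_right One_nat_def Suc_leI le_trans)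
    finally show False using card by simp
  qed
  show "f dvd g"
  proof (rule ccontr)
    assume "\<not> f dvd g"
    hence "resultant f g \<noteq> 0" by (rule resultant_neq_0[OF irr])
    moreover have "poly (resultant f g) [:c, m:] = 0" if mc: "(m, c) \<in> S" for m c
    proof -
      from S[OF mc] obtain s b where "on_line s b m c f = 0" "on_line s b m c g = 0" by blast
      from resultant_eq_0_at_common_root[OF h.comm_ring_hom_axioms deg this[unfolded on_line_def ev3_def]]
      show ?thesis by (simp only: ev2_line)
    qed
    ultimately have "card S \<le> degree (resultant f g)" by (rule card_lines_le_degree)
    with degree_resultant_le[of f g] card show False by simp
  qed
qed

subsection \<open>Isotropic lines on a surface\<close>

text \<open>A line is given by \<open>(s, b, c)\<close> and has direction \<open>(1, s, s\<^sup>2)\<close> in the coordinates \<open>(x, y, z)\<close>.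
  The directions run through a conic, hence a smooth point of a surface lies on at most two lines
  of the surface.\<close>

abbreviation iso_line :: "'a::field \<Rightarrow> 'a \<Rightarrow> 'a \<Rightarrow> 'a poly poly poly \<Rightarrow> 'a poly" where
  "iso_line s b c \<equiv> on_line s b (s\<^sup>2) c"

text \<open>For distinct slopes this says that the lines meet: it is what remains after eliminating
  the parameter. For equal slopes it says that both lines lie in a common plane tangent to the cone
  of directions (1, s, s^2); in particular every line crosses itself.\<close>

definition cross :: "'a::field \<times> 'a \<times> 'a \<Rightarrow> 'a \<times> 'a \<times> 'a \<Rightarrow> bool" where
  "cross = (\<lambda>(s, b, c) (s', b', c'). c' - c = (s + s') * (b' - b))"

definition crossing_time :: "'a::field \<times> 'a \<times> 'a \<Rightarrow> 'a \<times> 'a \<times> 'a \<Rightarrow> 'a" where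
  "crossing_time = (\<lambda>(s, b, c) (s', b', c'). (b' - b) / (s - s'))"

lemma crossD:
  assumes "cross (s, b, c) (s', b', c')" "s \<noteq> s'"
  defines "t \<equiv> crossing_time (s, b, c) (s', b', c')"
  shows "b + s * t = b' + s' * t" "c + s\<^sup>2 * t = c' + s'\<^sup>2 * t"
proof -
  have *: "(s - s') * t = b' - b" using assms(2) by (simp add: t_def crossing_time_def)
  show "b + s * t = b' + s' * t" using * by (simp add: algebra_simps)
  have "c' - c = (s + s') * ((s - s') * t)" using assms(1) * by (simp add: cross_def)
  thus "c + s\<^sup>2 * t = c' + s'\<^sup>2 * t" by (simp add: algebra_simps power2_eq_square)
qed

lemma poly_on_line: "poly (on_line s b m c f) t = ev3 (\<lambda>a. a) t (c + m * t) (b + s * t) f"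
proof -
  have h: "comm_ring_hom (\<lambda>p::'a poly. poly p t)" by unfold_locales auto
  have "poly (on_line s b m c f) t =
    ev3 ((\<lambda>p. poly p t) \<circ> (\<lambda>a. [:a:])) (poly [:0, 1:] t) (poly [:c, m:] t) (poly [:b, s:] t) f"
    unfolding on_line_def by (rule ev3_comp[OF h const_hom])
  thus ?thesis by (simp add: comp_def mult.commute)
qed

text \<open>The parameter on every line is the x-coordinate, so the crossing point belongs to the
  same \<open>t\<close> on both lines.\<close>

lemma poly_iso_line_crossing:
  assumes "cross (s, b, c) (s', b', c')" "s \<noteq> s'"
  defines "t \<equiv> crossing_time (s, b, c) (s', b', c')"
  shows "poly (iso_line s' b' c' f) t = poly (iso_line s b c f) t"
  using crossD[OF assms(1,2)] by (simp add: poly_on_line t_def)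

lemma pderiv_iso_line:
  "pderiv (iso_line s b c f) = iso_line s b c (dx f) + smult s (iso_line s b c (dy f)) + smult (s\<^sup>2) (iso_line s b c (dz f))"
  unfolding on_line_def by (subst pderiv_ev3[OF const_hom]) (simp_all add: pderiv_pCons algebra_simps)

subsubsection \<open>The second derivative along a direction, modulo the first\<close>

text \<open>With \<open>q = q0 + q1 \<sigma> + q2 \<sigma>\<^sup>2\<close> the derivative of \<open>f\<close> in direction \<open>(1, \<sigma>, \<sigma>\<^sup>2)\<close> and
  \<open>A0 + \<dots> + A4 \<sigma>\<^sup>4\<close> the second one, \<open>rem1 \<sigma> + rem0\<close> is the remainder of \<open>q2\<^sup>3\<close> times the second
  derivative upon division by \<open>q\<close>. It vanishes wherever two lines of the surface meet.\<close>

definition A0 where "A0 f = dx (dx f)"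
definition A1 where "A1 f = dx (dy f) + dy (dx f)"
definition A2 where "A2 f = dx (dz f) + dy (dy f) + dz (dx f)"
definition A3 where "A3 f = dy (dz f) + dz (dy f)"
definition A4 where "A4 f = dz (dz f)"

definition rem1 where
  "rem1 f = (let q0 = dx f; q1 = dy f; q2 = dz f in
    q2 ^ 3 * A1 f - q2 ^ 2 * q1 * A2 f + q2 * (q1 ^ 2 - q0 * q2) * A3 f + (2 * q0 * q1 * q2 - q1 ^ 3) * A4 f)"
definition rem0 where
  "rem0 f = (let q0 = dx f; q1 = dy f; q2 = dz f in
    q2 ^ 3 * A0 f - q2 ^ 2 * q0 * A2 f + q2 * q0 * q1 * A3 f + (q0 ^ 2 * q2 - q0 * q1 ^ 2) * A4 f)"

text \<open>The slope is homogenised to v / u because it is used both with a constant slope (u = 1)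
  and with the slope \<open>n / D\<close> of the second tangent direction, where no division is
  available.\<close>

lemma pseudo_division:
  fixes q0 q1 q2 :: "'b::idom"
  shows "q2 ^ 3 * (u ^ 4 * a0 + u ^ 3 * v * a1 + u ^ 2 * v ^ 2 * a2 + u * v ^ 3 * a3 + v ^ 4 * a4) =
    (u ^ 2 * q0 + u * v * q1 + v ^ 2 * q2) *
      (u ^ 2 * q2 ^ 2 * a2 + (q2 ^ 2 * u * v - q2 * q1 * u ^ 2) * a3
        + (q2 ^ 2 * v ^ 2 - q1 * q2 * u * v + (q1 ^ 2 - q0 * q2) * u ^ 2) * a4)
    + u ^ 3 * v * (q2 ^ 3 * a1 - q2 ^ 2 * q1 * a2 + q2 * (q1 ^ 2 - q0 * q2) * a3 + (2 * q0 * q1 * q2 - q1 ^ 3) * a4)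
    + u ^ 4 * (q2 ^ 3 * a0 - q2 ^ 2 * q0 * a2 + q2 * q0 * q1 * a3 + (q0 ^ 2 * q2 - q0 * q1 ^ 2) * a4)"
  by Groebner_Basis.algebra

lemma tdeg_second: "tdeg (A0 f) \<le> tdeg f" "tdeg (A1 f) \<le> tdeg f" "tdeg (A2 f) \<le> tdeg f"
  "tdeg (A3 f) \<le> tdeg f" "tdeg (A4 f) \<le> tdeg f"
  unfolding A0_def A1_def A2_def A3_def A4_def
  by (rule order_trans[OF tdeg.add] max.boundedI tdeg_dx tdeg_dy tdeg_dz
      tdeg_dx[THEN order_trans] tdeg_dy[THEN order_trans] tdeg_dz[THEN order_trans])+

lemma tdeg_mult_leI: "tdeg a \<le> m \<Longrightarrow> tdeg b \<le> n \<Longrightarrow> m + n \<le> k \<Longrightarrow> tdeg (a * b) \<le> k"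
  using tdeg.mult_le[of a b] by linarith
lemma tdeg_add_leI: "tdeg a \<le> k \<Longrightarrow> tdeg b \<le> k \<Longrightarrow> tdeg (a + b) \<le> k"
  using tdeg.add[of a b] by linarith
lemma tdeg_diff_leI: "tdeg a \<le> k \<Longrightarrow> tdeg b \<le> k \<Longrightarrow> tdeg (a - b) \<le> k"
  using tdeg.diff[of a b] by linarith
lemma tdeg_power_leI: "tdeg a \<le> m \<Longrightarrow> n * m \<le> k \<Longrightarrow> tdeg (a ^ n) \<le> k"
proof -
  assume a: "tdeg a \<le> m" and k: "n * m \<le> k"
  have "tdeg (a ^ n) \<le> n * m"
  proof (induction n)
    case (Suc n) thus ?case using tdeg_mult_leI[OF a Suc] by simp
  qed simp
  with k show ?thesis by simp
qed

lemma tdeg_rem: "tdeg (rem1 f) \<le> 4 * tdeg f" "tdeg (rem0 f) \<le> 4 * tdeg f"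
proof -
  note d = tdeg_dx[of f] tdeg_dy[of f] tdeg_dz[of f] tdeg_second[of f]
  have two: "tdeg (2 :: 'a poly poly poly) \<le> 0" using tdeg.of_nat[of 2] by simp
  show "tdeg (rem1 f) \<le> 4 * tdeg f"
    unfolding rem1_def Let_def
    by (intro tdeg_add_leI tdeg_diff_leI tdeg_mult_leI[where m = "3 * tdeg f" and n = "tdeg f"]
        tdeg_mult_leI[where m = "2 * tdeg f" and n = "tdeg f" and k = "3 * tdeg f"]
        tdeg_mult_leI[where m = "tdeg f" and n = "2 * tdeg f" and k = "3 * tdeg f"]
        tdeg_mult_leI[where m = "tdeg f" and n = "tdeg f" and k = "2 * tdeg f"]
        tdeg_mult_leI[where m = 0 and n = "tdeg f" and k = "tdeg f"]
        tdeg_power_leI[where m = "tdeg f"] d two) auto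
  show "tdeg (rem0 f) \<le> 4 * tdeg f"
    unfolding rem0_def Let_def
    by (intro tdeg_add_leI tdeg_diff_leI tdeg_mult_leI[where m = "3 * tdeg f" and n = "tdeg f"]
        tdeg_mult_leI[where m = "2 * tdeg f" and n = "tdeg f" and k = "3 * tdeg f"]
        tdeg_mult_leI[where m = "tdeg f" and n = "2 * tdeg f" and k = "3 * tdeg f"]
        tdeg_mult_leI[where m = "tdeg f" and n = "tdeg f" and k = "2 * tdeg f"]
        tdeg_power_leI[where m = "tdeg f"] d two) auto
qed

lemma pderiv2_iso_line:
  "pderiv (pderiv (iso_line s b c f)) = iso_line s b c (A0 f) + smult s (iso_line s b c (A1 f)) + smult (s\<^sup>2) (iso_line s b c (A2 f))
    + smult (s ^ 3) (iso_line s b c (A3 f)) + smult (s ^ 4) (iso_line s b c (A4 f))"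
proof -
  interpret h: comm_ring_hom "iso_line s b c" by (rule on_line_hom)
  show ?thesis
    unfolding A0_def A1_def A2_def A3_def A4_def h.hom_add
    by (simp add: pderiv_iso_line pderiv_add pderiv_smult smult_add_right)
      (simp add: algebra_simps power2_eq_square power3_eq_cube power4_eq_xxxx)
qed

text \<open>At the crossing both \<open>s\<close> and \<open>s'\<close> are roots of the first and
  of the second derivative as polynomials in the slope, hence of the remainder, which is linear and
  so must be zero.\<close>

lemma rem_vanish_at_crossing:
  assumes f: "iso_line s b c f = 0" "iso_line s' b' c' f = 0"
    and cr: "cross (s, b, c) (s', b', c')" "s \<noteq> s'"
  defines "t \<equiv> crossing_time (s, b, c) (s', b', c')"
  shows "poly (iso_line s b c (rem1 f)) t = 0" "poly (iso_line s b c (rem0 f)) t = 0"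
proof -
  define e where "e g = poly (iso_line s b c g) t" for g
  interpret e: comm_ring_hom e
  proof -
    interpret h: comm_ring_hom "iso_line s b c" by (rule on_line_hom)
    show "comm_ring_hom e" by unfold_locales (auto simp: e_def h.hom_add h.hom_mult)
  qed
  have e': "poly (iso_line s' b' c' g) t = e g" for g
    using poly_iso_line_crossing[OF cr, of g] by (simp add: e_def t_def)
  have 1: "e (dx f) + s * e (dy f) + s\<^sup>2 * e (dz f) = 0"
    using arg_cong[OF pderiv_iso_line[of s b c f], of "\<lambda>p. poly p t"] by (simp add: f e_def)
  have 2: "e (dx f) + s' * e (dy f) + s'\<^sup>2 * e (dz f) = 0"
    using arg_cong[OF pderiv_iso_line[of s' b' c' f], of "\<lambda>p. poly p t"] by (simp add: f e')
  have 3: "e (A0 f) + s * e (A1 f) + s\<^sup>2 * e (A2 f) + s ^ 3 * e (A3 f) + s ^ 4 * e (A4 f) = 0"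
    using arg_cong[OF pderiv2_iso_line[of s b c f], of "\<lambda>p. poly p t"] by (simp add: f e_def)
  have 4: "e (A0 f) + s' * e (A1 f) + s'\<^sup>2 * e (A2 f) + s' ^ 3 * e (A3 f) + s' ^ 4 * e (A4 f) = 0"
    using arg_cong[OF pderiv2_iso_line[of s' b' c' f], of "\<lambda>p. poly p t"] by (simp add: f e')
  have r1: "e (rem1 f) = e (dz f) ^ 3 * e (A1 f) - e (dz f) ^ 2 * e (dy f) * e (A2 f)
      + e (dz f) * (e (dy f) ^ 2 - e (dx f) * e (dz f)) * e (A3 f)
      + (2 * e (dx f) * e (dy f) * e (dz f) - e (dy f) ^ 3) * e (A4 f)"
    unfolding rem1_def Let_def by (simp add: hom_distribs)
  have r0: "e (rem0 f) = e (dz f) ^ 3 * e (A0 f) - e (dz f) ^ 2 * e (dx f) * e (A2 f)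
      + e (dz f) * e (dx f) * e (dy f) * e (A3 f)
      + (e (dx f) ^ 2 * e (dz f) - e (dx f) * e (dy f) ^ 2) * e (A4 f)"
    unfolding rem0_def Let_def by (simp add: hom_distribs)
  note D = pseudo_division[of "e (dz f)" 1 "e (A0 f)" _ "e (A1 f)" "e (A2 f)" "e (A3 f)" "e (A4 f)" "e (dx f)" "e (dy f)",
      folded r1 r0, unfolded power_one mult_1 mult_1_right, folded r1 r0]
  have 5: "s * e (rem1 f) + e (rem0 f) = 0" using D[of s] 1 3 by simp
  have 6: "s' * e (rem1 f) + e (rem0 f) = 0" using D[of s'] 2 4 by simp
  from 5 6 have "(s - s') * e (rem1 f) = 0" by Groebner_Basis.algebra
  with cr(2) have "e (rem1 f) = 0" by simp
  with 5 show "poly (iso_line s b c (rem1 f)) t = 0" "poly (iso_line s b c (rem0 f)) t = 0" by (auto simp: e_def)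
qed

subsection \<open>The second line through a point\<close>

text \<open>If m \<ge> 2 is the lowest exponent occurring in \<open>\<phi>\<close>, comparing
  coefficients of order m - 2 leaves only a(0) m (m - 1) times that coefficient. The characteristic
  condition keeps m (m - 1) invertible.\<close>

lemma second_order_ode_unique:
  fixes a b g \<phi> :: "'r::idom poly"
  assumes ode: "a * pderiv (pderiv \<phi>) = b * pderiv \<phi> + g * \<phi>"
    and a: "poly a 0 \<noteq> 0" and init: "poly \<phi> 0 = 0" "poly (pderiv \<phi>) 0 = 0"
    and char: "\<And>k. 0 < k \<Longrightarrow> k \<le> degree \<phi> \<Longrightarrow> of_nat k \<noteq> (0 :: 'r)"
  shows "\<phi> = 0"
proof (rule ccontr)
  assume "\<phi> \<noteq> 0"
  define m where "m = (LEAST i. coeff \<phi> i \<noteq> 0)"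
  have m: "coeff \<phi> m \<noteq> 0" unfolding m_def by (rule LeastI[of _ "degree \<phi>"]) (use \<open>\<phi> \<noteq> 0\<close> in simp)
  have low: "coeff \<phi> i = 0" if "i < m" for i using not_less_Least[of i] that unfolding m_def by blast
  have "coeff \<phi> 0 = 0" "coeff \<phi> 1 = 0"
    using init by (auto simp: poly_0_coeff_0 coeff_pderiv)
  with m have "m \<noteq> 0" "m \<noteq> 1" by metis+
  then obtain n where n: "m = Suc (Suc n)" by (metis One_nat_def old.nat.exhaust)
  have "coeff (a * pderiv (pderiv \<phi>)) n = (\<Sum>i\<le>n. if i = 0 then coeff a 0 * coeff (pderiv (pderiv \<phi>)) n else 0)"
    unfolding coeff_mult by (rule sum.cong) (auto simp: coeff_pderiv low n)
  also have "\<dots> = coeff a 0 * (of_nat (Suc n) * of_nat m * coeff \<phi> m)"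
    by (simp add: coeff_pderiv n mult_ac del: of_nat_Suc)
  finally have "coeff (a * pderiv (pderiv \<phi>)) n = coeff a 0 * (of_nat (Suc n) * of_nat m * coeff \<phi> m)" .
  moreover have "coeff (b * pderiv \<phi> + g * \<phi>) n = 0"
    unfolding coeff_mult coeff_add by (simp add: coeff_pderiv low n)
  moreover have "of_nat (Suc n) \<noteq> (0 :: 'r)" "of_nat m \<noteq> (0 :: 'r)"
    using char le_degree[OF m] n by (auto simp del: of_nat_Suc)
  ultimately show False using ode m a by (auto simp: poly_0_coeff_0 simp del: of_nat_Suc)
qed

text \<open>The line through the generic point of \<open>(s, b, c)\<close>, with parameter \<open>t\<close>, in direction
  \<open>(D\<^sup>2, D n, n\<^sup>2)\<close>, i.e. of slope \<open>n / D\<close>; the parameter along it is the outer variable.\<close>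

definition generic_line :: "'a::field \<Rightarrow> 'a \<Rightarrow> 'a \<Rightarrow> 'a poly \<Rightarrow> 'a poly \<Rightarrow> 'a poly poly poly \<Rightarrow> 'a poly poly" where
  "generic_line s b c D n =
    ev3 (\<lambda>a. [:[:a:]:]) [:[:0, 1:], D\<^sup>2:] [:[:c, s\<^sup>2:], n\<^sup>2:] [:[:b, s:], D * n:]"

lemma const2_hom: "comm_ring_hom (\<lambda>a::'a::comm_ring_1. [:[:a:]:])"
  by unfold_locales (simp_all add: pCons_one)

lemma generic_line_hom: "comm_ring_hom (generic_line s b c D n)"
  unfolding generic_line_def by (rule ev3_hom[OF const2_hom])

lemma poly_generic_line_0: "poly (generic_line s b c D n g) 0 = iso_line s b c g"
proof -
  have h: "comm_ring_hom (\<lambda>p::'a poly poly. poly p 0)" by unfold_locales auto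
  have "poly (generic_line s b c D n g) 0 = ev3 ((\<lambda>p. poly p 0) \<circ> (\<lambda>a. [:[:a:]:]))
      (poly [:[:0, 1:], D\<^sup>2:] 0) (poly [:[:c, s\<^sup>2:], n\<^sup>2:] 0) (poly [:[:b, s:], D * n:] 0) g"
    unfolding generic_line_def by (rule ev3_comp[OF h const2_hom])
  thus ?thesis by (simp add: comp_def on_line_def)
qed

lemma pderiv_generic_line:
  "pderiv (generic_line s b c D n g) = [:D:]\<^sup>2 * generic_line s b c D n (dx g)
    + [:D:] * [:n:] * generic_line s b c D n (dy g) + [:n:]\<^sup>2 * generic_line s b c D n (dz g)"
  unfolding generic_line_def
  by (subst pderiv_ev3[OF const2_hom]) (simp_all add: pderiv_pCons power2_eq_square mult_ac)

lemma pderiv2_generic_line: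
  "pderiv (pderiv (generic_line s b c D n f)) = [:D:] ^ 4 * generic_line s b c D n (A0 f)
    + [:D:] ^ 3 * [:n:] * generic_line s b c D n (A1 f) + [:D:]\<^sup>2 * [:n:]\<^sup>2 * generic_line s b c D n (A2 f)
    + [:D:] * [:n:] ^ 3 * generic_line s b c D n (A3 f) + [:n:] ^ 4 * generic_line s b c D n (A4 f)"
proof -
  interpret h: comm_ring_hom "generic_line s b c D n" by (rule generic_line_hom)
  have const: "pderiv ([:D:]\<^sup>2) = 0" "pderiv ([:D:] * [:n:]) = 0" "pderiv ([:n:]\<^sup>2) = 0"
    by (simp_all add: pderiv_mult pderiv_pCons power2_eq_square)
  have X: "pderiv (pderiv (generic_line s b c D n f)) = [:D:]\<^sup>2 * pderiv (generic_line s b c D n (dx f))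
    + [:D:] * [:n:] * pderiv (generic_line s b c D n (dy f)) + [:n:]\<^sup>2 * pderiv (generic_line s b c D n (dz f))"
    unfolding pderiv_generic_line[of s b c D n f] by (simp only: pderiv_add pderiv_mult[of "_ * _" "generic_line _ _ _ _ _ _"]
      pderiv_mult[of "_ ^ 2" "generic_line _ _ _ _ _ _"] const mult_zero_right add_0_right)
  show ?thesis
    unfolding X unfolding A0_def A1_def A2_def A3_def A4_def h.hom_add pderiv_generic_line
    by Groebner_Basis.algebra
qed

lemma degree_generic_line_le: "degree (generic_line s b c D n g) \<le> tdeg g"
  unfolding generic_line_def by (rule degree_ev3_le[OF const2_hom]) auto

text \<open>\<open>q2\<close> and \<open>-q1 - s q2\<close> are denominator and numerator of the slope other than \<open>s\<close>
  of an isotropic tangent direction.\<close>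

lemma second_line_on_surface:
  fixes f :: "'a::field_gcd poly poly poly"
  assumes rem: "f dvd rem1 f" "f dvd rem0 f"
    and line: "iso_line s b c f = 0"
    and char: "\<And>k. 0 < k \<Longrightarrow> k \<le> tdeg f \<Longrightarrow> of_nat k \<noteq> (0 :: 'a)"
  defines "D \<equiv> iso_line s b c (dz f)" and "n \<equiv> - iso_line s b c (dy f) - smult s (iso_line s b c (dz f))"
  assumes D: "D \<noteq> 0"
  shows "generic_line s b c D n f = 0"
proof -
  define G where "G = generic_line s b c D n"
  interpret G: comm_ring_hom G unfolding G_def by (rule generic_line_hom)
  obtain g1 g0 where g: "rem1 f = f * g1" "rem0 f = f * g0" using rem by (auto elim!: dvdE)
  note d1 = pderiv_generic_line[of s b c D n f, folded G_def]
  note d2 = pderiv2_generic_line[of s b c D n f, folded G_def]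
  have r1: "G f * G g1 = G (dz f) ^ 3 * G (A1 f) - G (dz f) ^ 2 * G (dy f) * G (A2 f)
      + G (dz f) * (G (dy f) ^ 2 - G (dx f) * G (dz f)) * G (A3 f)
      + (2 * G (dx f) * G (dy f) * G (dz f) - G (dy f) ^ 3) * G (A4 f)"
    using arg_cong[OF g(1), of G, symmetric] unfolding rem1_def Let_def by (simp add: hom_distribs)
  have r0: "G f * G g0 = G (dz f) ^ 3 * G (A0 f) - G (dz f) ^ 2 * G (dx f) * G (A2 f)
      + G (dz f) * G (dx f) * G (dy f) * G (A3 f)
      + (G (dx f) ^ 2 * G (dz f) - G (dx f) * G (dy f) ^ 2) * G (A4 f)"
    using arg_cong[OF g(2), of G, symmetric] unfolding rem0_def Let_def by (simp add: hom_distribs)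
  note D' = pseudo_division[of "G (dz f)" "[:D:]" "G (A0 f)" "[:n:]" "G (A1 f)" "G (A2 f)" "G (A3 f)" "G (A4 f)"
      "G (dx f)" "G (dy f)", folded r1 r0]
  define Q where "Q = [:D:] ^ 2 * G (dz f) ^ 2 * G (A2 f)
    + (G (dz f) ^ 2 * [:D:] * [:n:] - G (dz f) * G (dy f) * [:D:] ^ 2) * G (A3 f)
    + (G (dz f) ^ 2 * [:n:] ^ 2 - G (dy f) * G (dz f) * [:D:] * [:n:] + (G (dy f) ^ 2 - G (dx f) * G (dz f)) * [:D:] ^ 2) * G (A4 f)"
  show ?thesis unfolding G_def[symmetric]
  proof (rule second_order_ode_unique)
    \<comment> \<open>On the generic line the first and second derivatives of \<open>f\<close> along
      its direction are the derivatives of \<open>G f\<close>. Since \<open>f\<close> divides both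
      remainders, the pseudo-division becomes a linear differential equation for
      \<open>G f\<close>.\<close>
    show "G (dz f) ^ 3 * pderiv (pderiv (G f)) = Q * pderiv (G f)
        + ([:D:] ^ 3 * [:n:] * G g1 + [:D:] ^ 4 * G g0) * G f"
      unfolding d2 unfolding d1 D' Q_def[symmetric] by (simp only: algebra_simps)
    show "poly (G (dz f) ^ 3) 0 \<noteq> 0" using D by (simp add: G_def poly_generic_line_0 D_def)
    show "poly (G f) 0 = 0" by (simp add: G_def poly_generic_line_0 line)
    \<comment> \<open>One root of the quadratic for the tangent slopes is \<open>s\<close>, as
      \<open>f\<close> vanishes on the line; the other is then n / D, which makes the first
      derivative at parameter 0 vanish.\<close>
    have "iso_line s b c (dx f) + smult s (iso_line s b c (dy f)) + smult (s\<^sup>2) D = 0"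
      using pderiv_iso_line[of s b c f] by (simp add: line D_def)
    hence q0: "iso_line s b c (dx f) = - [:s:] * iso_line s b c (dy f) - [:s:]\<^sup>2 * D"
      by (simp add: power2_eq_square algebra_simps eq_neg_iff_add_eq_0)
    have n: "n = - iso_line s b c (dy f) - [:s:] * D" by (simp add: n_def D_def)
    have "poly (pderiv (G f)) 0 = D\<^sup>2 * iso_line s b c (dx f) + D * n * iso_line s b c (dy f) + n\<^sup>2 * D"
      unfolding d1 by (simp add: G_def poly_generic_line_0 D_def)
    also have "\<dots> = 0" unfolding q0 n by Groebner_Basis.algebra
    finally show "poly (pderiv (G f)) 0 = 0" .
    fix k assume "0 < k" "k \<le> degree (G f)"
    with char[of k] degree_generic_line_le[of s b c D n f] show "of_nat k \<noteq> (0 :: 'a poly)"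
      by (simp add: G_def of_nat_poly)
  qed
qed

text \<open>The projections of the second lines sweep out the whole (x, z)-plane, so no nonzero
  \<open>R\<close> vanishes on all of them. If \<open>R\<close> vanishes on the projected base line,
  divide by z - s^2 x - c, whose image is n^2 - s^2 D^2 times the parameter and nonzero by
  \<open>W\<close>; otherwise parameter 0 already shows the claim.\<close>

lemma ev2_generic_line_neq_0:
  fixes R :: "'a::field poly poly"
  assumes W: "n\<^sup>2 \<noteq> smult (s\<^sup>2) (D\<^sup>2)"
  shows "R \<noteq> 0 \<Longrightarrow> ev2 (\<lambda>a. [:[:a:]:]) [:[:0, 1:], D\<^sup>2:] [:[:c, s\<^sup>2:], n\<^sup>2:] R \<noteq> 0"
proof (induction "degree R" arbitrary: R rule: less_induct)
  case less
  let ?E = "ev2 (\<lambda>a. [:[:a:]:]) [:[:0, 1:], D\<^sup>2:] [:[:c, s\<^sup>2:], n\<^sup>2:]"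
  interpret E: comm_ring_hom ?E by (rule ev2_hom[OF const2_hom])
  interpret E1: comm_ring_hom "ev1 (\<lambda>a::'a. [:[:a:]:]) [:[:0, 1:], D\<^sup>2:]" by (rule ev1_hom[OF const2_hom])
  interpret K: comm_ring_hom "\<lambda>a::'a. [:[:a:]:]" by (rule const2_hom)
  let ?l = "[:c, s\<^sup>2:] :: 'a poly"
  have h: "comm_ring_hom (\<lambda>p::'a poly poly. poly p 0)" by unfold_locales auto
  show ?case
  proof (cases "poly R ?l = 0")
    case False
    have "poly (?E R) 0 = ev2 (\<lambda>a. [:a:]) [:0, 1:] ?l R"
    proof -
      have 1: "(\<lambda>p. poly p 0) \<circ> ev1 (\<lambda>a. [:[:a:]:]) [:[:0, 1:], D\<^sup>2:] = ev1 (\<lambda>a::'a. [:a:]) [:0, 1:]"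
        unfolding ev1_def comp_def using hom_eval[OF h const2_hom] by (auto simp: comp_def)
      show ?thesis
        using hom_eval[OF h ev1_hom[OF const2_hom]] unfolding ev2_def 1[symmetric] by (auto simp: comp_def)
    qed
    with False have "poly (?E R) 0 \<noteq> 0" by (simp only: ev2_line not_False_eq_True)
    thus ?thesis by (metis poly_0)
  next
    case True
    then obtain R' where R: "R = [:- ?l, 1:] * R'" by (auto simp: poly_eq_0_iff_dvd)
    with less.prems have "R' \<noteq> 0" by auto
    hence "degree R' < degree R" unfolding R by (subst degree_mult_eq) auto
    from less.hyps[OF this \<open>R' \<noteq> 0\<close>] have IH: "?E R' \<noteq> 0" .
    have "?E [:- ?l, 1:] = [:0, n\<^sup>2 - smult (s\<^sup>2) (D\<^sup>2):]"
      unfolding ev2_def E1.map_poly_pCons_hom map_poly_0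
      by (simp add: ev1_def K.map_poly_pCons_hom)
    hence "?E [:- ?l, 1:] \<noteq> 0" using W by simp
    with IH show ?thesis unfolding R E.hom_mult by simp
  qed
qed

text \<open>\<open>pencil f (s, b, c)\<close> is the derivative of \<open>f\<close> at a point in the direction of the isotropic
  line joining the point to the line \<open>(s, b, c)\<close>; that line has slope \<open>v / u\<close>.\<close>

definition pencil_u :: "'a::field \<Rightarrow> 'a \<Rightarrow> 'a poly poly poly" where
  "pencil_u s b = [:[:[:- b, - s:]:], 1:]"
definition pencil_v :: "'a::field \<Rightarrow> 'a \<Rightarrow> 'a \<Rightarrow> 'a poly poly poly" where
  "pencil_v s b c = [:[:[:- c, - s\<^sup>2:], 1:]:] - [:[:[:s:]:]:] * pencil_u s b"
definition pencil :: "'a::field \<Rightarrow> 'a \<Rightarrow> 'a \<Rightarrow> 'a poly poly poly \<Rightarrow> 'a poly poly poly" where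
  "pencil s b c f = dx f * pencil_u s b ^ 2 + dy f * pencil_u s b * pencil_v s b c + dz f * pencil_v s b c ^ 2"

lemma ev3_pencil_u: "comm_ring_hom k \<Longrightarrow> ev3 k X Z Y (pencil_u s b) = Y - k s * X - k b"
proof -
  assume k: "comm_ring_hom k"
  interpret k: comm_ring_hom k by fact
  interpret h1: comm_ring_hom "ev1 k X" by (rule ev1_hom[OF k])
  interpret h2: comm_ring_hom "ev2 k X Z" by (rule ev2_hom[OF k])
  show ?thesis unfolding ev3_def pencil_u_def h2.map_poly_pCons_hom map_poly_0
    by (simp add: ev2_def h1.map_poly_pCons_hom ev1_def k.map_poly_pCons_hom k.hom_uminus algebra_simps)
qed

text \<open>If the isotropic line of slope q through (x, y, z) meets the given line at parameter x -
  r, then u = y - s x - b = (q - s) r and z - s^2 x - c = (q^2 - s^2) r = (q + s) u. Subtracting s u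
  leaves v = q u.\<close>

lemma ev3_pencil_v: "comm_ring_hom k \<Longrightarrow>
  ev3 k X Z Y (pencil_v s b c) = Z - k s ^ 2 * X - k c - k s * (Y - k s * X - k b)"
proof -
  assume k: "comm_ring_hom k"
  interpret k: comm_ring_hom k by fact
  interpret h1: comm_ring_hom "ev1 k X" by (rule ev1_hom[OF k])
  interpret h2: comm_ring_hom "ev2 k X Z" by (rule ev2_hom[OF k])
  interpret h3: comm_ring_hom "ev3 k X Z Y" by (rule ev3_hom[OF k])
  have "ev3 k X Z Y [:[:[:- c, - s\<^sup>2:], 1:]:] = Z - k s ^ 2 * X - k c"
    unfolding ev3_def h2.map_poly_pCons_hom map_poly_0
    by (simp add: ev2_def h1.map_poly_pCons_hom ev1_def k.map_poly_pCons_hom k.hom_uminus k.hom_power algebra_simps)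
  moreover have "ev3 k X Z Y [:[:[:s:]:]:] = k s"
    unfolding ev3_def h2.map_poly_pCons_hom map_poly_0
    by (simp add: ev2_def h1.map_poly_pCons_hom ev1_def k.map_poly_pCons_hom)
  ultimately show ?thesis
    unfolding pencil_v_def h3.hom_minus h3.hom_mult by (simp add: ev3_pencil_u[OF k])
qed

text \<open>Both \<open>f\<close> and its pencil vanish on the second lines through the generic
  point of the base line. These project onto a dense part of the plane, so the resultant is zero and
  the irreducible \<open>f\<close> divides. The conditions \<open>q1\<close> and \<open>disc\<close>
  say that the second slope n / D is neither -s nor s, so that its square differs from s^2.\<close>

lemma dvd_pencil:
  fixes f :: "'a::field_gcd poly poly poly"
  assumes irr: "irreducible f" and deg: "0 < degree f"
    and rem: "f dvd rem1 f" "f dvd rem0 f"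
    and line: "iso_line s b c f = 0"
    and char: "\<And>k. 0 < k \<Longrightarrow> k \<le> tdeg f \<Longrightarrow> of_nat k \<noteq> (0 :: 'a)"
    and q2: "iso_line s b c (dz f) \<noteq> 0" and q1: "iso_line s b c (dy f) \<noteq> 0"
    and disc: "iso_line s b c (dy f) + smult (2 * s) (iso_line s b c (dz f)) \<noteq> 0"
  shows "f dvd pencil s b c f"
proof (rule ccontr)
  assume ndvd: "\<not> f dvd pencil s b c f"
  define D n where "D = iso_line s b c (dz f)" and "n = - iso_line s b c (dy f) - smult s (iso_line s b c (dz f))"
  have f0: "generic_line s b c D n f = 0"
    unfolding D_def n_def using q2 by (intro second_line_on_surface rem line char) auto
  define G where "G = generic_line s b c D n"
  interpret G: comm_ring_hom G unfolding G_def by (rule generic_line_hom)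
  \<comment> \<open>From a point of a second line, the line joining it to the base line is that
    second line, so (u, v) is proportional to (D, n).\<close>
  have u: "G (pencil_u s b) = [:0, D:] * [:n - smult s D:]"
    unfolding G_def generic_line_def ev3_pencil_u[OF const2_hom]
    by (simp add: power2_eq_square algebra_simps)
  have v: "G (pencil_v s b c) = [:0, n:] * [:n - smult s D:]"
    unfolding G_def generic_line_def ev3_pencil_v[OF const2_hom]
    by (simp add: power2_eq_square algebra_simps)
  have "G (pencil s b c f) = [:0, 1:]\<^sup>2 * [:n - smult s D:]\<^sup>2 *
      ([:D:]\<^sup>2 * G (dx f) + [:D:] * [:n:] * G (dy f) + [:n:]\<^sup>2 * G (dz f))"
  proof -
    have *: "[:0, D:] = [:0, 1:] * [:D:]" "[:0, n:] = [:0, 1:] * [:n:]" by auto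
    show ?thesis
      unfolding pencil_def G.hom_add G.hom_mult G.hom_power u v * by Groebner_Basis.algebra
  qed
  also have "[:D:]\<^sup>2 * G (dx f) + [:D:] * [:n:] * G (dy f) + [:n:]\<^sup>2 * G (dz f) = 0"
    using pderiv_generic_line[of s b c D n f] by (simp add: f0 G_def)
  finally have h0: "G (pencil s b c f) = 0" by simp
  have "n\<^sup>2 - smult (s\<^sup>2) (D\<^sup>2) = (n - smult s D) * (n + smult s D)"
    by (simp add: power2_eq_square algebra_simps)
  moreover have "n + smult s D = - iso_line s b c (dy f)" by (simp add: n_def D_def)
  moreover have "n - smult s D = - (iso_line s b c (dy f) + smult (2 * s) (iso_line s b c (dz f)))"
  proof -
    have "smult (2 * s) p = smult s p + smult s p" for p :: "'a poly"
      by (metis smult_add_left mult_2)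
    thus ?thesis by (simp add: n_def D_def)
  qed
  ultimately have "n\<^sup>2 - smult (s\<^sup>2) (D\<^sup>2) \<noteq> 0" using q1 disc by (simp add: neg_eq_iff_add_eq_0)
  hence W: "n\<^sup>2 \<noteq> smult (s\<^sup>2) (D\<^sup>2)" by auto
  let ?E = "ev2 (\<lambda>a. [:[:a:]:]) [:[:0, 1:], D\<^sup>2:] [:[:c, s\<^sup>2:], n\<^sup>2:]"
  have "?E (resultant f (pencil s b c f)) = 0"
    using resultant_eq_0_at_common_root[OF ev2_hom[OF const2_hom] deg]
      f0[unfolded generic_line_def ev3_def] h0[unfolded G_def generic_line_def ev3_def] by blast
  with ev2_generic_line_neq_0[OF W resultant_neq_0[OF irr ndvd]] show False by blast
qed

text \<open>At the crossing of the two lines the quadratic of tangent slopes has roots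
  \<open>s2\<close> and \<open>s\<close>, so the pencil factors as \<open>dz f\<close> times (v - s2
  u) (v - s u). A vanishing factor says that the line through the point with that slope crosses the
  first line.\<close>

lemma pencil_at_crossing:
  assumes p: "poly (iso_line s2 b2 c2 (pencil s1 b1 c1 f)) t = 0"
    and t: "t = crossing_time (s2, b2, c2) (s, b, c)"
    and cr: "cross (s2, b2, c2) (s, b, c)" "s2 \<noteq> s"
    and f: "iso_line s2 b2 c2 f = 0" "iso_line s b c f = 0"
    and q2: "poly (iso_line s2 b2 c2 (dz f)) t \<noteq> 0"
  shows "cross (s1, b1, c1) (s, b, c) \<or> cross (s1, b1, c1) (s2, b2, c2)"
proof -
  define e where "e g = poly (iso_line s2 b2 c2 g) t" for g
  have e': "poly (iso_line s b c g) t = e g" for g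
    using poly_iso_line_crossing[OF cr, of g] by (simp add: e_def t)
  interpret e: comm_ring_hom e
  proof -
    interpret h: comm_ring_hom "iso_line s2 b2 c2" by (rule on_line_hom)
    show "comm_ring_hom e" by unfold_locales (auto simp: e_def h.hom_add h.hom_mult)
  qed
  have 1: "e (dx f) + s2 * e (dy f) + s2\<^sup>2 * e (dz f) = 0"
    using arg_cong[OF pderiv_iso_line[of s2 b2 c2 f], of "\<lambda>p. poly p t"] by (simp add: f e_def)
  have 2: "e (dx f) + s * e (dy f) + s\<^sup>2 * e (dz f) = 0"
    using arg_cong[OF pderiv_iso_line[of s b c f], of "\<lambda>p. poly p t"] by (simp add: f e')
  have "(s2 - s) * (e (dy f) + (s + s2) * e (dz f)) = 0" using 1 2 by Groebner_Basis.algebra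
  hence "e (dy f) + (s + s2) * e (dz f) = 0" using cr(2) by simp
  hence q1: "e (dy f) = - (s + s2) * e (dz f)" by Groebner_Basis.algebra
  have q0: "e (dx f) = s * s2 * e (dz f)" using 1 unfolding q1 by Groebner_Basis.algebra
  define u v where "u = e (pencil_u s1 b1)" and "v = e (pencil_v s1 b1 c1)"
  have "e (dz f) * ((v - s2 * u) * (v - s * u)) = e (pencil s1 b1 c1 f)"
    unfolding pencil_def e.hom_add e.hom_mult e.hom_power u_def[symmetric] v_def[symmetric] q0 q1
    by Groebner_Basis.algebra
  with p q2 have uv: "v = s2 * u \<or> v = s * u" by (simp add: e_def)
  have id: "comm_ring_hom (\<lambda>a::'a. a)" by unfold_locales auto
  have U: "u = (b2 + s2 * t) - s1 * t - b1" "v = (c2 + s2\<^sup>2 * t) - s1\<^sup>2 * t - c1 - s1 * u"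
    unfolding u_def v_def e_def poly_on_line ev3_pencil_u[OF id] ev3_pencil_v[OF id] by auto
  have U': "u = (b + s * t) - s1 * t - b1" "v = (c + s\<^sup>2 * t) - s1\<^sup>2 * t - c1 - s1 * u"
    using U crossD[OF cr] by (auto simp: t)
  from uv show ?thesis
  proof
    assume "v = s2 * u"
    hence "c2 - c1 = (s1 + s2) * (b2 - b1)" using U by Groebner_Basis.algebra
    thus ?thesis by (simp add: cross_def)
  next
    assume "v = s * u"
    hence "c - c1 = (s1 + s) * (b - b1)" using U' by Groebner_Basis.algebra
    thus ?thesis by (simp add: cross_def)
  qed
qed

subsection \<open>An irreducible surface contains few mutually crossing lines\<close>

type_synonym 'a line = "'a \<times> 'a \<times> 'a"

definition vanishes :: "'a::field poly poly poly \<Rightarrow> 'a line \<Rightarrow> bool" where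
  "vanishes f = (\<lambda>(s, b, c). iso_line s b c f = 0)"

lemma cross_sym: "cross l l' \<longleftrightarrow> cross l' l"
proof -
  obtain s b c s' b' c' where [simp]: "l = (s, b, c)" "l' = (s', b', c')" by (metis prod_cases3)
  have "c' - c = (s + s') * (b' - b) \<longleftrightarrow> c - c' = (s' + s) * (b - b')"
    by (metis add.commute minus_diff_eq mult_minus_right)
  thus ?thesis by (simp add: cross_def)
qed

lemma crossing_time_inj:
  assumes l1: "cross (s, b, c) l1" "fst l1 \<noteq> s" and l2: "cross (s, b, c) l2" "fst l2 \<noteq> s"
    and eq: "crossing_time (s, b, c) l1 = crossing_time (s, b, c) l2"
  shows "cross l1 l2"
proof -
  obtain s1 b1 c1 where [simp]: "l1 = (s1, b1, c1)" by (metis prod_cases3)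
  obtain s2 b2 c2 where [simp]: "l2 = (s2, b2, c2)" by (metis prod_cases3)
  define t where "t = crossing_time (s, b, c) l1"
  have 1: "b + s * t = b1 + s1 * t" "c + s\<^sup>2 * t = c1 + s1\<^sup>2 * t"
    using crossD[of s b c s1 b1 c1] l1 by (auto simp: t_def)
  have 2: "b + s * t = b2 + s2 * t" "c + s\<^sup>2 * t = c2 + s2\<^sup>2 * t"
    using crossD[of s b c s2 b2 c2] l2 eq by (auto simp: t_def)
  have "c2 - c1 = (s1\<^sup>2 - s2\<^sup>2) * t" "b2 - b1 = (s1 - s2) * t" using 1 2 by Groebner_Basis.algebra+
  hence "c2 - c1 = (s1 + s2) * (b2 - b1)" by Groebner_Basis.algebra
  thus ?thesis by (simp add: cross_def)
qed

text \<open>Two lines that cross a third one at the same parameter pass through one point and thus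
  cross each other. Skewness therefore makes the crossing times distinct zeros of
  \<open>p\<close>.\<close>

lemma poly_eq_0_if_many_crossings:
  fixes p :: "'a::field poly"
  assumes fin: "finite C"
    and C: "\<And>l. l \<in> C \<Longrightarrow> cross (s, b, c) l \<and> fst l \<noteq> s \<and> poly p (crossing_time (s, b, c) l) = 0"
    and skew: "\<And>l l'. l \<in> C \<Longrightarrow> l' \<in> C \<Longrightarrow> cross l l' \<Longrightarrow> l = l'"
    and card: "degree p < card C"
  shows "p = 0"
proof (rule ccontr)
  assume "p \<noteq> 0"
  have inj: "inj_on (crossing_time (s, b, c)) C"
    by (rule inj_onI) (use C skew crossing_time_inj in blast)
  have "card C = card (crossing_time (s, b, c) ` C)" by (simp add: card_image[OF inj])
  also have "\<dots> \<le> card {t. poly p t = 0}"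
    by (rule card_mono[OF poly_roots_finite[OF \<open>p \<noteq> 0\<close>]]) (use C in auto)
  also have "\<dots> \<le> degree p" by (rule card_poly_roots_bound[OF \<open>p \<noteq> 0\<close>])
  finally show False using card by simp
qed

lemma iso_line_eq_0_if_many_crossings:
  assumes "finite C"
    and "\<And>l. l \<in> C \<Longrightarrow> cross (s, b, c) l \<and> fst l \<noteq> s \<and> vanishes g l"
    and "\<And>l l'. l \<in> C \<Longrightarrow> l' \<in> C \<Longrightarrow> cross l l' \<Longrightarrow> l = l'"
    and "tdeg g < card C"
  shows "iso_line s b c g = 0"
proof (rule poly_eq_0_if_many_crossings[OF assms(1) _ assms(3)])
  fix l assume "l \<in> C"
  obtain s' b' c' where [simp]: "l = (s', b', c')" by (metis prod_cases3)
  from assms(2)[OF \<open>l \<in> C\<close>] have *: "cross (s, b, c) (s', b', c')" "s \<noteq> s'" "iso_line s' b' c' g = 0"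
    by (auto simp: vanishes_def)
  from poly_iso_line_crossing[OF *(1,2), of g] *
  show "cross (s, b, c) l \<and> fst l \<noteq> s \<and> poly (iso_line s b c g) (crossing_time (s, b, c) l) = 0"
    by simp
qed (use assms(4) degree_on_line_le[of s b "s\<^sup>2" c g] in auto)

text \<open>Distinct intercepts \<open>c\<close> guarantee distinct projections to the (x, z)-plane,
  as elimination of y requires.\<close>

lemma few_lines_vanish:
  fixes f g :: "'a::field_gcd poly poly poly"
  assumes "irreducible f" "\<not> f dvd g" "finite L"
    and "\<And>l. l \<in> L \<Longrightarrow> vanishes f l \<and> vanishes g l"
    and inj: "inj_on (snd \<circ> snd) L"
  shows "card L \<le> (tdeg f + tdeg g) * max (tdeg f) (tdeg g)"
proof (rule ccontr)
  assume large: "\<not> ?thesis"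
  let ?h = "\<lambda>(s, b, c). (s\<^sup>2, c) :: 'a \<times> 'a"
  have "inj_on ?h L"
  proof (rule inj_onI)
    fix l l' assume "l \<in> L" "l' \<in> L" "?h l = ?h l'"
    thus "l = l'" using inj_onD[OF inj, of l l'] by (auto split: prod.splits)
  qed
  hence "card (?h ` L) = card L" by (rule card_image)
  hence "f dvd g"
    using assms(4) large
    by (intro dvd_if_vanish_on_many_lines(1)[OF assms(1), of "?h ` L"]) (fastforce simp: vanishes_def)+
  with assms(2) show False by simp
qed

text \<open>As the degree is below the characteristic, such an \<open>f\<close> is a cylinder over a
  curve in the (x, y)-plane. The curve contains at most \<open>tdeg f\<close> projected lines, each
  the image of at most \<open>N\<close> lines.\<close>

lemma dz_eq_0_imp_few_lines:
  fixes f :: "'a::field poly poly poly"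
  assumes "f \<noteq> 0" and char: "\<And>k. 0 < k \<Longrightarrow> k \<le> tdeg f \<Longrightarrow> of_nat k \<noteq> (0 :: 'a)"
    and dz: "dz f = 0" and L: "finite L" "\<And>l. l \<in> L \<Longrightarrow> vanishes f l"
    and fibre: "\<And>s b. card {l \<in> L. fst l = s \<and> fst (snd l) = b} \<le> N"
  shows "card L \<le> N * tdeg f"
proof -
  have flat: "coeff f i = [:coeff (coeff f i) 0:]" for i
  proof -
    have "pderiv (coeff f i) = 0" using arg_cong[OF dz, of "\<lambda>p. coeff p i"] by (simp add: coeff_map_poly)
    have "coeff (coeff f i) (Suc j) = 0" for j
    proof (rule ccontr)
      assume nz: "coeff (coeff f i) (Suc j) \<noteq> 0"
      have "of_nat (Suc j) * coeff (coeff f i) (Suc j) = 0"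
        using arg_cong[OF \<open>pderiv (coeff f i) = 0\<close>, of "\<lambda>p. coeff p j"] by (simp add: coeff_pderiv del: of_nat_Suc)
      moreover have "Suc j \<le> tdeg f"
        using le_degree[OF nz] degree_le_lift_deg[of "coeff f i" degree] lift_deg_coeff_le[of "lift_deg degree" f i]
        by simp
      ultimately show False using char[of "Suc j"] nz by (auto simp: of_nat_poly simp del: of_nat_Suc)
    qed
    thus ?thesis by (intro poly_eqI) (auto simp: coeff_pCons split: nat.split)
  qed
  define F where "F = map_poly (\<lambda>g. coeff g 0) f"
  have "F \<noteq> 0"
  proof
    assume "F = 0"
    moreover have "coeff F i = coeff (coeff f i) 0" for i by (simp add: F_def coeff_map_poly)
    ultimately have "coeff (coeff f i) 0 = 0" for i by (metis coeff_0)
    hence "coeff f i = 0" for i using flat[of i] by simp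
    with assms(1) show False by (auto intro: poly_eqI)
  qed
  have F: "poly F [:b, s:] = 0" if "(s, b, c) \<in> L" for s b c
  proof -
    have "map_poly (ev2 (\<lambda>a. [:a:]) [:0, 1:] [:c, s\<^sup>2:]) f = F"
    proof (rule poly_eqI)
      fix i
      have "ev2 (\<lambda>a. [:a:]) [:0, 1:] [:c, s\<^sup>2:] 0 = 0" by (simp add: ev2_def)
      moreover have "ev2 (\<lambda>a. [:a:]) [:0, 1:] [:c, s\<^sup>2:] (coeff f i) = coeff (coeff f i) 0"
        by (subst flat, simp only: ev2_line) simp
      ultimately show "coeff (map_poly (ev2 (\<lambda>a. [:a:]) [:0, 1:] [:c, s\<^sup>2:]) f) i = coeff F i"
        by (simp add: coeff_map_poly F_def)
    qed
    with L(2)[OF that] show ?thesis by (simp only: vanishes_def on_line_def ev3_def prod.case)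
  qed
  let ?h = "\<lambda>l. (fst l, fst (snd l)) :: 'a \<times> 'a"
  have S: "card (?h ` L) \<le> degree F"
    by (rule card_lines_le_degree(2)[OF \<open>F \<noteq> 0\<close>]) (use F in auto)
  have "card L \<le> (\<Sum>y\<in>?h ` L. card {l \<in> L. ?h l = y})"
    using sum.image_gen[OF L(1), of "\<lambda>_. 1::nat" ?h] by (simp only: card_eq_sum)
  also have "\<dots> \<le> (\<Sum>y\<in>?h ` L. N)"
  proof (rule sum_mono)
    fix y :: "'a \<times> 'a"
    show "card {l \<in> L. ?h l = y} \<le> N" using fibre[of "fst y" "snd y"] by (simp add: prod_eq_iff)
  qed
  also have "\<dots> = N * card (?h ` L)" by simp
  also have "\<dots> \<le> N * tdeg f"
  proof -
    have "degree F \<le> degree f" unfolding F_def by (rule degree_map_poly_le)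
    also have "\<dots> \<le> tdeg f" by (rule degree_le_lift_deg)
    finally show ?thesis using S by simp
  qed
  finally show ?thesis .
qed

text \<open>Otherwise the leading coefficient in y would divide its own nonzero derivative in z,
  whose degree is smaller.\<close>

lemma not_dvd_dz:
  assumes "dz f \<noteq> 0"
  shows "\<not> f dvd dz f"
proof
  assume "f dvd dz f"
  then obtain g where g: "dz f = f * g" unfolding dvd_def by blast
  have "f \<noteq> 0" "g \<noteq> 0" using assms g by auto
  hence "degree f + degree g \<le> degree f"
    using degree_map_poly_le[of pderiv f] g by (simp add: degree_mult_eq)
  then obtain g0 where g0: "g = [:g0:]" by (auto elim: degree_eq_zeroE)
  have L: "pderiv (lead_coeff f) = lead_coeff f * g0"
    using arg_cong[OF g, of "\<lambda>p. coeff p (degree f)"] by (simp add: g0 coeff_map_poly mult.commute)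
  have "lead_coeff f \<noteq> 0" "g0 \<noteq> 0" using \<open>f \<noteq> 0\<close> \<open>g \<noteq> 0\<close> g0 by auto
  hence "degree (pderiv (lead_coeff f)) = degree (lead_coeff f) + degree g0" "pderiv (lead_coeff f) \<noteq> 0"
    unfolding L by (simp_all add: degree_mult_eq)
  moreover have "degree (pderiv (lead_coeff f)) \<le> degree (lead_coeff f) - 1" by (rule degree_pderiv_le)
  ultimately have "degree (lead_coeff f) = 0" by linarith
  hence "pderiv (lead_coeff f) = 0" by (auto elim!: degree_eq_zeroE simp: pderiv_pCons)
  with \<open>pderiv (lead_coeff f) \<noteq> 0\<close> show False by simp
qed

lemma not_dvd_dy:
  fixes f :: "'a::idom poly poly poly"
  assumes "0 < degree f" "of_nat (degree f) \<noteq> (0 :: 'a)"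
  shows "\<not> f dvd dy f"
proof
  assume "f dvd dy f"
  have "coeff (dy f) (degree f - 1) = of_nat (degree f) * lead_coeff f"
    using assms(1) by (simp add: coeff_pderiv Suc_pred' del: of_nat_Suc)
  moreover have "of_nat (degree f) \<noteq> (0 :: 'a poly poly)" using assms(2) by (simp add: of_nat_poly)
  ultimately have "dy f \<noteq> 0" using assms(1) by auto
  from dvd_imp_degree_le[OF \<open>f dvd dy f\<close> this] degree_pderiv_le[of f] assms(1) show False by linarith
qed

text \<open>\<open>inj\<close> separates the projections to the (x, z)-plane and
  \<open>fibre\<close> controls those to the (x, y)-plane; \<open>skew1\<close> and
  \<open>skew2\<close> let crossings count as zeros; \<open>common\<close> supplies the final
  contradiction on an irreducible surface.\<close>

locale line_families =
  fixes L1 L2 :: "'a::field_gcd line set" and N :: nat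
  assumes fin: "finite L1" "finite L2"
    and skew1: "\<And>l l'. l \<in> L1 \<Longrightarrow> l' \<in> L1 \<Longrightarrow> cross l l' \<Longrightarrow> l = l'"
    and skew2: "\<And>l l'. l \<in> L2 \<Longrightarrow> l' \<in> L2 \<Longrightarrow> cross l l' \<Longrightarrow> l = l'"
    and slopes: "\<And>l l'. l \<in> L1 \<Longrightarrow> l' \<in> L2 \<Longrightarrow> fst l \<noteq> fst l'"
    and inj: "inj_on (snd \<circ> snd) L1"
    and fibre: "\<And>s b. card {l \<in> L1. fst l = s \<and> fst (snd l) = b} \<le> N"
    and common: "\<And>l l'. l \<in> L1 \<Longrightarrow> l' \<in> L1 \<Longrightarrow> l \<noteq> l' \<Longrightarrow> card {m \<in> L2. cross l m \<and> cross l' m} \<le> N"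
begin

text \<open>With d the degree, 20 d^2 = (d + 4 d) (4 d) is the elimination bound for
  \<open>f\<close> against a remainder of degree 4 d, and N d covers the case of a cylinder.
  Richness serves twice: more than 4 d crossings force the remainders to vanish on a line, and after
  dropping the at most d crossings where \<open>dz f\<close> vanishes more than \<open>N\<close> are
  left.\<close>

lemma few_lines_on_irreducible_surface:
  assumes irr: "irreducible f"
    and char: "\<And>k. 0 < k \<Longrightarrow> k \<le> tdeg f \<Longrightarrow> of_nat k \<noteq> (0 :: 'a)"
    and M: "M1 \<subseteq> L1" "M2 \<subseteq> L2" and van: "\<And>l. l \<in> M1 \<union> M2 \<Longrightarrow> vanishes f l"
    and rich: "\<And>l. l \<in> M1 \<Longrightarrow> 4 * tdeg f + N < card {m \<in> M2. cross l m}"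
  shows "card M1 \<le> 20 * tdeg f ^ 2 + N * tdeg f"
proof (rule ccontr)
  assume large: "\<not> ?thesis"
  define d where "d = tdeg f"
  have "f \<noteq> 0" using irr by auto
  have "0 < d" using tdeg_0_imp_unit[of f] irr \<open>f \<noteq> 0\<close> by (auto simp: irreducible_def d_def)
  have finM: "finite M1" "finite M2" using M fin finite_subset by auto
  have injM: "inj_on (snd \<circ> snd) M1" using inj M(1) by (rule inj_on_subset)
  have cr: "cross l m \<and> fst m \<noteq> fst l" if "l \<in> M1" "m \<in> {m \<in> M2. cross l m}" for l m
    using that M slopes[of l m] by force
  have few: "card {l \<in> M1. vanishes g l} \<le> (d + tdeg g) * max d (tdeg g)" if "\<not> f dvd g" for g
    unfolding d_def using finM van that
    by (intro few_lines_vanish[OF irr] inj_on_subset[OF injM]) auto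
  have dvd: "f dvd g" if "tdeg g \<le> 4 * d" "\<And>l. l \<in> M1 \<Longrightarrow> vanishes g l" for g
  proof (rule ccontr)
    assume "\<not> f dvd g"
    from few[OF this] have "card M1 \<le> (d + tdeg g) * max d (tdeg g)" using that(2) by (simp add: Collect_conj_eq Int_absorb2 subsetI)
    also have "\<dots> \<le> (d + 4 * d) * (4 * d)" using that(1) by (intro mult_le_mono) auto
    finally show False using large by (simp add: d_def power2_eq_square)
  qed
  have zero: "iso_line s b c g = 0"
    if l: "(s, b, c) \<in> M1" and g: "tdeg g \<le> 4 * d"
      and 0: "\<And>m. m \<in> M2 \<Longrightarrow> cross (s, b, c) m \<Longrightarrow> poly (iso_line s b c g) (crossing_time (s, b, c) m) = 0"
    for s b c g
  proof (rule poly_eq_0_if_many_crossings[of "{m \<in> M2. cross (s, b, c) m}"])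
    show "cross (s, b, c) m \<and> fst m \<noteq> s \<and> poly (iso_line s b c g) (crossing_time (s, b, c) m) = 0"
      if "m \<in> {m \<in> M2. cross (s, b, c) m}" for m
      using cr[OF l that] 0 that by simp
    show "m = m'" if "m \<in> {m \<in> M2. cross (s, b, c) m}" "m' \<in> {m \<in> M2. cross (s, b, c) m}" "cross m m'" for m m'
      using skew2[of m m'] that M by blast
    show "degree (iso_line s b c g) < card {m \<in> M2. cross (s, b, c) m}"
      using rich[OF l] g degree_on_line_le[of s b "s\<^sup>2" c g] by (simp add: d_def)
  qed (use finM in simp)
  have rem0: "vanishes (rem1 f) l \<and> vanishes (rem0 f) l" if l: "l \<in> M1" for l
  proof -
    obtain s b c where [simp]: "l = (s, b, c)" by (metis prod_cases3)
    have 0: "poly (iso_line s b c (rem1 f)) (crossing_time (s, b, c) m) = 0 \<and>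
        poly (iso_line s b c (rem0 f)) (crossing_time (s, b, c) m) = 0"
      if "m \<in> M2" "cross (s, b, c) m" for m
    proof -
      obtain s' b' c' where [simp]: "m = (s', b', c')" by (metis prod_cases3)
      show ?thesis
        using rem_vanish_at_crossing[of s b c f s' b' c'] van[of l] van[of m] cr[OF l, of m] l that
        by (auto simp: vanishes_def)
    qed
    show ?thesis
      using zero[of s b c "rem1 f"] zero[of s b c "rem0 f"] 0 l tdeg_rem[of f]
      by (auto simp: vanishes_def d_def)
  qed
  have rem: "f dvd rem1 f" "f dvd rem0 f"
    using dvd[of "rem1 f"] dvd[of "rem0 f"] rem0 tdeg_rem[of f] by (auto simp: d_def)
  have deg: "0 < degree f"
  proof -
    let ?h = "\<lambda>(s, b, c). (s\<^sup>2, c) :: 'a \<times> 'a"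
    have "inj_on ?h M1"
    proof (rule inj_onI)
      fix l l' assume "l \<in> M1" "l' \<in> M1" "?h l = ?h l'"
      thus "l = l'" using inj_onD[OF injM, of l l'] by (auto split: prod.splits)
    qed
    hence "card (?h ` M1) = card M1" by (rule card_image)
    moreover have "(d + tdeg f) * max d (tdeg f) < card M1" using large by (simp add: d_def power2_eq_square algebra_simps)
    ultimately show ?thesis
      using van by (intro dvd_if_vanish_on_many_lines(2)[OF irr, of "?h ` M1" f])
        (fastforce simp: vanishes_def d_def)+
  qed
  have "of_nat (degree f) \<noteq> (0 :: 'a)"
    by (rule char[OF deg]) (rule degree_le_lift_deg)
  hence ndy: "\<not> f dvd dy f" by (rule not_dvd_dy[OF deg])
  have "dz f \<noteq> 0"
  proof
    assume "dz f = 0"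
    have "card {l \<in> M1. fst l = s \<and> fst (snd l) = b} \<le> N" for s b
      by (rule order_trans[OF card_mono fibre[of s b]]) (use fin M in auto)
    from dz_eq_0_imp_few_lines[OF \<open>f \<noteq> 0\<close> char \<open>dz f = 0\<close> finM(1) _ this] van large show False by auto
  qed
  hence ndz: "\<not> f dvd dz f" by (rule not_dvd_dz)
  \<comment> \<open>Each excluded set has at most 2 d^2 lines, so more than 16 d^2 remain, and two
    are enough.\<close>
  define good where "good = {l \<in> M1. \<not> vanishes (dy f) l \<and> \<not> vanishes (dz f) l}"
  have "card {l \<in> M1. vanishes (dy f) l} \<le> 2 * d ^ 2" "card {l \<in> M1. vanishes (dz f) l} \<le> 2 * d ^ 2"
  proof -
    have *: "(d + e) * max d e \<le> 2 * d ^ 2" if "e \<le> d" for e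
      using mult_le_mono[of "d + e" "2 * d" "max d e" d] that by (simp add: power2_eq_square)
    show "card {l \<in> M1. vanishes (dy f) l} \<le> 2 * d ^ 2"
      using few[OF ndy] *[of "tdeg (dy f)"] tdeg_dy[of f] by (simp add: d_def)
    show "card {l \<in> M1. vanishes (dz f) l} \<le> 2 * d ^ 2"
      using few[OF ndz] *[of "tdeg (dz f)"] tdeg_dz[of f] by (simp add: d_def)
  qed
  moreover have "M1 \<subseteq> good \<union> ({l \<in> M1. vanishes (dy f) l} \<union> {l \<in> M1. vanishes (dz f) l})"
    by (auto simp: good_def)
  from card_mono[OF _ this] have "card M1 \<le> card good + (card {l \<in> M1. vanishes (dy f) l} + card {l \<in> M1. vanishes (dz f) l})"
    using finM card_Un_le[of good "{l \<in> M1. vanishes (dy f) l} \<union> {l \<in> M1. vanishes (dz f) l}"]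
      card_Un_le[of "{l \<in> M1. vanishes (dy f) l}" "{l \<in> M1. vanishes (dz f) l}"] by (simp add: good_def)
  ultimately have "card good > 16 * d ^ 2" using large by (simp add: d_def)
  moreover have "1 \<le> d ^ 2" using \<open>0 < d\<close> by (simp add: Suc_leI)
  ultimately have "\<not> card good \<le> Suc 0" by linarith
  moreover have "finite good" using finM by (simp add: good_def)
  ultimately obtain l1 l2 where l12: "l1 \<in> good" "l2 \<in> good" "l1 \<noteq> l2"
    using card_le_Suc0_iff_eq by blast
  obtain s1 b1 c1 where l1: "l1 = (s1, b1, c1)" by (metis prod_cases3)
  obtain s2 b2 c2 where l2: "l2 = (s2, b2, c2)" by (metis prod_cases3)
  have M12: "l1 \<in> M1" "l2 \<in> M1" using l12 by (auto simp: good_def)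
  have q1: "iso_line s1 b1 c1 (dy f) \<noteq> 0" "iso_line s1 b1 c1 (dz f) \<noteq> 0" "iso_line s2 b2 c2 (dz f) \<noteq> 0"
    using l12 by (auto simp: good_def vanishes_def l1 l2)
  have line: "iso_line s1 b1 c1 f = 0" "iso_line s2 b2 c2 f = 0"
    using van[of l1] van[of l2] M12 by (auto simp: vanishes_def l1 l2)
  have generic: "card {m \<in> M2. cross l m} \<le> d + card {m \<in> M2. cross l m \<and>
      poly (iso_line s b c (dz f)) (crossing_time l m) \<noteq> 0}"
    if l: "l = (s, b, c)" "l \<in> M1" "iso_line s b c (dz f) \<noteq> 0" for l s b c
  proof -
    let ?Z = "{m \<in> M2. cross l m \<and> poly (iso_line s b c (dz f)) (crossing_time l m) = 0}"
    have "card ?Z \<le> d"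
    proof (rule ccontr)
      assume "\<not> card ?Z \<le> d"
      moreover have "degree (iso_line s b c (dz f)) \<le> d"
        using degree_on_line_le[of s b "s\<^sup>2" c "dz f"] tdeg_dz[of f] by (simp add: d_def)
      ultimately have less: "degree (iso_line s b c (dz f)) < card ?Z" by linarith
      have "iso_line s b c (dz f) = 0"
      proof (rule poly_eq_0_if_many_crossings[OF _ _ _ less])
        show "cross (s, b, c) m \<and> fst m \<noteq> s \<and> poly (iso_line s b c (dz f)) (crossing_time (s, b, c) m) = 0"
          if "m \<in> ?Z" for m
          using cr[OF l(2), of m] that l(1) by simp
        show "m = m'" if "m \<in> ?Z" "m' \<in> ?Z" "cross m m'" for m m'
          using skew2[of m m'] that M by blast
      qed (use finM in simp)
      with l(3) show False by simp
    qed
    moreover have "{m \<in> M2. cross l m} = ?Z \<union> {m \<in> M2. cross l m \<and> poly (iso_line s b c (dz f)) (crossing_time l m) \<noteq> 0}"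
      (is "?X = ?Z \<union> ?Y") by auto
    hence "card ?X \<le> card ?Z + card ?Y" using card_Un_le[of ?Z ?Y] by simp
    ultimately show ?thesis by linarith
  qed
  \<comment> \<open>If it vanished, \<open>s1\<close> would be a double tangent slope all along
    \<open>l1\<close>. A crossing with nonzero \<open>dz f\<close> provides a second slope different
    from \<open>s1\<close>.\<close>
  have disc: "iso_line s1 b1 c1 (dy f) + smult (2 * s1) (iso_line s1 b1 c1 (dz f)) \<noteq> 0"
  proof
    assume 0: "iso_line s1 b1 c1 (dy f) + smult (2 * s1) (iso_line s1 b1 c1 (dz f)) = 0"
    have "0 < card {m \<in> M2. cross l1 m \<and> poly (iso_line s1 b1 c1 (dz f)) (crossing_time l1 m) \<noteq> 0}"
      using generic[OF l1 M12(1) q1(2)] rich[OF M12(1)] by (simp add: d_def)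
    then obtain m where m: "m \<in> M2" "cross l1 m" "poly (iso_line s1 b1 c1 (dz f)) (crossing_time l1 m) \<noteq> 0"
      by (auto simp: card_gt_0_iff)
    obtain s b c where mm: "m = (s, b, c)" by (metis prod_cases3)
    have ne: "s1 \<noteq> s" using cr[OF M12(1), of m] m by (auto simp: l1 mm)
    define e where "e g = poly (iso_line s1 b1 c1 g) (crossing_time l1 m)" for g
    have e': "poly (iso_line s b c g) (crossing_time l1 m) = e g" for g
      using poly_iso_line_crossing[of s1 b1 c1 s b c g] m ne by (simp add: e_def l1 mm)
    have 1: "e (dx f) + s1 * e (dy f) + s1\<^sup>2 * e (dz f) = 0"
      using arg_cong[OF pderiv_iso_line[of s1 b1 c1 f], of "\<lambda>p. poly p (crossing_time l1 m)"] by (simp add: line e_def)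
    have "iso_line s b c f = 0" using van[of m] m by (auto simp: vanishes_def mm)
    hence 2: "e (dx f) + s * e (dy f) + s\<^sup>2 * e (dz f) = 0"
      using arg_cong[OF pderiv_iso_line[of s b c f], of "\<lambda>p. poly p (crossing_time l1 m)"] by (simp add: e')
    have 3: "e (dy f) + 2 * s1 * e (dz f) = 0"
      using arg_cong[OF 0, of "\<lambda>p. poly p (crossing_time l1 m)"] by (simp add: e_def)
    have "(s1 - s) * ((s1 - s) * e (dz f)) = 0" using 1 2 3 by Groebner_Basis.algebra
    with ne m(3) show False by (simp add: e_def)
  qed
  have pencil: "f dvd pencil s1 b1 c1 f"
    by (rule dvd_pencil[OF irr deg rem line(1) char q1(2,1) disc])
  \<comment> \<open>Since \<open>l1\<close> and \<open>l2\<close> are skew, the pencil of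
    \<open>l1\<close> evaluated on \<open>l2\<close> forces these lines to cross \<open>l1\<close>
    too, which gives more than \<open>N\<close> common transversals.\<close>
  have "{m \<in> M2. cross l2 m \<and> poly (iso_line s2 b2 c2 (dz f)) (crossing_time l2 m) \<noteq> 0}
      \<subseteq> {m \<in> L2. cross l1 m \<and> cross l2 m}"
  proof safe
    fix s b c assume m: "(s, b, c) \<in> M2" "cross l2 (s, b, c)"
      and nz: "poly (iso_line s2 b2 c2 (dz f)) (crossing_time l2 (s, b, c)) \<noteq> 0"
    show "(s, b, c) \<in> L2" using m M by auto
    have ne: "s2 \<noteq> s" using cr[OF M12(2), of "(s, b, c)"] m by (auto simp: l2)
    have "iso_line s2 b2 c2 (pencil s1 b1 c1 f) = 0"
    proof -
      interpret h: comm_ring_hom "iso_line s2 b2 c2" by (rule on_line_hom)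
      from pencil obtain g where "pencil s1 b1 c1 f = f * g" unfolding dvd_def by blast
      thus ?thesis by (simp add: h.hom_mult line)
    qed
    moreover have "iso_line s b c f = 0" using van[of "(s, b, c)"] m by (auto simp: vanishes_def)
    ultimately have "cross l1 (s, b, c) \<or> cross l1 l2"
      using pencil_at_crossing[of s2 b2 c2 s1 b1 c1 f "crossing_time l2 (s, b, c)" s b c] m nz ne line
      by (simp add: l1 l2)
    moreover have "\<not> cross l1 l2" using skew1[of l1 l2] M12 M l12(3) by auto
    ultimately show "cross l1 (s, b, c)" by simp
  qed
  from card_mono[OF _ this] fin
  have "card {m \<in> M2. cross l2 m \<and> poly (iso_line s2 b2 c2 (dz f)) (crossing_time l2 m) \<noteq> 0} \<le> N"
    using common[of l1 l2] M12 M l12(3) by (auto intro: order_trans)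
  with generic[OF l2 M12(2) q1(3)] rich[OF M12(2)] show False using \<open>0 < d\<close> by (simp add: d_def)
qed

end

subsection \<open>A polynomial of small degree vanishing on given lines\<close>

lemma homogeneous_system_nontrivial:
  fixes A :: "'j \<Rightarrow> 'i \<Rightarrow> 'a::field"
  assumes "finite J" "finite I" "card J < card I"
  shows "\<exists>x. (\<exists>i\<in>I. x i \<noteq> 0) \<and> (\<forall>j\<in>J. (\<Sum>i\<in>I. A j i * x i) = 0)"
  using assms
proof (induction J arbitrary: I A rule: finite_induct)
  case empty
  hence "I \<noteq> {}" by auto
  thus ?case by (intro exI[of _ "\<lambda>_. 1"]) auto
next
  case (insert j0 J)
  show ?case
  proof (cases "\<forall>i\<in>I. A j0 i = 0")
    case True
    have "card J < card I" using insert by simp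
    from insert.IH[OF insert.prems(1) this, of A] True show ?thesis by auto
  next
    case False
    then obtain i0 where i0: "i0 \<in> I" "A j0 i0 \<noteq> 0" by auto
    define A' where "A' j i = A j i - A j i0 * A j0 i / A j0 i0" for j i
    have "card J < card (I - {i0})" using insert i0 by simp
    from insert.IH[OF _ this, of A'] insert.prems(1) obtain x where
      x: "\<exists>i\<in>I - {i0}. x i \<noteq> 0" "\<And>j. j \<in> J \<Longrightarrow> (\<Sum>i\<in>I - {i0}. A' j i * x i) = 0" by auto
    define s where "s = (\<Sum>i\<in>I - {i0}. A j0 i * x i)"
    define y where "y = x(i0 := - s / A j0 i0)"
    have split: "(\<Sum>i\<in>I. A j i * y i) = (\<Sum>i\<in>I - {i0}. A j i * x i) - A j i0 * s / A j0 i0" for j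
    proof -
      have "(\<Sum>i\<in>I. A j i * y i) = A j i0 * y i0 + (\<Sum>i\<in>I - {i0}. A j i * y i)"
        using insert.prems(1) i0 by (simp add: sum.remove)
      also have "(\<Sum>i\<in>I - {i0}. A j i * y i) = (\<Sum>i\<in>I - {i0}. A j i * x i)"
        by (rule sum.cong) (auto simp: y_def)
      finally show ?thesis by (simp add: y_def)
    qed
    have "(\<Sum>i\<in>I. A j i * y i) = 0" if "j \<in> insert j0 J" for j
    proof (cases "j = j0")
      case True thus ?thesis using split[of j0] i0 by (simp add: s_def)
    next
      case False
      hence "0 = (\<Sum>i\<in>I - {i0}. A' j i * x i)" using x(2) that by simp
      also have "\<dots> = (\<Sum>i\<in>I - {i0}. A j i * x i - A j i0 / A j0 i0 * (A j0 i * x i))"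
        by (rule sum.cong) (simp_all add: A'_def algebra_simps)
      also have "\<dots> = (\<Sum>i\<in>I - {i0}. A j i * x i) - A j i0 * s / A j0 i0"
        by (simp add: sum_subtractf sum_distrib_left sum_divide_distrib s_def)
      finally show ?thesis using split[of j] by simp
    qed
    moreover have "\<exists>i\<in>I. y i \<noteq> 0" using x(1) by (auto simp: y_def)
    ultimately show ?thesis by blast
  qed
qed

abbreviation mon :: "'a::comm_ring_1 \<Rightarrow> nat \<times> nat \<times> nat \<Rightarrow> 'a poly poly poly" where
  "mon a \<equiv> (\<lambda>(i, j, k). monom (monom (monom a k) j) i)"

lemma on_line_mon: "on_line s b m c (mon a t) = smult a (on_line s b m c (mon 1 t))"
proof -
  interpret h: comm_ring_hom "on_line s b m c" by (rule on_line_hom)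
  obtain i j k where [simp]: "t = (i, j, k)" by (metis prod_cases3)
  interpret h1: comm_ring_hom "ev1 (\<lambda>a::'a. [:a:]) [:0, 1:]" by (rule ev1_hom[OF const_hom])
  interpret h2: comm_ring_hom "ev2 (\<lambda>a::'a. [:a:]) [:0, 1:] [:c, m:]" by (rule ev2_hom[OF const_hom])
  have "mon a t = [:[:[:a:]:]:] * mon 1 t" by (simp add: smult_monom)
  moreover have "on_line s b m c [:[:[:a:]:]:] = [:a:]"
    unfolding on_line_def ev3_def h2.map_poly_pCons_hom map_poly_0
    by (simp add: ev2_line[unfolded pCons_one])
  ultimately show ?thesis by (simp only: h.hom_mult) simp
qed

lemma lift_deg_monom_le: "lift_deg w (monom a i) \<le> i + w a"
  by (auto simp: lift_deg_le_iff)

text \<open>Parameter count: exponents up to \<open>\<mu>\<close> in each variable give (\<mu> +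
  1)^3 unknowns, and vanishing on a line amounts to the 3 \<mu> + 1 coefficients of a univariate
  polynomial.\<close>

lemma exists_vanishing_polynomial:
  fixes H :: "'a::field line set"
  assumes "finite H" "card H * (3 * \<mu> + 1) < (\<mu> + 1) ^ 3"
  shows "\<exists>f. f \<noteq> 0 \<and> tdeg f \<le> 3 * \<mu> \<and> (\<forall>l\<in>H. vanishes f l)"
proof -
  let ?I = "{..\<mu>} \<times> {..\<mu>} \<times> {..\<mu>}" and ?J = "H \<times> {..3 * \<mu>}"
  define A :: "'a line \<times> nat \<Rightarrow> nat \<times> nat \<times> nat \<Rightarrow> 'a" where
    "A = (\<lambda>((s, b, c), n) t. coeff (iso_line s b c (mon 1 t)) n)"
  have "card ?J = card H * (3 * \<mu> + 1)" "card ?I = (\<mu> + 1) ^ 3"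
    by (simp_all add: card_cartesian_product power3_eq_cube)
  with assms(2) have "card ?J < card ?I" by (simp only:)
  from homogeneous_system_nontrivial[OF _ _ this, of A] assms(1) obtain x where
    x: "\<exists>t\<in>?I. x t \<noteq> 0" "\<And>j. j \<in> ?J \<Longrightarrow> (\<Sum>t\<in>?I. A j t * x t) = 0" by auto
  define f where "f = (\<Sum>t\<in>?I. mon (x t) t)"
  have deg: "tdeg f \<le> 3 * \<mu>"
    unfolding f_def
  proof (rule tdeg.sum_le)
    fix t assume "t \<in> ?I"
    then obtain i j k where t: "t = (i, j, k)" "i \<le> \<mu>" "j \<le> \<mu>" "k \<le> \<mu>" by auto
    have "tdeg (mon (x t) t) \<le> i + (j + k)"
      using lift_deg_monom_le[of "lift_deg degree" "monom (monom (x t) k) j" i]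
        lift_deg_monom_le[of degree "monom (x t) k" j] degree_monom_le[of "x t" k] by (simp add: t)
    thus "tdeg (mon (x t) t) \<le> 3 * \<mu>" using t by linarith
  qed auto
  moreover have "f \<noteq> 0"
  proof
    assume "f = 0"
    obtain i j k where t: "(i, j, k) \<in> ?I" "x (i, j, k) \<noteq> 0" using x(1) by auto
    have "coeff (coeff (coeff f i) j) k = (\<Sum>t\<in>?I. coeff (coeff (coeff (mon (x t) t) i) j) k)"
      by (simp add: f_def coeff_sum)
    also have "\<dots> = (\<Sum>t\<in>?I. if t = (i, j, k) then x t else 0)"
    proof (rule sum.cong[OF refl])
      fix t :: "nat \<times> nat \<times> nat"
      obtain a b c where "t = (a, b, c)" by (metis prod_cases3)
      thus "coeff (coeff (coeff (mon (x t) t) i) j) k = (if t = (i, j, k) then x t else 0)"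
        by (cases "a = i"; cases "b = j"; cases "c = k") simp_all
    qed
    also have "\<dots> = x (i, j, k)" using t(1) by (subst sum.delta) auto
    finally show False using t \<open>f = 0\<close> by simp
  qed
  moreover have "vanishes f l" if "l \<in> H" for l
  proof -
    obtain s b c where l: "l = (s, b, c)" by (metis prod_cases3)
    interpret h: comm_ring_hom "iso_line s b c" by (rule on_line_hom)
    have "iso_line s b c f = 0"
    proof (rule poly_eqI)
      fix n
      show "coeff (iso_line s b c f) n = coeff 0 n"
      proof (cases "n \<le> 3 * \<mu>")
        case True
        have "coeff (iso_line s b c f) n = (\<Sum>t\<in>?I. x t * coeff (iso_line s b c (mon 1 t)) n)"
          unfolding f_def h.hom_sum coeff_sum on_line_mon[of _ _ _ _ "x _"] coeff_smult ..
        also have "\<dots> = (\<Sum>t\<in>?I. A (l, n) t * x t)" by (simp add: A_def l mult.commute)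
        finally show ?thesis using x(2)[of "(l, n)"] that True by simp
      next
        case False
        thus ?thesis using degree_on_line_le[of s b "s\<^sup>2" c f] deg by (simp add: coeff_eq_0)
      qed
    qed
    thus ?thesis by (simp add: vanishes_def l)
  qed
  ultimately show ?thesis by blast
qed

subsection \<open>Hitting sets\<close>

lemma double_count:
  assumes "finite P" "finite Q"
  shows "(\<Sum>l\<in>P. card {m \<in> Q. R l m}) = (\<Sum>m\<in>Q. card {l \<in> P. R l m})"
  using sum_multicount_gen[OF assms] by simp

text \<open>Greedy choice: by averaging, some element of \<open>P\<close> hits at least the fraction
  \<theta> / n of what is not yet hit.\<close>

lemma hitting_set:
  assumes fin: "finite P" "finite Q" and P: "card P \<le> n" and \<theta>: "\<theta> \<le> n" "0 < n"
    and deg: "\<And>m. m \<in> Q \<Longrightarrow> \<theta> \<le> card {l \<in> P. R l m}"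
  shows "\<exists>H\<subseteq>P. card H \<le> h \<and>
    real (card {m \<in> Q. \<forall>l\<in>H. \<not> R l m}) \<le> card Q * (1 - real \<theta> / n) ^ h"
proof (induction h)
  case 0 show ?case by (intro exI[of _ "{}"]) auto
next
  case (Suc h)
  then obtain H where H: "H \<subseteq> P" "card H \<le> h"
    "real (card {m \<in> Q. \<forall>l\<in>H. \<not> R l m}) \<le> card Q * (1 - real \<theta> / n) ^ h" by auto
  let ?U = "{m \<in> Q. \<forall>l\<in>H. \<not> R l m}"
  have "\<exists>l\<in>P. real \<theta> * card ?U \<le> n * card {m \<in> ?U. R l m} \<or> ?U = {}"
    if "P \<noteq> {}"
  proof (rule ccontr)
    assume *: "\<not> ?thesis"
    have 1: "real \<theta> * card ?U \<le> (\<Sum>m\<in>?U. real (card {l \<in> P. R l m}))"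
      using sum_mono[of ?U "\<lambda>_. real \<theta>" "\<lambda>m. real (card {l \<in> P. R l m})"] deg by (simp add: mult.commute)
    have 2: "(\<Sum>m\<in>?U. real (card {l \<in> P. R l m})) = (\<Sum>l\<in>P. real (card {m \<in> ?U. R l m}))"
      using double_count[of P ?U R] fin by (simp flip: of_nat_sum)
    have "n * (\<Sum>l\<in>P. real (card {m \<in> ?U. R l m})) < (\<Sum>l\<in>P. real \<theta> * card ?U)"
      unfolding sum_distrib_left
    proof (rule sum_strict_mono)
      fix l assume "l \<in> P"
      with * have "\<not> real \<theta> * card ?U \<le> real (n * card {m \<in> ?U. R l m})" by blast
      thus "n * real (card {m \<in> ?U. R l m}) < real \<theta> * card ?U" by simp
    qed (use fin that in auto)
    also have "\<dots> = card P * (real \<theta> * card ?U)" by simp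
    also have "\<dots> \<le> n * (real \<theta> * card ?U)" using P by (intro mult_right_mono) auto
    finally have "(\<Sum>l\<in>P. real (card {m \<in> ?U. R l m})) < real \<theta> * card ?U"
      using \<theta>(2) by (simp add: mult_less_cancel_left_pos)
    with 1 2 show False by linarith
  qed
  moreover have "?U = {}" if "P = {}" "\<theta> > 0" using deg that by fastforce
  ultimately consider (triv) "?U = {} \<or> \<theta> = 0" |
    (hit) l where "l \<in> P" "real \<theta> * card ?U \<le> n * card {m \<in> ?U. R l m}" by blast
  thus ?case
  proof cases
    case triv
    have "0 \<le> real (card Q) * (1 - real \<theta> / n) ^ Suc h"
      using \<theta> by (intro mult_nonneg_nonneg zero_le_power) (simp_all add: divide_le_eq)
    have "real (card ?U) \<le> card Q * (1 - real \<theta> / n) ^ Suc h"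
    proof (cases "\<theta> = 0")
      case True thus ?thesis using H(3) by simp
    next
      case False
      with triv have "?U = {}" by blast
      hence "real (card ?U) = 0" by (simp only: card.empty of_nat_0)
      with \<open>0 \<le> _\<close> show ?thesis by linarith
    qed
    thus ?thesis using H(1,2) by (intro exI[of _ H]) simp
  next
    case (hit l)
    let ?V = "{m \<in> Q. \<forall>l\<in>insert l H. \<not> R l m}"
    have "card ?V + card {m \<in> ?U. R l m} = card (?V \<union> {m \<in> ?U. R l m})"
      using fin by (intro card_Un_disjoint[symmetric]) auto
    also have "?V \<union> {m \<in> ?U. R l m} = ?U" by auto
    finally have "real (card ?V) = real (card ?U) - card {m \<in> ?U. R l m}" by linarith
    also have "\<dots> \<le> card ?U * (1 - real \<theta> / n)"
      using hit(2) \<theta>(2) by (simp add: field_simps)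
    also have "\<dots> \<le> (card Q * (1 - real \<theta> / n) ^ h) * (1 - real \<theta> / n)"
      using H(3) \<theta> by (intro mult_right_mono) (auto simp: divide_le_eq)
    finally have "real (card ?V) \<le> card Q * (1 - real \<theta> / n) ^ Suc h"
      by (simp only: power_Suc2 mult.assoc)
    moreover have "card (insert l H) \<le> Suc h" using H(2) by (metis card_insert_le_m1 diff_Suc_1 zero_less_Suc)
    ultimately show ?thesis using hit(1) H(1) by (intro exI[of _ "insert l H"]) auto
  qed
qed

lemma multiple_hitting_set:
  assumes fin: "finite P" "finite Q" and P: "card P \<le> n" and \<theta>: "\<theta> \<le> n" "0 < n"
    and h: "card Q * (1 - real \<theta> / n) ^ h < 1"
  shows "(\<And>m. m \<in> Q \<Longrightarrow> \<theta> + r \<le> card {l \<in> P. R l m}) \<Longrightarrow>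
    \<exists>H\<subseteq>P. card H \<le> r * h \<and> (\<forall>m\<in>Q. r \<le> card {l \<in> H. R l m})"
proof (induction r)
  case 0 show ?case by (intro exI[of _ "{}"]) auto
next
  case (Suc r)
  have "\<theta> + r \<le> card {l \<in> P. R l m}" if "m \<in> Q" for m using Suc.prems[OF that] by simp
  from Suc.IH[OF this] obtain H where H: "H \<subseteq> P" "card H \<le> r * h" "\<And>m. m \<in> Q \<Longrightarrow> r \<le> card {l \<in> H. R l m}" by auto
  have finH: "finite H" using H fin finite_subset by blast
  let ?Q = "{m \<in> Q. card {l \<in> H. R l m} = r}"
  have deg: "\<theta> \<le> card {l \<in> P - H. R l m}" if "m \<in> ?Q" for m
  proof -
    have "{l \<in> P. R l m} = {l \<in> H. R l m} \<union> {l \<in> P - H. R l m}" using H(1) by auto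
    hence "card {l \<in> P. R l m} \<le> card {l \<in> H. R l m} + card {l \<in> P - H. R l m}" by (simp add: card_Un_le)
    with Suc.prems[of m] that show ?thesis by simp
  qed
  have "card (P - H) \<le> n" using P fin by (meson Diff_subset card_mono le_trans)
  hence "\<exists>H'\<subseteq>P - H. card H' \<le> h \<and>
      real (card {m \<in> ?Q. \<forall>l\<in>H'. \<not> R l m}) \<le> card ?Q * (1 - real \<theta> / n) ^ h"
    by (intro hitting_set deg) (use fin \<theta> in simp_all)
  then obtain H' where H': "H' \<subseteq> P - H" "card H' \<le> h"
    "real (card {m \<in> ?Q. \<forall>l\<in>H'. \<not> R l m}) \<le> card ?Q * (1 - real \<theta> / n) ^ h" by blast
  have "real (card ?Q) * (1 - real \<theta> / n) ^ h \<le> card Q * (1 - real \<theta> / n) ^ h"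
    using \<theta> fin by (intro mult_right_mono) (auto simp: divide_le_eq intro!: card_mono)
  with H'(3) h have "card {m \<in> ?Q. \<forall>l\<in>H'. \<not> R l m} = 0" by linarith
  hence hit: "\<exists>l\<in>H'. R l m" if "m \<in> ?Q" for m using that fin by auto
  have finH': "finite H'" using H' fin finite_subset by blast
  have "Suc r \<le> card {l \<in> H \<union> H'. R l m}" if "m \<in> Q" for m
  proof (cases "m \<in> ?Q")
    case True
    then obtain l where l: "l \<in> H'" "R l m" using hit by auto
    have "insert l {l \<in> H. R l m} \<subseteq> {l \<in> H \<union> H'. R l m}" using l by auto
    from card_mono[OF _ this] l H'(1) True finH finH' show ?thesis by (auto simp: card_insert_if)
  next
    case False
    hence "Suc r \<le> card {l \<in> H. R l m}" using H(3)[OF that] that by auto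
    also have "\<dots> \<le> card {l \<in> H \<union> H'. R l m}" using finH finH' by (intro card_mono) auto
    finally show ?thesis .
  qed
  moreover have "card (H \<union> H') \<le> Suc r * h" using card_Un_le[of H H'] H(2) H'(2) by simp
  ultimately show ?case using H(1) H'(1) by (intro exI[of _ "H \<union> H'"]) auto
qed

subsection \<open>Counting crossings\<close>

definition crossings :: "'a::field line set \<Rightarrow> 'a line set \<Rightarrow> nat" where
  "crossings M1 M2 = card {(l, m). l \<in> M1 \<and> m \<in> M2 \<and> cross l m}"

lemma crossings_sum:
  assumes "finite M1" "finite M2"
  shows "crossings M1 M2 = (\<Sum>l\<in>M1. card {m \<in> M2. cross l m})"
    "crossings M1 M2 = (\<Sum>m\<in>M2. card {l \<in> M1. cross l m})"
proof -
  have "{(l, m). l \<in> M1 \<and> m \<in> M2 \<and> cross l m} = (SIGMA l:M1. {m \<in> M2. cross l m})" by auto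
  thus "crossings M1 M2 = (\<Sum>l\<in>M1. card {m \<in> M2. cross l m})"
    using assms by (simp add: crossings_def)
  thus "crossings M1 M2 = (\<Sum>m\<in>M2. card {l \<in> M1. cross l m})"
    using double_count[OF assms] by simp
qed

lemma crossings_Un1:
  assumes "finite M1" "finite M2" "finite M1'" "M1 \<inter> M1' = {}"
  shows "crossings (M1 \<union> M1') M2 = crossings M1 M2 + crossings M1' M2"
  using assms by (simp add: crossings_sum(1) sum.union_disjoint)

lemma crossings_Un2:
  assumes "finite M1" "finite M2" "finite M2'" "M2 \<inter> M2' = {}"
  shows "crossings M1 (M2 \<union> M2') = crossings M1 M2 + crossings M1 M2'"
  using assms by (simp add: crossings_sum(2) sum.union_disjoint)

text \<open>Deleting a line with at most \<open>\<Theta>\<close> crossings preserves the inequality,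
  so a pair of least total size that satisfies it has only rich lines.\<close>

lemma trim:
  assumes "finite L1" "finite L2"
  shows "\<exists>M1 M2. M1 \<subseteq> L1 \<and> M2 \<subseteq> L2 \<and>
    crossings L1 L2 + \<Theta> * (card M1 + card M2) \<le> crossings M1 M2 + \<Theta> * (card L1 + card L2) \<and>
    (\<forall>l\<in>M1. \<Theta> < card {m \<in> M2. cross l m}) \<and> (\<forall>m\<in>M2. \<Theta> < card {l \<in> M1. cross l m})"
proof -
  let ?P = "\<lambda>(M1, M2). M1 \<subseteq> L1 \<and> M2 \<subseteq> L2 \<and>
    crossings L1 L2 + \<Theta> * (card M1 + card M2) \<le> crossings M1 M2 + \<Theta> * (card L1 + card L2)"
  from ex_has_least_nat[of ?P "(L1, L2)" "\<lambda>(M1, M2). card M1 + card M2"] obtain M1 M2 where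
    M: "M1 \<subseteq> L1" "M2 \<subseteq> L2" and ineq:
    "crossings L1 L2 + \<Theta> * (card M1 + card M2) \<le> crossings M1 M2 + \<Theta> * (card L1 + card L2)"
    and min: "\<And>N1 N2. ?P (N1, N2) \<Longrightarrow> card M1 + card M2 \<le> card N1 + card N2" by auto
  have fin: "finite M1" "finite M2" using M assms finite_subset by auto
  have "\<Theta> < card {m \<in> M2. cross l m}" if l: "l \<in> M1" for l
  proof (rule ccontr)
    assume low: "\<not> ?thesis"
    have "crossings M1 M2 = card {m \<in> M2. cross l m} + crossings (M1 - {l}) M2"
      using fin l by (simp add: crossings_sum(1) sum.remove)
    moreover have "card M1 = Suc (card (M1 - {l}))" by (rule card_Suc_Diff1[OF fin(1) l, symmetric])
    ultimately have "?P (M1 - {l}, M2)" using M ineq low by auto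
    from min[OF this] \<open>card M1 = _\<close> show False by simp
  qed
  moreover have "\<Theta> < card {l \<in> M1. cross l m}" if m: "m \<in> M2" for m
  proof (rule ccontr)
    assume low: "\<not> ?thesis"
    have "crossings M1 M2 = card {l \<in> M1. cross l m} + crossings M1 (M2 - {m})"
      using fin m by (simp add: crossings_sum(2) sum.remove)
    moreover have "card M2 = Suc (card (M2 - {m}))" by (rule card_Suc_Diff1[OF fin(2) m, symmetric])
    ultimately have "?P (M1, M2 - {m})" using M ineq low by auto
    from min[OF this] \<open>card M2 = _\<close> show False by simp
  qed
  ultimately show ?thesis using M ineq by blast
qed

context line_families
begin

text \<open>A counterexample of least degree is irreducible. For f = g h split the lines into those
  on g and the rest, which lie on h. A line off g crosses at most \<open>tdeg g\<close> lines on g,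
  and raising its weight from \<delta> + tdeg h to \<delta> + tdeg f pays exactly for these.\<close>

lemma crossings_on_surface_le:
  assumes f: "f \<noteq> 0" "tdeg f \<le> a" and P: "P1 \<subseteq> L1" "P2 \<subseteq> L2"
    and van: "\<And>l. l \<in> P1 \<union> P2 \<Longrightarrow> vanishes f l"
    and char: "\<And>k. 0 < k \<Longrightarrow> k \<le> a \<Longrightarrow> of_nat k \<noteq> (0 :: 'a)"
    and \<Delta>: "\<And>l. l \<in> L1 \<Longrightarrow> card {m \<in> L2. cross l m} \<le> \<Delta>"
  shows "crossings P1 P2 \<le> (4 * a + N) * (card P1 + card P2) + \<Delta> * (20 * a + N) * a"
proof (rule ccontr)
  assume large: "\<not> ?thesis"
  \<comment> \<open>As \<open>tdeg f\<close> is at most \<open>a\<close>, trimming at \<delta> +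
    tdeg f leaves lines with more than 4 tdeg f + N crossings, while the weight never exceeds 4 a +
    N.\<close>
  define \<delta> \<kappa> where "\<delta> = 3 * a + N" and "\<kappa> = \<Delta> * (20 * a + N)"
  let ?\<Phi> = "\<lambda>(f, M1, M2). f \<noteq> 0 \<and> tdeg f \<le> a \<and> M1 \<subseteq> L1 \<and> M2 \<subseteq> L2 \<and> (\<forall>l\<in>M1 \<union> M2. vanishes f l) \<and>
    (\<delta> + tdeg f) * (card M1 + card M2) + \<kappa> * tdeg f < crossings M1 M2"
  have "?\<Phi> (f, P1, P2)"
  proof -
    have "(\<delta> + tdeg f) * (card P1 + card P2) \<le> (4 * a + N) * (card P1 + card P2)" "\<kappa> * tdeg f \<le> \<kappa> * a"
      using f(2) by (auto simp: \<delta>_def intro!: mult_le_mono)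
    with large have "(\<delta> + tdeg f) * (card P1 + card P2) + \<kappa> * tdeg f < crossings P1 P2"
      unfolding \<kappa>_def by linarith
    thus ?thesis using f P van by simp
  qed
  from ex_has_least_nat[of ?\<Phi>, OF this, of "\<lambda>t. tdeg (fst t)"] obtain t where
    t: "?\<Phi> t" "\<forall>t'. ?\<Phi> t' \<longrightarrow> tdeg (fst t) \<le> tdeg (fst t')" by blast
  obtain f M1 M2 where t': "t = (f, M1, M2)" by (metis prod_cases3)
  have f: "f \<noteq> 0" "tdeg f \<le> a" and M: "M1 \<subseteq> L1" "M2 \<subseteq> L2"
    using t(1) unfolding t' prod.case by blast+
  have van: "vanishes f l" if "l \<in> M1 \<union> M2" for l
    using t(1) that unfolding t' prod.case by blast
  have many: "(\<delta> + tdeg f) * (card M1 + card M2) + \<kappa> * tdeg f < crossings M1 M2"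
    using t(1) unfolding t' prod.case by blast
  have min: "tdeg f \<le> tdeg g" if "?\<Phi> (g, N1, N2)" for g N1 N2
    using t(2)[rule_format, OF that] unfolding t' fst_conv .
  have finM: "finite M1" "finite M2" using M fin finite_subset by auto
  have irr: "irreducible f"
  proof (rule irreducibleI)
    show "f \<noteq> 0" by fact
    show "\<not> is_unit f"
    proof
      assume "is_unit f"
      have "M1 \<noteq> {}" using many by (auto simp: crossings_def)
      then obtain s b c where "(s, b, c) \<in> M1" by auto
      hence "iso_line s b c f = 0" using van[of "(s, b, c)"] by (simp add: vanishes_def)
      moreover obtain g where "1 = f * g" using \<open>is_unit f\<close> unfolding dvd_def by blast
      ultimately show False
      proof -
        interpret h: comm_ring_hom "iso_line s b c" by (rule on_line_hom)
        have "1 = iso_line s b c f * iso_line s b c g" using \<open>1 = f * g\<close> by (metis h.hom_mult h.hom_one)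
        with \<open>iso_line s b c f = 0\<close> show False by simp
      qed
    qed
    fix g h assume fgh: "f = g * h"
    show "is_unit g \<or> is_unit h"
    proof (rule ccontr)
      assume "\<not> (is_unit g \<or> is_unit h)"
      hence pos: "0 < tdeg g" "0 < tdeg h" using tdeg_0_imp_unit[of g] tdeg_0_imp_unit[of h] f fgh by auto
      have deg: "tdeg f = tdeg g + tdeg h" unfolding fgh by (rule tdeg.mult) (use f fgh in auto)
      define Z1 X1 where "Z1 = {l \<in> M1. vanishes g l}" and "X1 = {l \<in> M1. \<not> vanishes g l}"
      define Z2 X2 where "Z2 = {l \<in> M2. vanishes g l}" and "X2 = {l \<in> M2. \<not> vanishes g l}"
      have finZX: "finite Z1" "finite X1" "finite Z2" "finite X2" using finM by (auto simp: Z1_def Z2_def X1_def X2_def)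
      have "vanishes h l" if "l \<in> X1 \<union> X2" for l
      proof -
        obtain s b c where l: "l = (s, b, c)" by (metis prod_cases3)
        interpret h: comm_ring_hom "iso_line s b c" by (rule on_line_hom)
        have "iso_line s b c g * iso_line s b c h = 0" "iso_line s b c g \<noteq> 0"
          using van[of l] that by (auto simp: X1_def X2_def vanishes_def l fgh h.hom_mult)
        thus ?thesis by (simp add: vanishes_def l)
      qed
      hence 1: "crossings X1 X2 \<le> (\<delta> + tdeg h) * (card X1 + card X2) + \<kappa> * tdeg h"
        using min[of h X1 X2] f(1,2) M deg pos fgh by (force simp: X1_def X2_def)
      have 2: "crossings Z1 Z2 \<le> (\<delta> + tdeg g) * (card Z1 + card Z2) + \<kappa> * tdeg g"
        using min[of g Z1 Z2] f(1,2) M deg pos fgh by (force simp: Z1_def Z2_def)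
      have "card {m \<in> Z2. cross l m} \<le> tdeg g" if "l \<in> X1" for l
      proof (rule ccontr)
        assume low: "\<not> ?thesis"
        obtain s b c where l: "l = (s, b, c)" by (metis prod_cases3)
        have "iso_line s b c g = 0"
        proof (rule iso_line_eq_0_if_many_crossings[of "{m \<in> Z2. cross l m}"])
          show "cross (s, b, c) m \<and> fst m \<noteq> s \<and> vanishes g m" if "m \<in> {m \<in> Z2. cross l m}" for m
            using that \<open>l \<in> X1\<close> slopes[of l m] M by (auto simp: X1_def Z2_def l)
          show "m = m'" if "m \<in> {m \<in> Z2. cross l m}" "m' \<in> {m \<in> Z2. cross l m}" "cross m m'" for m m'
            using skew2[of m m'] that M unfolding Z2_def by blast
          show "finite {m \<in> Z2. cross l m}" using finZX by simp
          show "tdeg g < card {m \<in> Z2. cross l m}" using low by simp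
        qed
        with that show False by (simp add: X1_def vanishes_def l)
      qed
      hence 3: "crossings X1 Z2 \<le> tdeg g * card X1"
        using sum_bounded_above[of X1 "\<lambda>l. card {m \<in> Z2. cross l m}" "tdeg g"] finZX
        by (simp add: crossings_sum(1) mult.commute)
      have "card {l \<in> Z1. cross l m} \<le> tdeg g" if "m \<in> X2" for m
      proof (rule ccontr)
        assume low: "\<not> ?thesis"
        obtain s b c where m: "m = (s, b, c)" by (metis prod_cases3)
        have "iso_line s b c g = 0"
        proof (rule iso_line_eq_0_if_many_crossings[of "{l \<in> Z1. cross l m}"])
          show "cross (s, b, c) l \<and> fst l \<noteq> s \<and> vanishes g l" if "l \<in> {l \<in> Z1. cross l m}" for l
            using that \<open>m \<in> X2\<close> slopes[of l m] M cross_sym[of l m] by (auto simp: X2_def Z1_def m)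
          show "l = l'" if "l \<in> {l \<in> Z1. cross l m}" "l' \<in> {l \<in> Z1. cross l m}" "cross l l'" for l l'
            using skew1[of l l'] that M unfolding Z1_def by blast
          show "finite {l \<in> Z1. cross l m}" using finZX by simp
          show "tdeg g < card {l \<in> Z1. cross l m}" using low by simp
        qed
        with that show False by (simp add: X2_def vanishes_def m)
      qed
      hence 4: "crossings Z1 X2 \<le> tdeg g * card X2"
        using sum_bounded_above[of X2 "\<lambda>m. card {l \<in> Z1. cross l m}" "tdeg g"] finZX
        by (simp add: crossings_sum(2) mult.commute)
      have un: "M1 = X1 \<union> Z1" "M2 = X2 \<union> Z2" and disj: "X1 \<inter> Z1 = {}" "X2 \<inter> Z2 = {}"
        by (auto simp: X1_def Z1_def X2_def Z2_def)
      have "crossings M1 M2 = crossings X1 X2 + crossings X1 Z2 + (crossings Z1 X2 + crossings Z1 Z2)"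
        unfolding un using finZX disj by (simp add: crossings_Un1 crossings_Un2)
      moreover have "card M1 = card X1 + card Z1" "card M2 = card X2 + card Z2"
        unfolding un using finZX disj by (simp_all add: card_Un_disjoint)
      ultimately have "crossings M1 M2 \<le> (\<delta> + tdeg f) * (card M1 + card M2) + \<kappa> * tdeg f"
        using 1 2 3 4 unfolding deg by (simp add: algebra_simps)
      with many show False by simp
    qed
  qed
  from trim[OF finM, of "\<delta> + tdeg f"] obtain K1 K2 where K: "K1 \<subseteq> M1" "K2 \<subseteq> M2"
    and K': "crossings M1 M2 + (\<delta> + tdeg f) * (card K1 + card K2) \<le> crossings K1 K2 + (\<delta> + tdeg f) * (card M1 + card M2)"
    and rich: "\<And>l. l \<in> K1 \<Longrightarrow> \<delta> + tdeg f < card {m \<in> K2. cross l m}" by blast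
  have KL: "K1 \<subseteq> L1" "K2 \<subseteq> L2" using K M by auto
  have "\<kappa> * tdeg f < crossings K1 K2" using K' many by linarith
  also have "crossings K1 K2 \<le> (\<Sum>l\<in>K1. \<Delta>)"
  proof -
    have finK: "finite K1" "finite K2" using KL fin finite_subset by auto
    have "card {m \<in> K2. cross l m} \<le> \<Delta>" if "l \<in> K1" for l
      by (rule order_trans[OF card_mono \<Delta>[of l]]) (use KL that fin in auto)
    thus ?thesis unfolding crossings_sum(1)[OF finK] by (intro sum_mono) auto
  qed
  also have "\<dots> = \<Delta> * card K1" by simp
  also have "\<dots> \<le> \<Delta> * (20 * tdeg f ^ 2 + N * tdeg f)"
  proof (rule mult_le_mono2, rule few_lines_on_irreducible_surface[OF irr _ KL])
    show "of_nat k \<noteq> (0 :: 'a)" if "0 < k" "k \<le> tdeg f" for k using char[of k] that f(2) by simp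
    show "vanishes f l" if "l \<in> K1 \<union> K2" for l using van[of l] that K by blast
    show "4 * tdeg f + N < card {m \<in> K2. cross l m}" if "l \<in> K1" for l
      using rich[OF that] f(2) unfolding \<delta>_def by linarith
  qed
  also have "\<dots> \<le> \<kappa> * tdeg f"
  proof -
    have "20 * tdeg f ^ 2 + N * tdeg f = (20 * tdeg f + N) * tdeg f" by (simp add: power2_eq_square algebra_simps)
    also have "\<dots> \<le> (20 * a + N) * tdeg f" using f(2) by (intro mult_le_mono) auto
    finally show ?thesis by (simp add: \<kappa>_def mult.assoc)
  qed
  finally show False by simp
qed

text \<open>Trimming costs \<theta> + a + 1 per line, where a = 27 h bounds the degree of the
  surface. Lines left over have more than a crossings, so vanishing spreads from the hitting set to
  \<open>P2\<close> and then to \<open>P1\<close>. The surface bound adds 4 a + N per line; thus 135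
  h = 5 a and 540 h = 20 a.\<close>

theorem crossings_le:
  assumes h: "card L2 * (1 - real \<theta> / card L1) ^ h < 1" and \<theta>: "\<theta> \<le> card L1" and "0 < h"
    and char: "\<And>k. 0 < k \<Longrightarrow> k \<le> 27 * h \<Longrightarrow> of_nat k \<noteq> (0 :: 'a)"
    and \<Delta>: "\<And>l. l \<in> L1 \<Longrightarrow> card {m \<in> L2. cross l m} \<le> \<Delta>"
  shows "crossings L1 L2 \<le> (\<theta> + 135 * h + 1 + N) * (card L1 + card L2) + \<Delta> * (540 * h + N) * (27 * h)"
proof (cases "L1 = {}")
  case True thus ?thesis by (simp add: crossings_def)
next
  case False
  hence n: "0 < card L1" using fin by (simp add: card_gt_0_iff)
  define a where "a = 27 * h"
  from trim[OF fin, of "\<theta> + a + 1"] obtain P1 P2 where P: "P1 \<subseteq> L1" "P2 \<subseteq> L2"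
    and P': "crossings L1 L2 + (\<theta> + a + 1) * (card P1 + card P2) \<le> crossings P1 P2 + (\<theta> + a + 1) * (card L1 + card L2)"
    and rich1: "\<And>l. l \<in> P1 \<Longrightarrow> \<theta> + a + 1 < card {m \<in> P2. cross l m}"
    and rich2: "\<And>m. m \<in> P2 \<Longrightarrow> \<theta> + a + 1 < card {l \<in> P1. cross l m}" by blast
  have finP: "finite P1" "finite P2" using P fin finite_subset by auto
  have cardP: "card P1 \<le> card L1" "card P2 \<le> card L2" using P fin by (auto intro: card_mono)
  have "real (card P2) * (1 - real \<theta> / card L1) ^ h \<le> card L2 * (1 - real \<theta> / card L1) ^ h"
    using cardP \<theta> n by (intro mult_right_mono) (auto simp: divide_le_eq)
  with h have h': "real (card P2) * (1 - real \<theta> / card L1) ^ h < 1" by linarith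
  have "\<theta> + (a + 1) \<le> card {l \<in> P1. cross l m}" if "m \<in> P2" for m using rich2[OF that] by linarith
  from multiple_hitting_set[of P1 P2 "card L1" \<theta> h "a + 1" cross, OF finP cardP(1) \<theta> n h' this]
  obtain H where H: "H \<subseteq> P1" "card H \<le> (a + 1) * h" "\<And>m. m \<in> P2 \<Longrightarrow> a + 1 \<le> card {l \<in> H. cross l m}" by blast
  \<comment> \<open>The factor 27 is chosen here: with exponents up to 9 h the degree is a = 27 h,
    and the roughly a^2 h = (9 h)^3 conditions stay just below the number of monomials.\<close>
  have "card H * (3 * (9 * h) + 1) < (9 * h + 1) ^ 3"
  proof -
    have "3 * (9 * h) + 1 = a + 1" by (simp add: a_def)
    hence "card H * (3 * (9 * h) + 1) \<le> (a + 1) * h * (a + 1)" using H(2) by (simp only: mult_le_mono1)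
    also have "\<dots> \<le> (3 * (9 * h + 1)) ^ 2 * h" by (simp add: a_def power2_eq_square algebra_simps)
    also have "\<dots> = (9 * h + 1) ^ 2 * (9 * h)" by (simp add: power2_eq_square algebra_simps)
    also have "\<dots> < (9 * h + 1) ^ 2 * (9 * h + 1)" by (intro mult_strict_left_mono) auto
    finally show ?thesis by (simp add: power2_eq_square power3_eq_cube)
  qed
  from exists_vanishing_polynomial[OF _ this] finP H(1) obtain f where
    f: "f \<noteq> 0" "tdeg f \<le> a" "\<And>l. l \<in> H \<Longrightarrow> vanishes f l" by (auto simp: a_def dest: finite_subset)
  have van2: "vanishes f m" if m: "m \<in> P2" for m
  proof -
    obtain s b c where l: "m = (s, b, c)" by (metis prod_cases3)
    have "iso_line s b c f = 0"
    proof (rule iso_line_eq_0_if_many_crossings[of "{l \<in> H. cross l m}"])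
      show "cross (s, b, c) l \<and> fst l \<noteq> s \<and> vanishes f l" if "l \<in> {l \<in> H. cross l m}" for l
        using that m slopes[of l m] P H(1) f(3) cross_sym[of l m] l by auto
      show "finite {l \<in> H. cross l m}" using finP H(1) by (auto dest: finite_subset)
      show "tdeg f < card {l \<in> H. cross l m}" using H(3)[OF m] f(2) by linarith
      show "l = l'" if "l \<in> {l \<in> H. cross l m}" "l' \<in> {l \<in> H. cross l m}" "cross l l'" for l l'
        using skew1[of l l'] that P H(1) by blast
    qed
    thus ?thesis by (simp add: vanishes_def l)
  qed
  have van1: "vanishes f l" if l: "l \<in> P1" for l
  proof -
    obtain s b c where l': "l = (s, b, c)" by (metis prod_cases3)
    have "iso_line s b c f = 0"
    proof (rule iso_line_eq_0_if_many_crossings[of "{m \<in> P2. cross l m}"])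
      show "cross (s, b, c) m \<and> fst m \<noteq> s \<and> vanishes f m" if "m \<in> {m \<in> P2. cross l m}" for m
        using that l slopes[of l m] P van2 by (auto simp: l')
      show "tdeg f < card {m \<in> P2. cross l m}" using rich1[OF l] f(2) by linarith
      show "m = m'" if "m \<in> {m \<in> P2. cross l m}" "m' \<in> {m \<in> P2. cross l m}" "cross m m'" for m m'
        using skew2[of m m'] that P by blast
    qed (use finP in simp)
    thus ?thesis by (simp add: vanishes_def l')
  qed
  have "crossings P1 P2 \<le> (4 * a + N) * (card P1 + card P2) + \<Delta> * (20 * a + N) * a"
    using van1 van2 char \<Delta> by (intro crossings_on_surface_le[OF f(1,2) P]) (auto simp: a_def)
  also have "\<dots> \<le> (4 * a + N) * (card L1 + card L2) + \<Delta> * (20 * a + N) * a"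
    using cardP by (intro add_le_mono mult_le_mono) auto
  finally have "crossings L1 L2 \<le> (4 * a + N) * (card L1 + card L2) + \<Delta> * (20 * a + N) * a
      + (\<theta> + a + 1) * (card L1 + card L2)" using P' by linarith
  also have "\<dots> = (\<theta> + 135 * h + 1 + N) * (card L1 + card L2) + \<Delta> * (540 * h + N) * (27 * h)"
    by (simp add: a_def algebra_simps)
  finally show ?thesis .
qed

end

subsection \<open>The lines of a Cartesian product\<close>

text \<open>The solutions of \<open>\<beta>' (x - x') = \<beta> (y - y')\<close> are the crossings of two families of lines. The
  indeterminate \<open>\<kappa>\<close> makes the lines of each family pairwise disjoint.\<close>

abbreviation emb :: "'f::field \<Rightarrow> 'f poly fract" where "emb a \<equiv> to_fract [:a:]"
definition kap :: "'f::field poly fract" where "kap = to_fract [:0, 1:]"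

text \<open>With e = c - s b, crossing reads e' - e = s b' - s' b. Here e is \<beta> (y + \<kappa>)
  for \<open>line1\<close> and -\<beta> (x + \<kappa>) for \<open>line2\<close>, so between the
  families all \<kappa> cancel and the bilinear equation remains. Inside a family crossing becomes a
  cubic relation for \<kappa>.\<close>

definition line1 :: "'f::field \<times> 'f \<times> 'f \<Rightarrow> 'f poly fract line" where
  "line1 = (\<lambda>(\<beta>, x, y). (- emb \<beta>, kap\<^sup>2 * (emb x + kap), emb \<beta> * (emb y + kap) - kap\<^sup>2 * (emb x + kap) * emb \<beta>))"
definition line2 :: "'f::field \<times> 'f \<times> 'f \<Rightarrow> 'f poly fract line" where
  "line2 = (\<lambda>(\<beta>, x, y). (emb \<beta> / kap\<^sup>2, emb y + kap, (emb y + kap) * emb \<beta> / kap\<^sup>2 - emb \<beta> * (emb x + kap)))"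

lemma kap_neq_0 [simp]: "kap \<noteq> 0"
  by (simp add: kap_def)

lemma emb_cubic_eq_0:
  assumes "emb a0 + emb a1 * kap + emb a2 * kap\<^sup>2 + emb a3 * kap ^ 3 = 0"
  shows "a0 = 0 \<and> a1 = 0 \<and> a2 = 0 \<and> a3 = 0"
proof -
  have "to_fract [:a0, a1, a2, a3:] = emb a0 + emb a1 * kap + emb a2 * kap\<^sup>2 + emb a3 * kap ^ 3"
    unfolding kap_def to_fract_hom.hom_power[symmetric] to_fract_hom.hom_mult[symmetric] to_fract_hom.hom_add[symmetric]
    by (rule arg_cong[of _ _ to_fract]) (simp add: power2_eq_square power3_eq_cube)
  with assms have "[:a0, a1, a2, a3:] = 0" by simp
  thus ?thesis by simp
qed

lemma emb_simps: "emb (a + b) = emb a + emb b" "emb (a - b) = emb a - emb b" "emb (a * b) = emb a * emb b"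
  "emb (- a) = - emb a"
  unfolding to_fract_add[symmetric] to_fract_mult[symmetric] to_fract_diff[symmetric] to_fract_uminus[symmetric]
  by simp_all

lemma emb_eq_iff: "emb a = emb b \<longleftrightarrow> a = b"
  by simp

lemma cubic_coeffs_eqD:
  fixes \<beta> :: "'f::field"
  assumes "\<beta> * y - \<beta>' * y' = 0 \<and> \<beta> - \<beta>' = 0 \<and> \<beta>' * x - \<beta> * x' = 0 \<and> \<beta>' - \<beta> = 0" "\<beta> \<noteq> 0"
  shows "\<beta> = \<beta>' \<and> x = x' \<and> y = y'"
proof -
  have "\<beta> - \<beta>' = 0" using assms(1) by blast
  hence \<beta>: "\<beta>' = \<beta>" by (metis eq_iff_diff_eq_0)
  show ?thesis using assms unfolding \<beta> by simp
qed

lemma cubic_coeffs_eqD2: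
  fixes \<beta> :: "'f::field"
  assumes "\<beta> * y - \<beta>' * y' = 0 \<and> \<beta> - \<beta>' = 0 \<and> \<beta>' * x' - \<beta> * x = 0 \<and> \<beta>' - \<beta> = 0" "\<beta> \<noteq> 0"
  shows "\<beta> = \<beta>' \<and> x = x' \<and> y = y'"
proof -
  have "\<beta> - \<beta>' = 0" using assms(1) by blast
  hence \<beta>: "\<beta>' = \<beta>" by (metis eq_iff_diff_eq_0)
  show ?thesis using assms unfolding \<beta> by simp
qed

lemma cubic_coeffs_eqD3:
  fixes \<beta> :: "'f::field"
  assumes "\<beta> * y' - \<beta>' * y = 0 \<and> \<beta> - \<beta>' = 0 \<and> \<beta>' * x' - \<beta> * x = 0 \<and> \<beta>' - \<beta> = 0" "\<beta> \<noteq> 0"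
  shows "\<beta> = \<beta>' \<and> x = x' \<and> y = y'"
proof -
  have "\<beta> - \<beta>' = 0" using assms(1) by blast
  hence \<beta>: "\<beta>' = \<beta>" by (metis eq_iff_diff_eq_0)
  show ?thesis using assms unfolding \<beta> by simp
qed

text \<open>As \<kappa> is transcendental, the cubic relation holds coefficientwise. The terms free
  of \<open>x\<close> and \<open>y\<close> give \<beta> = \<beta>'; dividing the others by \<beta>
  gives the rest.\<close>

lemma cross_line1_line1:
  assumes "cross (line1 (\<beta>, x, y)) (line1 (\<beta>', x', y'))" "\<beta> \<noteq> 0"
  shows "\<beta> = \<beta>' \<and> x = x' \<and> y = y'"
proof -
  have "emb (\<beta> * y - \<beta>' * y') + emb (\<beta> - \<beta>') * kap + emb (\<beta>' * x - \<beta> * x') * kap\<^sup>2 + emb (\<beta>' - \<beta>) * kap ^ 3 = 0"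
  proof -
    have *: "(b * y - b' * y') + (b - b') * \<kappa> + (b' * x - b * x') * k2 + (b' - b) * (\<kappa> * k2)
        = (- b + - b') * (k2 * (x' + \<kappa>) - k2 * (x + \<kappa>))
          - ((b' * (y' + \<kappa>) - k2 * (x' + \<kappa>) * b') - (b * (y + \<kappa>) - k2 * (x + \<kappa>) * b))"
      for b b' x x' y y' \<kappa> k2 :: "'a poly fract"
      by (simp add: algebra_simps)
    have 3: "kap ^ 3 = kap * (kap\<^sup>2 :: 'a poly fract)" by (simp add: power3_eq_cube power2_eq_square)
    show ?thesis
      unfolding emb_simps 3 *[where b = "emb \<beta>" and b' = "emb \<beta>'" and x = "emb x" and x' = "emb x'"
        and y = "emb y" and y' = "emb y'" and \<kappa> = kap and ?k2.0 = "kap\<^sup>2"]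
      using assms(1) unfolding cross_def line1_def prod.case by (simp only: diff_self)
  qed
  from cubic_coeffs_eqD[OF emb_cubic_eq_0[OF this] assms(2)] show ?thesis by simp
qed

lemma line2_alt:
  "line2 (\<beta>, x, y) = (emb \<beta> * (1 / kap\<^sup>2), emb y + kap, (emb y + kap) * (emb \<beta> * (1 / kap\<^sup>2)) - emb \<beta> * (emb x + kap))"
  by (simp only: line2_def prod.case times_divide_eq_right mult_1_right)

lemma cross_line2_line2:
  assumes "cross (line2 (\<beta>, x, y)) (line2 (\<beta>', x', y'))" "\<beta> \<noteq> 0"
  shows "\<beta> = \<beta>' \<and> x = x' \<and> y = y'"
proof -
  define k where "k = 1 / (kap\<^sup>2 :: 'a poly fract)"
  have k: "kap\<^sup>2 * k = 1" by (simp add: k_def)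
  have 1: "(emb y' + kap) * (emb \<beta>' * k) - emb \<beta>' * (emb x' + kap) - ((emb y + kap) * (emb \<beta> * k) - emb \<beta> * (emb x + kap))
      = (emb \<beta> * k + emb \<beta>' * k) * (emb y' + kap - (emb y + kap))"
    using assms(1) unfolding cross_def line2_alt prod.case k_def .
  have "emb (\<beta> * y' - \<beta>' * y) + emb (\<beta> - \<beta>') * kap + emb (\<beta>' * x' - \<beta> * x) * kap\<^sup>2 + emb (\<beta>' - \<beta>) * kap ^ 3 = 0"
  proof -
    have *: "(b * y' - b' * y) + (b - b') * \<kappa> + (b' * x' - b * x) * k2 + (b' - b) * (\<kappa> * k2)
        = (k2 * k - 1) * (\<kappa> * (b' - b) - b * y' + b' * y)
          - k2 * ((y' + \<kappa>) * (b' * k) - b' * (x' + \<kappa>) - ((y + \<kappa>) * (b * k) - b * (x + \<kappa>))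
            - (b * k + b' * k) * (y' + \<kappa> - (y + \<kappa>)))"
      for b b' x x' y y' \<kappa> k k2 :: "'a poly fract"
      by (simp add: algebra_simps)
    have 3: "kap ^ 3 = kap * (kap\<^sup>2 :: 'a poly fract)" by (simp add: power3_eq_cube power2_eq_square)
    show ?thesis
      unfolding emb_simps 3 *[where b = "emb \<beta>" and b' = "emb \<beta>'" and x = "emb x" and x' = "emb x'"
        and y = "emb y" and y' = "emb y'" and \<kappa> = kap and k = k and ?k2.0 = "kap\<^sup>2"]
      by (simp only: 1 k diff_self mult_zero_left mult_zero_right)
  qed
  from cubic_coeffs_eqD3[OF emb_cubic_eq_0[OF this] assms(2)] show ?thesis by simp
qed

lemma cross_line1_line2:
  "cross (line1 (\<beta>, x, y)) (line2 (\<beta>', x', y')) \<longleftrightarrow> \<beta>' * (x - x') = \<beta> * (y - y')"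
proof -
  define k where "k = 1 / (kap\<^sup>2 :: 'a poly fract)"
  have k: "kap\<^sup>2 * k = 1" by (simp add: k_def)
  have "cross (line1 (\<beta>, x, y)) (line2 (\<beta>', x', y')) \<longleftrightarrow>
      (emb y' + kap) * (emb \<beta>' * k) - emb \<beta>' * (emb x' + kap) - (emb \<beta> * (emb y + kap) - kap\<^sup>2 * (emb x + kap) * emb \<beta>)
      = (- emb \<beta> + emb \<beta>' * k) * (emb y' + kap - kap\<^sup>2 * (emb x + kap))"
    unfolding cross_def line1_def line2_alt prod.case k_def ..
  also have "\<dots> \<longleftrightarrow> emb \<beta>' * (emb x - emb x') = emb \<beta> * (emb y - emb y')"
  proof -
    have "(y' + \<kappa>) * (b' * k) - b' * (x' + \<kappa>) - (b * (y + \<kappa>) - k2 * (x + \<kappa>) * b)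
        - (- b + b' * k) * (y' + \<kappa> - k2 * (x + \<kappa>)) = b' * (x - x') - b * (y - y')"
      if "k2 * k = 1" for b b' x x' y y' \<kappa> k k2 :: "'a poly fract"
    proof -
      have "(y' + \<kappa>) * (b' * k) - b' * (x' + \<kappa>) - (b * (y + \<kappa>) - k2 * (x + \<kappa>) * b)
        - (- b + b' * k) * (y' + \<kappa> - k2 * (x + \<kappa>)) = b' * (x - x') - b * (y - y') + (k2 * k - 1) * (b' * (x + \<kappa>))"
        by (simp add: algebra_simps)
      with that show ?thesis by simp
    qed
    from diff_eq_diff_eq[OF this[OF k]] show ?thesis .
  qed
  also have "\<dots> \<longleftrightarrow> \<beta>' * (x - x') = \<beta> * (y - y')"
    by (simp only: emb_simps[symmetric] emb_eq_iff)
  finally show ?thesis .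
qed

lemma cross_refl: "cross l l"
  by (cases l) (simp add: cross_def)

section \<open>Solutions over a Cartesian product counted as crossings\<close>

definition grid_solutions :: "'f::field set \<Rightarrow> 'f set \<Rightarrow> (('f \<times> 'f \<times> 'f) \<times> ('f \<times> 'f \<times> 'f)) set" where
  "grid_solutions B D = {((\<beta>, x, y), (\<beta>', x', y')). (\<beta>, x, y) \<in> B \<times> D \<times> D \<and> (\<beta>', x', y') \<in> B \<times> D \<times> D \<and>
    \<beta>' * (x - x') = \<beta> * (y - y')}"

lemma card_le_inj:
  assumes "inj_on f A" "f ` A \<subseteq> B" "finite B" "card B \<le> N"
  shows "card A \<le> N"
  using card_inj_on_le[OF assms(1-3)] assms(4) by simp

context
  fixes B D :: "'f::field set" and N :: nat
  assumes fin: "finite B" "finite D" and nz: "0 \<notin> B" and card: "card B \<le> N" "card D \<le> N"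
begin

text \<open>A line crosses itself, so skewness of the family already contains injectivity.\<close>

lemma inj_line1: "inj_on line1 (B \<times> D \<times> D)"
proof (rule inj_onI)
  fix t t' assume t: "t \<in> B \<times> D \<times> D" and eq: "line1 t = line1 t'"
  obtain \<beta> x y \<beta>' x' y' where [simp]: "t = (\<beta>, x, y)" "t' = (\<beta>', x', y')" by (metis prod_cases3)
  have "cross (line1 (\<beta>, x, y)) (line1 (\<beta>', x', y'))" using eq cross_refl[of "line1 t"] by simp
  from cross_line1_line1[OF this] t nz show "t = t'" by auto
qed

lemma inj_line2: "inj_on line2 (B \<times> D \<times> D)"
proof (rule inj_onI)
  fix t t' assume t: "t \<in> B \<times> D \<times> D" and eq: "line2 t = line2 t'"
  obtain \<beta> x y \<beta>' x' y' where [simp]: "t = (\<beta>, x, y)" "t' = (\<beta>', x', y')" by (metis prod_cases3)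
  have "cross (line2 (\<beta>, x, y)) (line2 (\<beta>', x', y'))" using eq cross_refl[of "line2 t"] by simp
  from cross_line2_line2[OF this] t nz show "t = t'" by auto
qed

lemma card_line2_image:
  assumes "\<And>\<beta> x y. (\<beta>, x, y) \<in> B \<times> D \<times> D \<Longrightarrow> P (line2 (\<beta>, x, y)) \<longleftrightarrow> Q \<beta> x y"
  shows "card {m \<in> line2 ` (B \<times> D \<times> D). P m} = card {(\<beta>, x, y). (\<beta>, x, y) \<in> B \<times> D \<times> D \<and> Q \<beta> x y}"
proof -
  have "{m \<in> line2 ` (B \<times> D \<times> D). P m} = line2 ` {(\<beta>, x, y). (\<beta>, x, y) \<in> B \<times> D \<times> D \<and> Q \<beta> x y}"
    using assms by force
  moreover have "inj_on line2 {(\<beta>, x, y). (\<beta>, x, y) \<in> B \<times> D \<times> D \<and> Q \<beta> x y}"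
    by (rule inj_on_subset[OF inj_line2]) auto
  ultimately show ?thesis by (simp add: card_image)
qed

lemma line_families_grid: "line_families (line1 ` (B \<times> D \<times> D)) (line2 ` (B \<times> D \<times> D)) N"
proof
  show "finite (line1 ` (B \<times> D \<times> D))" "finite (line2 ` (B \<times> D \<times> D))" using fin by auto
  show "l = l'" if l: "l \<in> line1 ` (B \<times> D \<times> D)" "l' \<in> line1 ` (B \<times> D \<times> D)" and cr: "cross l l'" for l l'
  proof -
    from l obtain \<beta> x y \<beta>' x' y' where ll: "l = line1 (\<beta>, x, y)" "l' = line1 (\<beta>', x', y')" "\<beta> \<in> B" by blast
    hence "\<beta> \<noteq> 0" using nz by blast
    from cross_line1_line1[OF cr[unfolded ll(1,2)] this] ll(1,2) show "l = l'" by simp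
  qed
  show "l = l'" if l: "l \<in> line2 ` (B \<times> D \<times> D)" "l' \<in> line2 ` (B \<times> D \<times> D)" and cr: "cross l l'" for l l'
  proof -
    from l obtain \<beta> x y \<beta>' x' y' where ll: "l = line2 (\<beta>, x, y)" "l' = line2 (\<beta>', x', y')" "\<beta> \<in> B" by blast
    hence "\<beta> \<noteq> 0" using nz by blast
    from cross_line2_line2[OF cr[unfolded ll(1,2)] this] ll(1,2) show "l = l'" by simp
  qed
  show "fst l \<noteq> fst l'" if "l \<in> line1 ` (B \<times> D \<times> D)" "l' \<in> line2 ` (B \<times> D \<times> D)" for l l'
  proof
    assume eq: "fst l = fst l'"
    from that obtain \<beta> x y \<beta>' x' y' where l: "l = line1 (\<beta>, x, y)" "l' = line2 (\<beta>', x', y')" "\<beta> \<in> B"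
      by blast
    have "- emb \<beta> = emb \<beta>' / kap\<^sup>2" using eq by (simp add: l line1_def line2_def)
    hence \<beta>': "emb \<beta>' = - emb \<beta> * kap\<^sup>2" by (simp add: divide_eq_eq eq_divide_eq)
    have "emb \<beta>' + emb 0 * kap + emb \<beta> * kap\<^sup>2 + emb 0 * kap ^ 3 = 0" unfolding \<beta>' by simp
    from emb_cubic_eq_0[OF this] have "\<beta> = 0" by blast
    with nz \<open>\<beta> \<in> B\<close> show False by blast
  qed
  show "inj_on (snd \<circ> snd) (line1 ` (B \<times> D \<times> D))"
  proof (rule inj_onI)
    fix l l' assume l: "l \<in> line1 ` (B \<times> D \<times> D)" "l' \<in> line1 ` (B \<times> D \<times> D)" and "(snd \<circ> snd) l = (snd \<circ> snd) l'"
    then obtain \<beta> x y \<beta>' x' y' where ll: "l = line1 (\<beta>, x, y)" "l' = line1 (\<beta>', x', y')" and B: "\<beta> \<in> B"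
      and eq: "(snd \<circ> snd) (line1 (\<beta>, x, y)) = (snd \<circ> snd) (line1 (\<beta>', x', y'))"
      by blast
    have "emb (\<beta> * y - \<beta>' * y') + emb (\<beta> - \<beta>') * kap + emb (\<beta>' * x' - \<beta> * x) * kap\<^sup>2 + emb (\<beta>' - \<beta>) * kap ^ 3 = 0"
    proof -
      have *: "(b * y - b' * y') + (b - b') * \<kappa> + (b' * x' - b * x) * k2 + (b' - b) * (\<kappa> * k2)
          = (b * (y + \<kappa>) - k2 * (x + \<kappa>) * b) - (b' * (y' + \<kappa>) - k2 * (x' + \<kappa>) * b')"
        for b b' x x' y y' \<kappa> k2 :: "'f poly fract"
        by (simp add: algebra_simps)
      have 3: "kap ^ 3 = kap * (kap\<^sup>2 :: 'f poly fract)" by (simp add: power3_eq_cube power2_eq_square)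
      show ?thesis
        unfolding emb_simps 3 *[where b = "emb \<beta>" and b' = "emb \<beta>'" and x = "emb x" and x' = "emb x'"
          and y = "emb y" and y' = "emb y'" and \<kappa> = kap and ?k2.0 = "kap\<^sup>2"]
        using eq unfolding line1_def comp_def prod.case snd_conv by (simp only: diff_self)
    qed
    moreover have "\<beta> \<noteq> 0" using B nz by blast
    ultimately have "\<beta> = \<beta>' \<and> x = x' \<and> y = y'"
      using cubic_coeffs_eqD2[OF emb_cubic_eq_0] by blast
    thus "l = l'" by (simp only: ll)
  qed
  show "card {l \<in> line1 ` (B \<times> D \<times> D). fst l = s \<and> fst (snd l) = b} \<le> N" for s b
  proof (cases "{l \<in> line1 ` (B \<times> D \<times> D). fst l = s \<and> fst (snd l) = b} = {}")
    case False
    then obtain l1 where "l1 \<in> line1 ` (B \<times> D \<times> D)" "fst l1 = s" "fst (snd l1) = b" by blast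
    then obtain \<beta> x y where 1: "fst (line1 (\<beta>, x, y)) = s" "fst (snd (line1 (\<beta>, x, y))) = b" by blast
    have "{l \<in> line1 ` (B \<times> D \<times> D). fst l = s \<and> fst (snd l) = b} \<subseteq> (\<lambda>y. line1 (\<beta>, x, y)) ` D"
    proof
      fix l2 assume "l2 \<in> {l \<in> line1 ` (B \<times> D \<times> D). fst l = s \<and> fst (snd l) = b}"
      then obtain \<beta>' x' y' where l2: "l2 = line1 (\<beta>', x', y')" and "y' \<in> D"
        and 2: "fst (line1 (\<beta>', x', y')) = s" "fst (snd (line1 (\<beta>', x', y'))) = b" by blast
      have "\<beta> = \<beta>'" "x = x'" using 1 2 by (auto simp: line1_def simp flip: emb_simps)
      with \<open>y' \<in> D\<close> show "l2 \<in> (\<lambda>y. line1 (\<beta>, x, y)) ` D" unfolding l2 by blast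
    qed
    hence "card {l \<in> line1 ` (B \<times> D \<times> D). fst l = s \<and> fst (snd l) = b} \<le> card D"
      using fin by (meson card_image_le card_mono finite_imageI le_trans)
    with card show ?thesis by simp
  next
    case True
    show ?thesis unfolding True by simp
  qed
  show "card {m \<in> line2 ` (B \<times> D \<times> D). cross l m \<and> cross l' m} \<le> N"
    if l: "l \<in> line1 ` (B \<times> D \<times> D)" "l' \<in> line1 ` (B \<times> D \<times> D)" "l \<noteq> l'" for l l'
  proof -
    from l obtain \<beta>1 x1 y1 \<beta>2 x2 y2 where ll: "l = line1 (\<beta>1, x1, y1)" "l' = line1 (\<beta>2, x2, y2)"
      and B: "\<beta>1 \<in> B" "\<beta>2 \<in> B" by auto
    have ne: "(\<beta>1, x1, y1) \<noteq> (\<beta>2, x2, y2)" using l(3) ll by auto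
    let ?M = "{(\<beta>, x, y). (\<beta>, x, y) \<in> B \<times> D \<times> D \<and> (\<beta> * (x1 - x) = \<beta>1 * (y1 - y) \<and> \<beta> * (x2 - x) = \<beta>2 * (y2 - y))}"
    \<comment> \<open>For distinct \<beta>1, \<beta>2 the value \<beta> determines y and then x. For
      equal ones x1 and x2 must differ, so x determines \<beta> and then y.\<close>
    have "card ?M \<le> N"
    proof (cases "\<beta>1 = \<beta>2")
      case False
      have "inj_on fst ?M"
      proof (rule inj_onI)
        fix t t' assume "t \<in> ?M" "t' \<in> ?M" "fst t = fst t'"
        then obtain \<beta> x y x' y' where t: "t = (\<beta>, x, y)" "t' = (\<beta>, x', y')" and "\<beta> \<in> B"
          and e: "\<beta> * (x1 - x) = \<beta>1 * (y1 - y)" "\<beta> * (x2 - x) = \<beta>2 * (y2 - y)"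
            "\<beta> * (x1 - x') = \<beta>1 * (y1 - y')" "\<beta> * (x2 - x') = \<beta>2 * (y2 - y')" by force
        have "(\<beta>1 - \<beta>2) * (y - y') = 0" using e by Groebner_Basis.algebra
        with False have "y = y'" by simp
        hence "\<beta> * (x1 - x) = \<beta> * (x1 - x')" using e by simp
        with \<open>\<beta> \<in> B\<close> nz \<open>y = y'\<close> show "t = t'" by (auto simp: t)
      qed
      moreover have "fst ` ?M \<subseteq> B" by auto
      ultimately show ?thesis using fin(1) card(1) by (rule card_le_inj)
    next
      case True
      have "inj_on (\<lambda>(\<beta>, x, y). x) ?M"
      proof (rule inj_onI)
        fix t t' assume "t \<in> ?M" "t' \<in> ?M" "(\<lambda>(\<beta>, x, y). x) t = (\<lambda>(\<beta>, x, y). x) t'"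
        then obtain \<beta> \<beta>' x y y' where t: "t = (\<beta>, x, y)" "t' = (\<beta>', x, y')"
          and e: "\<beta> * (x1 - x) = \<beta>1 * (y1 - y)" "\<beta> * (x2 - x) = \<beta>2 * (y2 - y)"
            "\<beta>' * (x1 - x) = \<beta>1 * (y1 - y')" "\<beta>' * (x2 - x) = \<beta>2 * (y2 - y')" by force
        have "x1 \<noteq> x2"
        proof
          assume "x1 = x2"
          hence "\<beta>1 * (y1 - y) = \<beta>1 * (y2 - y)" using e(1,2) True by metis
          with B nz ne True \<open>x1 = x2\<close> show False by auto
        qed
        moreover have "(\<beta> - \<beta>') * (x1 - x2) = 0" using e True by Groebner_Basis.algebra
        ultimately have "\<beta> = \<beta>'" by simp
        hence "\<beta>1 * (y1 - y) = \<beta>1 * (y1 - y')" using e(1,3) by metis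
        with B nz \<open>\<beta> = \<beta>'\<close> show "t = t'" by (auto simp: t)
      qed
      moreover have "(\<lambda>(\<beta>, x, y). x) ` ?M \<subseteq> D" by auto
      ultimately show ?thesis using fin(2) card(2) by (rule card_le_inj)
    qed
    moreover have "card {m \<in> line2 ` (B \<times> D \<times> D). cross l m \<and> cross l' m} = card ?M"
      by (rule card_line2_image) (auto simp: ll cross_line1_line2)
    ultimately show ?thesis by simp
  qed
qed

lemma card_crossing_grid_le:
  assumes "l \<in> line1 ` (B \<times> D \<times> D)"
  shows "card {m \<in> line2 ` (B \<times> D \<times> D). cross l m} \<le> N\<^sup>2"
proof -
  from assms obtain \<beta>1 x1 y1 where l: "l = line1 (\<beta>1, x1, y1)" "\<beta>1 \<in> B" by auto
  let ?M = "{(\<beta>, x, y). (\<beta>, x, y) \<in> B \<times> D \<times> D \<and> \<beta> * (x1 - x) = \<beta>1 * (y1 - y)}"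
  have "inj_on (\<lambda>(\<beta>, x, y). (\<beta>, x)) ?M"
    by (rule inj_onI) (use l nz in auto)
  moreover have "card (B \<times> D) \<le> N\<^sup>2" using card by (simp add: card_cartesian_product power2_eq_square mult_le_mono)
  moreover have "finite (B \<times> D)" using fin by simp
  moreover have "(\<lambda>(\<beta>, x, y). (\<beta>, x)) ` ?M \<subseteq> B \<times> D" by auto
  ultimately have "card ?M \<le> N\<^sup>2" by (blast intro: card_le_inj)
  moreover have "card {m \<in> line2 ` (B \<times> D \<times> D). cross l m} = card ?M"
    by (rule card_line2_image) (auto simp: l cross_line1_line2)
  ultimately show ?thesis by simp
qed

lemma card_grid_solutions:
  "card (grid_solutions B D) = crossings (line1 ` (B \<times> D \<times> D)) (line2 ` (B \<times> D \<times> D))"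
proof -
  let ?h = "map_prod line1 line2"
  have "{(l, m). l \<in> line1 ` (B \<times> D \<times> D) \<and> m \<in> line2 ` (B \<times> D \<times> D) \<and> cross l m} = ?h ` grid_solutions B D"
    by (force simp: grid_solutions_def cross_line1_line2)
  moreover have "inj_on ?h (grid_solutions B D)"
    by (rule inj_on_subset[OF map_prod_inj_on[OF inj_line1 inj_line2]]) (auto simp: grid_solutions_def)
  ultimately show ?thesis by (simp add: crossings_def card_image)
qed

text \<open>The condition on \<open>h\<close> is stated with N^3 in place of the size c of the
  families, so that \<open>h\<close> and \<open>\<theta>\<close> can depend on \<open>N\<close>
  only; this is legitimate as c (1 - \<theta>/c)^h grows with c. Families with fewer than
  \<open>\<theta>\<close> lines satisfy the bound trivially.\<close>

lemma card_grid_solutions_le: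
  assumes h: "real N ^ 3 * (1 - real \<theta> / real N ^ 3) ^ h < 1" and "0 < h" "\<theta> \<le> N ^ 3"
    and char: "\<And>k. 0 < k \<Longrightarrow> k \<le> 27 * h \<Longrightarrow> of_nat k \<noteq> (0 :: 'f)"
  shows "card (grid_solutions B D) \<le> (\<theta> + 135 * h + 1 + N) * (2 * N ^ 3) + N\<^sup>2 * (540 * h + N) * (27 * h)"
proof -
  let ?T = "B \<times> D \<times> D"
  interpret L: line_families "line1 ` ?T" "line2 ` ?T" N by (rule line_families_grid)
  have T: "card (line1 ` ?T) = card ?T" "card (line2 ` ?T) = card ?T" "card ?T \<le> N ^ 3"
    using card by (simp_all add: card_image inj_line1 inj_line2 card_cartesian_product power3_eq_cube mult_le_mono mult.assoc)
  show ?thesis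
  proof (cases "\<theta> \<le> card ?T \<and> card ?T \<noteq> 0")
    case True
    define c where "c = real (card ?T)"
    have "real (card ?T) \<le> real (N ^ 3)" using T(3) by (simp only: of_nat_le_iff)
    hence c: "0 < c" "real \<theta> \<le> c" "c \<le> real N ^ 3" using True by (auto simp: c_def)
    moreover have "0 < real N ^ 3" using c by linarith
    ultimately have "real \<theta> / real N ^ 3 \<le> real \<theta> / c" by (intro divide_left_mono mult_pos_pos) auto
    hence "c * (1 - real \<theta> / c) ^ h \<le> real N ^ 3 * (1 - real \<theta> / real N ^ 3) ^ h"
      using c by (intro mult_mono power_mono) (auto simp: divide_le_eq)
    hence "card (line2 ` ?T) * (1 - real \<theta> / card (line1 ` ?T)) ^ h < 1"
      using h by (simp only: T c_def)
    moreover have "of_nat k \<noteq> (0 :: 'f poly fract)" if "0 < k" "k \<le> 27 * h" for k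
    proof -
      have "of_nat k = emb (of_nat k :: 'f)" by (induction k) (simp_all add: emb_simps pCons_one)
      with char[OF that] show ?thesis by simp
    qed
    ultimately have "crossings (line1 ` ?T) (line2 ` ?T) \<le>
        (\<theta> + 135 * h + 1 + N) * (card (line1 ` ?T) + card (line2 ` ?T)) + N\<^sup>2 * (540 * h + N) * (27 * h)"
      using True assms(2) card_crossing_grid_le by (intro L.crossings_le) (auto simp: T)
    also have "\<dots> \<le> (\<theta> + 135 * h + 1 + N) * (2 * N ^ 3) + N\<^sup>2 * (540 * h + N) * (27 * h)"
      using T by (intro add_mono mult_le_mono) auto
    finally show ?thesis by (simp add: card_grid_solutions)
  next
    case False
    have "card (grid_solutions B D) \<le> card (?T \<times> ?T)"
      by (rule card_mono) (use fin in \<open>auto simp: grid_solutions_def\<close>)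
    also have "\<dots> = card ?T * card ?T" by (simp only: card_cartesian_product)
    also have "\<dots> \<le> \<theta> * (2 * N ^ 3)" using False T(3) by (intro mult_le_mono) auto
    also have "\<dots> \<le> (\<theta> + 135 * h + 1 + N) * (2 * N ^ 3)" by (intro mult_le_mono) auto
    finally show ?thesis by linarith
  qed
qed

end

text \<open>The degree of the vanishing polynomial is of order \<open>h\<close>, and a line is poor if it has at most about
  \<open>\<theta>\<close> crossings; \<open>h\<close> of order \<open>N\<^bsup>5/4\<^esup>\<close> and \<open>\<theta>\<close> of order \<open>N\<^bsup>9/5\<^esup>\<close> will do.\<close>

definition admissible :: "nat \<Rightarrow> nat \<Rightarrow> nat \<Rightarrow> bool" where
  "admissible N h \<theta> \<longleftrightarrow> 0 < h \<and> \<theta> \<le> N ^ 3 \<and> real N ^ 3 * (1 - real \<theta> / real N ^ 3) ^ h < 1 \<and> 27 * h < N\<^sup>2 \<and>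
    real ((\<theta> + 135 * h + 1 + N) * (2 * N ^ 3) + N\<^sup>2 * (540 * h + N) * (27 * h)) \<le> real N powr (24 / 5)"

text \<open>The product of x^(9/5) and x^(5/4) exceeds x^3 by the power x^(1/20), so the exponential
  beats the factor x^3. The main term 2 \<theta> x^3 is at most x^(24/5) / 2 thanks to the divisor 8
  in \<open>v\<close>; all others have order at most x^(9/2).\<close>

lemma eventually_admissible: "\<exists>n. \<forall>N\<ge>n. \<exists>h \<theta>. admissible N h \<theta>"
proof -
  have "\<forall>\<^sub>F x::real in at_top. 2 * x powr (5/4) < x\<^sup>2 / 27 \<and> x powr (9/5) / 4 < x ^ 3 \<and>
     1 \<le> x powr (9/5) / 8 \<and> 1 \<le> x powr (5/4) \<and> 1 \<le> x \<and>
     x ^ 3 * exp (- (x powr (9/5) / 8) / x ^ 3 * x powr (5/4)) < 1 \<and>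
     (x powr (9/5) / 4 + 135 * (2 * x powr (5/4)) + 1 + x) * (2 * x ^ 3)
       + x\<^sup>2 * (540 * (2 * x powr (5/4)) + x) * (27 * (2 * x powr (5/4))) \<le> x powr (24/5)"
    by (intro eventually_conj; real_asymp)
  then obtain x0 where x0: "\<And>x::real. x0 \<le> x \<Longrightarrow> 2 * x powr (5/4) < x\<^sup>2 / 27 \<and> x powr (9/5) / 4 < x ^ 3 \<and>
     1 \<le> x powr (9/5) / 8 \<and> 1 \<le> x powr (5/4) \<and> 1 \<le> x \<and>
     x ^ 3 * exp (- (x powr (9/5) / 8) / x ^ 3 * x powr (5/4)) < 1 \<and>
     (x powr (9/5) / 4 + 135 * (2 * x powr (5/4)) + 1 + x) * (2 * x ^ 3)
       + x\<^sup>2 * (540 * (2 * x powr (5/4)) + x) * (27 * (2 * x powr (5/4))) \<le> x powr (24/5)"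
    unfolding eventually_at_top_linorder by blast
  show ?thesis
  proof (rule exI[of _ "nat \<lceil>x0\<rceil>"], intro allI impI)
    fix N assume "nat \<lceil>x0\<rceil> \<le> N"
    hence "x0 \<le> real N" by linarith
    define x where "x = real N"
    define u where "u = x powr (5/4)"
    define v where "v = x powr (9/5) / 8"
    have X: "2 * u < x\<^sup>2 / 27" "2 * v < x ^ 3" "1 \<le> v" "1 \<le> u" "1 \<le> x" "x ^ 3 * exp (- v / x ^ 3 * u) < 1"
      "(2 * v + 135 * (2 * u) + 1 + x) * (2 * x ^ 3) + x\<^sup>2 * (540 * (2 * u) + x) * (27 * (2 * u)) \<le> x powr (24/5)"
      using x0[of x] \<open>x0 \<le> real N\<close> unfolding u_def v_def x_def by auto
    define h where "h = nat \<lceil>u\<rceil>"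
    define \<theta> where "\<theta> = nat \<lfloor>2 * v\<rfloor>"
    have h: "u \<le> real h" "real h \<le> 2 * u" using X(4) unfolding h_def by linarith+
    have \<theta>: "v \<le> real \<theta>" "real \<theta> \<le> 2 * v" using X(3) unfolding \<theta>_def by linarith+
    have "real \<theta> \<le> x ^ 3" using \<theta> X by linarith
    have "(1 - real \<theta> / x ^ 3) ^ h \<le> exp (- real \<theta> / x ^ 3) ^ h"
      using \<open>real \<theta> \<le> x ^ 3\<close> X(5) exp_ge_add_one_self[of "- real \<theta> / x ^ 3"] by (intro power_mono) auto
    also have "\<dots> = exp (- (real \<theta> / x ^ 3 * real h))" by (simp add: exp_of_nat_mult[symmetric] mult.commute)
    also have "\<dots> \<le> exp (- v / x ^ 3 * u)"
      using \<theta> h X by (auto intro!: mult_mono divide_right_mono)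
    finally have "x ^ 3 * (1 - real \<theta> / x ^ 3) ^ h \<le> x ^ 3 * exp (- v / x ^ 3 * u)"
      using X(5) by (intro mult_left_mono) auto
    with X(6) have 1: "x ^ 3 * (1 - real \<theta> / x ^ 3) ^ h < 1" by simp
    have "real (27 * h) < real (N\<^sup>2)" using h X(1) by (simp add: x_def)
    hence 2: "27 * h < N\<^sup>2" by (simp only: of_nat_less_iff)
    have "real \<theta> \<le> real (N ^ 3)" using \<open>real \<theta> \<le> x ^ 3\<close> by (simp add: x_def)
    hence 3: "\<theta> \<le> N ^ 3" by (simp only: of_nat_le_iff)
    have "real ((\<theta> + 135 * h + 1 + N) * (2 * N ^ 3) + N\<^sup>2 * (540 * h + N) * (27 * h))
        = (\<theta> + 135 * h + 1 + x) * (2 * x ^ 3) + x\<^sup>2 * (540 * h + x) * (27 * h)"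
      by (simp only: x_def of_nat_add of_nat_mult of_nat_power of_nat_1 of_nat_numeral)
    also have "\<dots> \<le> (2 * v + 135 * (2 * u) + 1 + x) * (2 * x ^ 3) + x\<^sup>2 * (540 * (2 * u) + x) * (27 * (2 * u))"
      using h \<theta> X by (intro add_mono mult_mono mult_nonneg_nonneg) auto
    finally have "real ((\<theta> + 135 * h + 1 + N) * (2 * N ^ 3) + N\<^sup>2 * (540 * h + N) * (27 * h)) \<le> x powr (24/5)"
      using X(7) by linarith
    moreover have "0 < h" using h(1) X(4) by linarith
    ultimately have "admissible N h \<theta>" using 1 2 3 by (simp add: admissible_def x_def)
    thus "\<exists>h \<theta>. admissible N h \<theta>" by blast
  qed
qed

subsection \<open>Two applications of the Cauchy-Schwarz inequality\<close>

lemma card_squared_le_collisions: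
  assumes "finite X" "finite Y" "f ` X \<subseteq> Y"
  shows "(card X)\<^sup>2 \<le> card Y * card {(a, b). a \<in> X \<and> b \<in> X \<and> f a = f b}"
proof -
  define E where "E y = {x \<in> X. f x = y}" for y
  have fin: "finite (E y)" for y using assms by (simp add: E_def)
  have "card X = card (\<Union>y\<in>Y. E y)" using assms(3) by (intro arg_cong[of _ _ card]) (auto simp: E_def)
  also have "\<dots> = (\<Sum>y\<in>Y. card (E y))"
    using assms fin by (intro card_UN_disjoint) (auto simp: E_def)
  finally have 1: "card X = (\<Sum>y\<in>Y. card (E y))" .
  have "card {(a, b). a \<in> X \<and> b \<in> X \<and> f a = f b} = card (\<Union>y\<in>Y. E y \<times> E y)"
    using assms(3) by (intro arg_cong[of _ _ card]) (auto simp: E_def)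
  also have "\<dots> = (\<Sum>y\<in>Y. card (E y \<times> E y))"
    using assms fin by (intro card_UN_disjoint) (auto simp: E_def)
  finally have 2: "card {(a, b). a \<in> X \<and> b \<in> X \<and> f a = f b} = (\<Sum>y\<in>Y. card (E y) ^ 2)"
    by (simp add: card_cartesian_product power2_eq_square)
  have "(\<Sum>y\<in>Y. 1 * real (card (E y)))\<^sup>2 \<le> (\<Sum>y\<in>Y. 1\<^sup>2) * (\<Sum>y\<in>Y. (real (card (E y)))\<^sup>2)"
    by (rule Cauchy_Schwarz_ineq_sum)
  hence "real ((\<Sum>y\<in>Y. card (E y))\<^sup>2) \<le> real (card Y * (\<Sum>y\<in>Y. card (E y) ^ 2))" by simp
  hence "(\<Sum>y\<in>Y. card (E y))\<^sup>2 \<le> card Y * (\<Sum>y\<in>Y. card (E y) ^ 2)" by (simp only: of_nat_le_iff)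
  thus ?thesis by (simp only: 1 2)
qed

text \<open>For given b, b', c, c' the two equations are linear in a and a'. Two solutions make the
  determinant vanish, b c' = b' c; then d \<noteq> 0 forces c = c', and the triples coincide, which
  \<open>ne\<close> excludes.\<close>

lemma quadruple_determines_triples:
  fixes a :: "'f::field"
  assumes "a * b = a' * b'" "(a + d) * c = (a' + d) * c'" "e * b = e' * b'" "(e + d) * c = (e' + d) * c'"
    and nz: "b \<noteq> 0" "b' \<noteq> 0" "c \<noteq> 0" "c' \<noteq> 0" "d \<noteq> 0" and ne: "(a, b, c) \<noteq> (a', b', c')"
  shows "a = e \<and> a' = e'"
proof -
  have 1: "(a - e) * b = (a' - e') * b'" using assms(1,3) by (simp add: algebra_simps)
  have "(a - e) * c = (a + d) * c - (e + d) * c" "(a' - e') * c' = (a' + d) * c' - (e' + d) * c'"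
    by (simp_all add: algebra_simps)
  with assms(2,4) have 2: "(a - e) * c = (a' - e') * c'" by simp
  have "a = e"
  proof (rule ccontr)
    assume "a \<noteq> e"
    have "(a - e) * (b * c' - b' * c) = ((a - e) * b - (a' - e') * b') * c' - b' * ((a - e) * c - (a' - e') * c')"
      by (simp add: algebra_simps)
    with 1 2 \<open>a \<noteq> e\<close> have 3: "b * c' = b' * c" by simp
    have "d * (c - c') * b' = ((a + d) * c - (a' + d) * c') * b' - (a * (b' * c - b * c') + c' * (a * b - a' * b'))"
      by (simp add: algebra_simps)
    with assms(1,2) 3 nz have "c = c'" by simp
    with 3 nz have "b = b'" by simp
    with assms(1) nz \<open>c = c'\<close> ne show False by simp
  qed
  with 1 nz show ?thesis by simp
qed

text \<open>\<open>n0\<close> counts triples, \<open>P\<close> colliding pairs of triples and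
  \<open>g\<close> those off the diagonal. Removing -d from A and 0 from B and C, so that all
  divisions are legitimate, costs at most one element each, hence N - 1.\<close>

lemma product_sets_inequalities:
  fixes A B C S T :: "'f::field set"
  assumes fin: "finite A" "finite B" "finite C" "finite S" "finite T" and "card A = N" "card B = N" "card C = N"
    and "d \<noteq> 0" and S: "\<And>a b. a \<in> A \<Longrightarrow> b \<in> B \<Longrightarrow> a * b \<in> S" and T: "\<And>a c. a \<in> A \<Longrightarrow> c \<in> C \<Longrightarrow> (a + d) * c \<in> T"
    and M: "card S \<le> M" "card T \<le> M"
    and grid: "\<And>B D :: 'f set. finite B \<Longrightarrow> finite D \<Longrightarrow> 0 \<notin> B \<Longrightarrow> card B \<le> N \<Longrightarrow> card D \<le> N \<Longrightarrow>
      card (grid_solutions B D) \<le> K"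
  obtains n0 P g where "(N - 1) ^ 3 \<le> n0" "n0\<^sup>2 \<le> M * M * P" "P \<le> n0 + g" "g\<^sup>2 \<le> (N * N * M) * K"
proof -
  define A' where "A' = A - {- d}"
  define B' where "B' = B - {0}"
  define C' where "C' = C - {0}"
  define X where "X = A' \<times> B' \<times> C'"
  define F where "F = (\<lambda>(a, b, c). (a * b, (a + d) * c))"
  define Pr where "Pr = {(t, t'). t \<in> X \<and> t' \<in> X \<and> F t = F t'}"
  define Q where "Q = {(t, t'). (t, t') \<in> Pr \<and> t \<noteq> t'}"
  define \<psi> where "\<psi> = (\<lambda>((a::'f, b::'f, c::'f), (a'::'f, b'::'f, c'::'f)). (b, b', b / c - b' / c'))"
  \<comment> \<open>Equal values of \<open>\<psi>\<close> give b (1/c1 - 1/c2) = b' (1/c1' - 1/c2'),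
    a point of the grid. The first components are dropped, as they can be recovered from the others
    off the diagonal.\<close>
  define \<phi> where "\<phi> = (\<lambda>(((a1::'f, b1::'f, c1::'f), (a1'::'f, b1'::'f, c1'::'f)),
      ((a2::'f, b2::'f, c2::'f), (a2'::'f, b2'::'f, c2'::'f))).
    ((b1', inverse c1, inverse c1'), (b1, inverse c2, inverse c2')))"
  have fin': "finite A'" "finite B'" "finite C'" using fin by (simp_all add: A'_def B'_def C'_def)
  have finX: "finite X" using fin' by (simp add: X_def)
  have finP: "finite Pr" by (rule finite_subset[of _ "X \<times> X"]) (use finX in \<open>auto simp: Pr_def\<close>)
  have finQ: "finite Q" by (rule finite_subset[OF _ finP]) (auto simp: Q_def)
  have "N - 1 \<le> card A'" "N - 1 \<le> card B'" "N - 1 \<le> card C'"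
    using assms(6-8) fin by (simp_all add: A'_def B'_def C'_def card_Diff_singleton_if)
  hence "(N - 1) * ((N - 1) * (N - 1)) \<le> card X"
    unfolding X_def card_cartesian_product by (intro mult_le_mono)
  hence 1: "(N - 1) ^ 3 \<le> card X" by (simp add: power3_eq_cube mult.assoc)
  have "(card X)\<^sup>2 \<le> card (S \<times> T) * card Pr"
    unfolding Pr_def using S T fin finX
    by (intro card_squared_le_collisions) (auto simp: X_def F_def A'_def B'_def C'_def)
  also have "\<dots> \<le> M * M * card Pr"
    unfolding card_cartesian_product using M by (intro mult_le_mono) auto
  finally have 2: "(card X)\<^sup>2 \<le> M * M * card Pr" .
  have "Pr \<subseteq> (\<lambda>t. (t, t)) ` X \<union> Q" by (auto simp: Pr_def Q_def)
  hence "card Pr \<le> card ((\<lambda>t. (t, t)) ` X \<union> Q)" using finX finQ by (intro card_mono) auto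
  also have "\<dots> \<le> card ((\<lambda>t. (t, t)) ` X) + card Q" by (rule card_Un_le)
  also have "\<dots> \<le> card X + card Q" using card_image_le[OF finX] by simp
  finally have 3: "card Pr \<le> card X + card Q" .
  have Q: "\<exists>a b c a' b' c'. q = ((a, b, c), (a', b', c')) \<and> a \<in> A' \<and> b \<in> B' \<and> c \<in> C' \<and> a' \<in> A' \<and> b' \<in> B' \<and> c' \<in> C' \<and>
      a * b = a' * b' \<and> (a + d) * c = (a' + d) * c' \<and> (a, b, c) \<noteq> (a', b', c')" if "q \<in> Q" for q
    using that unfolding Q_def Pr_def X_def F_def by force
  let ?Y = "(\<lambda>(b, b', t). (b, b', d * (b - b') / t)) ` (B' \<times> B' \<times> T)"
  have sub: "\<psi> ` Q \<subseteq> ?Y"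
  proof
    fix v assume "v \<in> \<psi> ` Q"
    then obtain q where "q \<in> Q" and v: "v = \<psi> q" by blast
    from Q[OF this(1)] obtain a b c a' b' c' where q: "q = ((a, b, c), (a', b', c'))" and
      mem: "a \<in> A'" "b \<in> B'" "c \<in> C'" "a' \<in> A'" "b' \<in> B'" "c' \<in> C'" and
      eq: "a * b = a' * b'" "(a + d) * c = (a' + d) * c'" by blast
    have nz: "c \<noteq> 0" "c' \<noteq> 0" "a + d \<noteq> 0" "a' + d \<noteq> 0"
      using mem by (auto simp: C'_def A'_def add_eq_0_iff2)
    have t: "(a + d) * c \<in> T" using T mem by (auto simp: A'_def C'_def)
    have e1: "b / c = (a + d) * b / ((a + d) * c)" using nz by simp
    have e2: "b' / c' = (a' + d) * b' / ((a + d) * c)" unfolding eq(2) using nz by simp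
    have e3: "(a + d) * b - (a' + d) * b' = d * (b - b')" using eq(1) by (simp add: algebra_simps)
    have "b / c - b' / c' = d * (b - b') / ((a + d) * c)" by (simp only: e1 e2 e3[symmetric] diff_divide_distrib)
    hence "v = (\<lambda>(b, b', t). (b, b', d * (b - b') / t)) (b, b', (a + d) * c)" by (simp add: v q \<psi>_def)
    moreover have "(b, b', (a + d) * c) \<in> B' \<times> B' \<times> T" using mem t by simp
    ultimately show "v \<in> ?Y" by (rule image_eqI)
  qed
  have cB: "card B' \<le> N" using assms(7) fin card_mono[of B B'] by (auto simp: B'_def)
  have cC: "card C' \<le> N" using assms(8) fin card_mono[of C C'] by (auto simp: C'_def)
  have "card ?Y \<le> card (B' \<times> B' \<times> T)" by (rule card_image_le) (use fin' fin in auto)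
  also have "\<dots> \<le> N * (N * M)" unfolding card_cartesian_product using cB M by (intro mult_le_mono)
  finally have cY: "card ?Y \<le> N * N * M" by (simp add: mult.assoc)
  let ?Z = "{(q, q'). q \<in> Q \<and> q' \<in> Q \<and> \<psi> q = \<psi> q'}"
  have finZ: "finite (grid_solutions B' (inverse ` C'))"
    by (rule finite_subset[of _ "(B' \<times> inverse ` C' \<times> inverse ` C') \<times> (B' \<times> inverse ` C' \<times> inverse ` C')"])
      (use fin' in \<open>auto simp: grid_solutions_def\<close>)
  have Z: "\<exists>a1 b c1 a1' b' c1' a2 c2 a2' c2'. z = (((a1, b, c1), (a1', b', c1')), ((a2, b, c2), (a2', b', c2'))) \<and>
      b \<in> B' \<and> b' \<in> B' \<and> c1 \<in> C' \<and> c1' \<in> C' \<and> c2 \<in> C' \<and> c2' \<in> C' \<and> b / c1 - b' / c1' = b / c2 - b' / c2' \<and>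
      a1 * b = a1' * b' \<and> (a1 + d) * c1 = (a1' + d) * c1' \<and> (a1, b, c1) \<noteq> (a1', b', c1') \<and>
      a2 * b = a2' * b' \<and> (a2 + d) * c2 = (a2' + d) * c2' \<and> (a2, b, c2) \<noteq> (a2', b', c2')" if "z \<in> ?Z" for z
  proof -
    from that obtain q q' where z: "z = (q, q')" "q \<in> Q" "q' \<in> Q" "\<psi> q = \<psi> q'" by blast
    from Q[OF z(2)] obtain a b c a' b' c' where q: "q = ((a, b, c), (a', b', c'))"
      "b \<in> B'" "c \<in> C'" "b' \<in> B'" "c' \<in> C'" "a * b = a' * b'" "(a + d) * c = (a' + d) * c'" "(a, b, c) \<noteq> (a', b', c')"
      by blast
    from Q[OF z(3)] obtain a2 b2 c2 a2' b2' c2' where q': "q' = ((a2, b2, c2), (a2', b2', c2'))"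
      "c2 \<in> C'" "c2' \<in> C'" "a2 * b2 = a2' * b2'" "(a2 + d) * c2 = (a2' + d) * c2'" "(a2, b2, c2) \<noteq> (a2', b2', c2')"
      by blast
    have "b2 = b" "b2' = b'" "b / c - b' / c' = b / c2 - b' / c2'" using z(4) by (auto simp: q(1) q'(1) \<psi>_def)
    thus ?thesis using q q' z(1) by blast
  qed
  have "\<phi> ` ?Z \<subseteq> grid_solutions B' (inverse ` C')"
  proof
    fix u assume "u \<in> \<phi> ` ?Z"
    then obtain z where "z \<in> ?Z" and u: "u = \<phi> z" by blast
    from Z[OF this(1)] obtain a1 b c1 a1' b' c1' a2 c2 a2' c2' where
      z: "z = (((a1, b, c1), (a1', b', c1')), ((a2, b, c2), (a2', b', c2')))"
        "b \<in> B'" "b' \<in> B'" "c1 \<in> C'" "c1' \<in> C'" "c2 \<in> C'" "c2' \<in> C'" and e: "b / c1 - b' / c1' = b / c2 - b' / c2'"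
      by blast
    have "b * (inverse c1 - inverse c2) = b' * (inverse c1' - inverse c2')"
      using e by (simp add: divide_inverse algebra_simps)
    thus "u \<in> grid_solutions B' (inverse ` C')" using z by (simp add: u \<phi>_def grid_solutions_def)
  qed
  moreover have "inj_on \<phi> ?Z"
  proof (rule inj_onI)
    fix z e assume "z \<in> ?Z" "e \<in> ?Z" and eq: "\<phi> z = \<phi> e"
    from Z[OF this(1)] obtain a1 b c1 a1' b' c1' a2 c2 a2' c2' where
      z: "z = (((a1, b, c1), (a1', b', c1')), ((a2, b, c2), (a2', b', c2')))"
        "b \<in> B'" "b' \<in> B'" "c1 \<in> C'" "c1' \<in> C'" "c2 \<in> C'" "c2' \<in> C'" and
      z1: "a1 * b = a1' * b'" "(a1 + d) * c1 = (a1' + d) * c1'" "(a1, b, c1) \<noteq> (a1', b', c1')" and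
      z2: "a2 * b = a2' * b'" "(a2 + d) * c2 = (a2' + d) * c2'" "(a2, b, c2) \<noteq> (a2', b', c2')"
      by blast
    from Z[OF \<open>e \<in> ?Z\<close>] obtain e1 \<beta> \<gamma>1 e1' \<beta>' \<gamma>1' e2 \<gamma>2 e2' \<gamma>2' where
      e: "e = (((e1, \<beta>, \<gamma>1), (e1', \<beta>', \<gamma>1')), ((e2, \<beta>, \<gamma>2), (e2', \<beta>', \<gamma>2')))" and
      e1: "e1 * \<beta> = e1' * \<beta>'" "(e1 + d) * \<gamma>1 = (e1' + d) * \<gamma>1'" and
      e2: "e2 * \<beta> = e2' * \<beta>'" "(e2 + d) * \<gamma>2 = (e2' + d) * \<gamma>2'"
      by blast
    have same: "\<beta> = b" "\<beta>' = b'" "\<gamma>1 = c1" "\<gamma>1' = c1'" "\<gamma>2 = c2" "\<gamma>2' = c2'"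
      using eq by (auto simp: z(1) e \<phi>_def)
    have nz: "b \<noteq> 0" "b' \<noteq> 0" "c1 \<noteq> 0" "c1' \<noteq> 0" "c2 \<noteq> 0" "c2' \<noteq> 0" using z by (auto simp: B'_def C'_def)
    have "a1 = e1 \<and> a1' = e1'"
      using z1(1,2) e1[unfolded same] nz(1-4) \<open>d \<noteq> 0\<close> z1(3) by (rule quadruple_determines_triples)
    moreover have "a2 = e2 \<and> a2' = e2'"
      using z2(1,2) e2[unfolded same] nz(1,2,5,6) \<open>d \<noteq> 0\<close> z2(3) by (rule quadruple_determines_triples)
    ultimately show "z = e" by (simp add: z(1) e same)
  qed
  ultimately have "card ?Z \<le> card (grid_solutions B' (inverse ` C'))" using finZ card_inj_on_le by blast
  also have "\<dots> \<le> K"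
    using fin' cB cC card_image_le[OF fin'(3), of inverse] by (intro grid) (auto simp: B'_def)
  finally have cZ: "card ?Z \<le> K" .
  have "finite ?Y" using fin' fin by simp
  hence "(card Q)\<^sup>2 \<le> card ?Y * card ?Z" using finQ sub by (intro card_squared_le_collisions)
  also have "\<dots> \<le> (N * N * M) * K" by (rule mult_le_mono[OF cY cZ])
  finally show thesis using that 1 2 3 by blast
qed

text \<open>If 2 M^2 \<le> n0 the diagonal is absorbed, n0^2 \<le> 2 M^2 g, and squaring gives N^12
  / 4096 \<le> 4 M^5 N^(34/5). The constant 7 appears because 7^5 = 16807 exceeds 4 * 4096.
  Otherwise M is already of order N^(3/2).\<close>

lemma product_sets_exponent:
  fixes N M n0 P g K :: nat
  assumes "2 \<le> N" "(N - 1) ^ 3 \<le> n0" "n0\<^sup>2 \<le> M * M * P" "P \<le> n0 + g" "g\<^sup>2 \<le> (N * N * M) * K"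
    and K: "real K \<le> real N powr (24 / 5)"
  shows "real N powr (1 + 1 / 25) / 7 \<le> real M"
proof -
  define x where "x = real N"
  define m where "m = real M"
  have x: "2 \<le> x" using assms(1) by (simp add: x_def)
  have "x / 2 \<le> real (N - 1)" using assms(1) by (simp add: x_def of_nat_diff)
  hence "(x / 2) ^ 3 \<le> real (N - 1) ^ 3" using x by (intro power_mono) auto
  also have "\<dots> \<le> real n0" using assms(2) by (simp flip: of_nat_power)
  finally have n0: "x ^ 3 / 8 \<le> real n0" by (simp add: power_divide)
  have "0 < x ^ 3 / 8" using x by simp
  hence "0 < real n0" using n0 by linarith
  have "real (n0\<^sup>2) \<le> real (M * M * P)" using assms(3) by (simp only: of_nat_le_iff)
  hence 3: "(real n0)\<^sup>2 \<le> m\<^sup>2 * real P" by (simp add: m_def power2_eq_square)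
  have "0 \<le> m" by (simp add: m_def)
  have "m \<noteq> 0" using 3 \<open>0 < real n0\<close> by auto
  hence m: "0 < m" using \<open>0 \<le> m\<close> by simp
  show ?thesis
  proof (cases "2 * m\<^sup>2 \<le> real n0")
    case True
    have "(real n0)\<^sup>2 \<le> m\<^sup>2 * (real n0 + real g)"
      using 3 assms(4) by (smt (verit) mult_left_mono of_nat_add of_nat_le_iff zero_le_power2)
    moreover have "2 * m\<^sup>2 * real n0 \<le> (real n0)\<^sup>2"
      using True by (simp add: power2_eq_square mult_right_mono)
    ultimately have "(real n0)\<^sup>2 \<le> 2 * m\<^sup>2 * real g" by (simp add: algebra_simps)
    hence "((real n0)\<^sup>2)\<^sup>2 \<le> (2 * m\<^sup>2 * real g)\<^sup>2" by (intro power_mono) auto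
    also have "\<dots> = 4 * m ^ 4 * (real g)\<^sup>2" by (simp add: power_mult_distrib flip: power_mult)
    also have "(real g)\<^sup>2 \<le> x\<^sup>2 * m * real K"
    proof -
      have "real (g\<^sup>2) \<le> real (N * N * M * K)" using assms(5) by (simp only: of_nat_le_iff)
      thus ?thesis by (simp add: x_def m_def power2_eq_square)
    qed
    also have "x\<^sup>2 * m * real K \<le> x\<^sup>2 * m * x powr (24 / 5)" using K m by (intro mult_left_mono) (auto simp: x_def)
    also have "4 * m ^ 4 * (x\<^sup>2 * m * x powr (24 / 5)) = 4 * m ^ 5 * (x\<^sup>2 * x powr (24 / 5))"
      by (simp add: power_numeral_reduce algebra_simps)
    also have "x\<^sup>2 * x powr (24 / 5) = x powr (34 / 5)"
      using x by (simp add: powr_add[symmetric] flip: powr_numeral)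
    finally have "((real n0)\<^sup>2)\<^sup>2 \<le> 4 * m ^ 5 * x powr (34 / 5)" using m by simp
    moreover have "((x ^ 3 / 8)\<^sup>2)\<^sup>2 \<le> ((real n0)\<^sup>2)\<^sup>2" using n0 x by (intro power_mono) auto
    moreover have "((x ^ 3 / 8)\<^sup>2)\<^sup>2 = x ^ 12 / 4096" by (simp add: power_divide flip: power_mult)
    moreover have "x ^ 12 = x powr (26 / 5) * x powr (34 / 5)"
      using x by (simp add: powr_add[symmetric] flip: powr_numeral)
    ultimately have "x powr (26 / 5) * x powr (34 / 5) \<le> (16384 * m ^ 5) * x powr (34 / 5)" by simp
    hence "x powr (26 / 5) \<le> 16384 * m ^ 5" using x by simp
    also have "\<dots> \<le> (7 * m) ^ 5" using m by (simp add: power_mult_distrib)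
    also have "x powr (26 / 5) = (x powr (1 + 1 / 25)) ^ 5"
      using x by (simp add: powr_power)
    finally have "x powr (1 + 1 / 25) \<le> 7 * m" by (rule power_le_imp_le_base[of _ 4, simplified]) (use m in auto)
    thus ?thesis by (simp add: x_def m_def)
  next
    case False
    hence "x ^ 3 / 16 \<le> m\<^sup>2" using n0 by simp
    moreover have "x ^ 3 = (x powr (3 / 2))\<^sup>2" using x by (simp add: powr_powr flip: powr_numeral)
    ultimately have "(x powr (3 / 2) / 4)\<^sup>2 \<le> m\<^sup>2" by (simp add: power_divide)
    hence "x powr (3 / 2) / 4 \<le> m" by (rule power2_le_imp_le) (use m in auto)
    moreover have "x powr (1 + 1 / 25) \<le> x powr (3 / 2)" using x by (intro powr_mono) auto
    ultimately have "x powr (1 + 1 / 25) \<le> 4 * m" by simp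
    thus ?thesis using m by (simp add: x_def m_def)
  qed
qed

section \<open>The absolute constant\<close>

definition threshold :: nat where
  "threshold = (SOME n. 2 \<le> n \<and> (\<forall>N\<ge>n. \<exists>h \<theta>. admissible N h \<theta>))"

lemma threshold: "2 \<le> threshold" "threshold \<le> N \<Longrightarrow> \<exists>h \<theta>. admissible N h \<theta>"
proof -
  obtain n where "\<forall>N\<ge>n. \<exists>h \<theta>. admissible N h \<theta>" using eventually_admissible by blast
  hence "2 \<le> max 2 n \<and> (\<forall>N\<ge>max 2 n. \<exists>h \<theta>. admissible N h \<theta>)" by simp
  hence "2 \<le> threshold \<and> (\<forall>N\<ge>threshold. \<exists>h \<theta>. admissible N h \<theta>)" unfolding threshold_def by (rule someI)
  thus "2 \<le> threshold" "threshold \<le> N \<Longrightarrow> \<exists>h \<theta>. admissible N h \<theta>" by blast+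
qed

text \<open>The second entry handles N below \<open>threshold\<close>: there N^(1 + 1/26) is at most
  the square of \<open>threshold\<close>, and a nonempty product set has at least one
  element.\<close>

definition implied_constant :: real where
  "implied_constant = min (1 / 7) (1 / (real threshold)\<^sup>2)"

lemma implied_constant_pos: "0 < implied_constant"
  using threshold(1) by (simp add: implied_constant_def)

lemma product_sets_lower_bound:
  fixes A B C S T :: "'f::field set"
  assumes fin: "finite A" "finite B" "finite C" "finite S" "finite T"
    and card: "card A = N" "card B = N" "card C = N" and d: "d \<noteq> 0"
    and S: "\<And>a b. a \<in> A \<Longrightarrow> b \<in> B \<Longrightarrow> a * b \<in> S" and T: "\<And>a c. a \<in> A \<Longrightarrow> c \<in> C \<Longrightarrow> (a + d) * c \<in> T"
    and char: "\<And>k. 0 < k \<Longrightarrow> k < N\<^sup>2 \<Longrightarrow> of_nat k \<noteq> (0 :: 'f)"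
  shows "implied_constant * real N powr (1 + 1 / 26) \<le> real (max (card S) (card T))"
proof -
  consider "N = 0" | "1 \<le> N" "N < threshold" | "threshold \<le> N" by linarith
  thus ?thesis
  proof cases
    case 1
    thus ?thesis by simp
  next
    case 2
    have "A \<noteq> {}" "B \<noteq> {}" using 2 card by auto
    hence "S \<noteq> {}" using S by blast
    hence "1 \<le> card S" using fin by (simp add: Suc_le_eq card_gt_0_iff)
    have "real N powr (1 + 1 / 26) \<le> real N powr 2" using 2 by (intro powr_mono) auto
    also have "\<dots> = (real N)\<^sup>2" using 2 by simp
    also have "\<dots> \<le> (real threshold)\<^sup>2" using 2 by (intro power_mono) auto
    finally have "implied_constant * real N powr (1 + 1 / 26) \<le> 1 / (real threshold)\<^sup>2 * (real threshold)\<^sup>2"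
      by (intro mult_mono) (auto simp: implied_constant_def)
    also have "\<dots> = 1" using threshold(1) by simp
    finally show ?thesis using \<open>1 \<le> card S\<close> by simp
  next
    case 3
    obtain h \<theta> where "admissible N h \<theta>" using threshold(2)[OF 3] by blast
    note adm = this[unfolded admissible_def]
    define K where "K = (\<theta> + 135 * h + 1 + N) * (2 * N ^ 3) + N\<^sup>2 * (540 * h + N) * (27 * h)"
    define M where "M = max (card S) (card T)"
    \<comment> \<open>Admissibility includes 27 h < N^2, so the hypothesis on the characteristic
      covers all degrees that occur.\<close>
    have grid: "card (grid_solutions B D) \<le> K"
      if "finite B" "finite D" "0 \<notin> B" "card B \<le> N" "card D \<le> N" for B D :: "'f set"
      unfolding K_def using that adm char by (intro card_grid_solutions_le) auto
    have M: "card S \<le> M" "card T \<le> M" by (simp_all add: M_def)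
    obtain n0 P g where *: "(N - 1) ^ 3 \<le> n0" "n0\<^sup>2 \<le> M * M * P" "P \<le> n0 + g" "g\<^sup>2 \<le> (N * N * M) * K"
      by (rule product_sets_inequalities[OF fin card d S T M grid])
    have "2 \<le> N" using 3 threshold(1) by linarith
    have "real K \<le> real N powr (24 / 5)" using adm by (simp only: K_def)
    from product_sets_exponent[OF \<open>2 \<le> N\<close> * this] have "real N powr (1 + 1 / 25) / 7 \<le> real M" .
    moreover have "real N powr (1 + 1 / 26) \<le> real N powr (1 + 1 / 25)" using \<open>2 \<le> N\<close> by (intro powr_mono) auto
    moreover have "implied_constant * real N powr (1 + 1 / 26) \<le> 1 / 7 * real N powr (1 + 1 / 26)"
      by (intro mult_right_mono) (auto simp: implied_constant_def)
    ultimately show ?thesis by (simp add: M_def)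
  qed
qed

subsection \<open>Transfer to residue rings\<close>

definition products_large :: "nat \<Rightarrow> bool" where
  "products_large p \<longleftrightarrow> (\<forall>A B C d. A \<subseteq> carrier (Fp p) \<longrightarrow> B \<subseteq> carrier (Fp p) \<longrightarrow> C \<subseteq> carrier (Fp p) \<longrightarrow>
     card A = card B \<longrightarrow> card B = card C \<longrightarrow> real (card A) \<le> sqrt (real p) \<longrightarrow>
     d \<in> carrier (Fp p) \<longrightarrow> d \<noteq> \<zero>\<^bsub>Fp p\<^esub> \<longrightarrow>
     implied_constant * real (card A) powr (1 + 1 / 26)
       \<le> real (max (card (A <#>\<^bsub>Fp p\<^esub> B)) (card ((A +>\<^bsub>Fp p\<^esub> d) <#>\<^bsub>Fp p\<^esub> C))))"

text \<open>A type cannot depend on the prime \<open>p\<close>, but a type built from a hypothetical counterexample suffices.\<close>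

definition worst_prime :: nat where
  "worst_prime = (SOME p. prime p \<and> ((\<exists>q. prime q \<and> \<not> products_large q) \<longrightarrow> \<not> products_large p))"

lemma worst_prime: "prime worst_prime" "products_large worst_prime \<Longrightarrow> prime p \<Longrightarrow> products_large p"
proof -
  have "\<exists>p::nat. prime p \<and> ((\<exists>q. prime q \<and> \<not> products_large q) \<longrightarrow> \<not> products_large p)"
    using two_is_prime_nat by blast
  hence "prime worst_prime \<and> ((\<exists>q. prime q \<and> \<not> products_large q) \<longrightarrow> \<not> products_large worst_prime)"
    unfolding worst_prime_def by (rule someI_ex)
  thus "prime worst_prime" "products_large worst_prime \<Longrightarrow> prime p \<Longrightarrow> products_large p" by blast+
qed

typedef worst_index = "{..<worst_prime}"
  using prime_gt_0_nat[OF worst_prime(1)] by blast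

lemma card_worst_index: "CARD(worst_index) = worst_prime"
  using type_definition.card[OF type_definition_worst_index] by simp

instance worst_index :: prime_card
  by standard (simp add: card_worst_index worst_prime(1))

lemma of_int_mod_ring_mod: "of_int_mod_ring (x mod int CARD('a)) = (of_int_mod_ring x :: 'a::nontriv mod_ring)"
  by transfer simp

lemma inj_on_of_int_mod_ring: "inj_on (of_int_mod_ring :: int \<Rightarrow> 'a::nontriv mod_ring) {0..int CARD('a) - 1}"
  by (rule inj_on_inverseI[of _ to_int_mod_ring]) simp

lemma of_int_mod_ring_hom:
  "of_int_mod_ring (x * y) = (of_int_mod_ring x * of_int_mod_ring y :: 'a::nontriv mod_ring)"
  "of_int_mod_ring (x + y) = (of_int_mod_ring x + of_int_mod_ring y :: 'a::nontriv mod_ring)"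
  by (simp_all flip: of_int_of_int_mod_ring)

lemma residue_ring_simps: "carrier (residue_ring m) = {0..m - 1}" "x \<otimes>\<^bsub>residue_ring m\<^esub> y = x * y mod m"
  "x \<oplus>\<^bsub>residue_ring m\<^esub> y = (x + y) mod m" "\<zero>\<^bsub>residue_ring m\<^esub> = 0" "\<one>\<^bsub>residue_ring m\<^esub> = 1"
  by (simp_all add: residue_ring_def)

text \<open>\<open>of_int_mod_ring\<close> is injective on the representatives 0, ..., p - 1 and
  ignores reduction modulo p. So sets keep their sizes, and products of images lie in the images of
  the product sets.\<close>

lemma products_large_worst_prime: "products_large worst_prime"
  unfolding products_large_def
proof (intro allI impI)
  fix A B C :: "int set" and d :: int
  let ?p = "worst_prime" and ?e = "of_int_mod_ring :: int \<Rightarrow> worst_index mod_ring"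
  define R where "R = Fp ?p"
  assume "A \<subseteq> carrier (Fp ?p)" "B \<subseteq> carrier (Fp ?p)" "C \<subseteq> carrier (Fp ?p)" and
    card: "card A = card B" "card B = card C" and small: "real (card A) \<le> sqrt (real ?p)" and
    "d \<in> carrier (Fp ?p)" "d \<noteq> \<zero>\<^bsub>Fp ?p\<^esub>"
  hence sub: "A \<subseteq> {0..int ?p - 1}" "B \<subseteq> {0..int ?p - 1}" "C \<subseteq> {0..int ?p - 1}" and d: "d \<in> {0..int ?p - 1}" "d \<noteq> 0"
    by (simp_all add: residue_ring_simps)
  have p: "0 < ?p" using worst_prime(1) by (rule prime_gt_0_nat)
  define S where "S = A <#>\<^bsub>Fp ?p\<^esub> B"
  define T where "T = (A +>\<^bsub>Fp ?p\<^esub> d) <#>\<^bsub>Fp ?p\<^esub> C"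
  have ST: "S \<subseteq> {0..int ?p - 1}" "T \<subseteq> {0..int ?p - 1}"
    using p by (auto simp: S_def T_def set_mult_def a_r_coset_def' residue_ring_simps)
  have inj: "inj_on ?e {0..int ?p - 1}"
    using inj_on_of_int_mod_ring[where 'a = worst_index] by (simp only: card_worst_index)
  have cardE: "card (?e ` X) = card X" if "X \<subseteq> {0..int ?p - 1}" for X
    by (rule card_image[OF inj_on_subset[OF inj that]])
  have fin: "finite X" if "X \<subseteq> {0..int ?p - 1}" for X
    using that by (rule finite_subset) simp
  have emod: "?e (x mod int ?p) = ?e x" for x
    using of_int_mod_ring_mod[of x, where 'a = worst_index] by (simp only: card_worst_index)
  have "?e d \<noteq> 0"
    using inj_onD[OF inj, of d 0] d p by auto
  moreover have "a * b \<in> ?e ` S" if "a \<in> ?e ` A" "b \<in> ?e ` B" for a b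
  proof -
    from that obtain x y where xy: "a = ?e x" "b = ?e y" "x \<in> A" "y \<in> B" by blast
    hence "x * y mod int ?p \<in> S" by (auto simp: S_def set_mult_def residue_ring_simps)
    moreover have "a * b = ?e (x * y mod int ?p)" by (simp only: xy emod of_int_mod_ring_hom)
    ultimately show ?thesis by blast
  qed
  moreover have "(a + ?e d) * c \<in> ?e ` T" if "a \<in> ?e ` A" "c \<in> ?e ` C" for a c
  proof -
    from that obtain x y where xy: "a = ?e x" "c = ?e y" "x \<in> A" "y \<in> C" by blast
    hence "(x + d) mod int ?p * y mod int ?p \<in> T"
      by (auto simp: T_def set_mult_def a_r_coset_def' residue_ring_simps)
    moreover have "(a + ?e d) * c = ?e ((x + d) mod int ?p * y mod int ?p)"
      by (simp only: xy emod of_int_mod_ring_hom)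
    ultimately show ?thesis by blast
  qed
  \<comment> \<open>The bound by the square root of p is used here: k < |A|^2 \<le> p is not
    divisible by p.\<close>
  moreover have "of_nat k \<noteq> (0 :: worst_index mod_ring)" if "0 < k" "k < (card A)\<^sup>2" for k
  proof
    assume "of_nat k = (0 :: worst_index mod_ring)"
    hence "?p dvd k" using of_nat_0_mod_ring_dvd card_worst_index by metis
    hence "?p \<le> k" using that(1) by (rule dvd_imp_le)
    have "(real (card A))\<^sup>2 \<le> real ?p"
      using small by (metis of_nat_0_le_iff power_mono real_sqrt_pow2)
    hence "real ((card A)\<^sup>2) \<le> real ?p" by simp
    hence "(card A)\<^sup>2 \<le> ?p" by (simp only: of_nat_le_iff)
    with \<open>?p \<le> k\<close> that(2) show False by linarith
  qed
  ultimately have "implied_constant * real (card A) powr (1 + 1 / 26) \<le> real (max (card (?e ` S)) (card (?e ` T)))"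
    using sub ST card fin
    by (intro product_sets_lower_bound[of "?e ` A" "?e ` B" "?e ` C" _ _ _ "?e d"]) (auto simp: cardE)
  thus "implied_constant * real (card A) powr (1 + 1 / 26)
      \<le> real (max (card (A <#>\<^bsub>Fp ?p\<^esub> B)) (card ((A +>\<^bsub>Fp ?p\<^esub> d) <#>\<^bsub>Fp ?p\<^esub> C)))"
    using ST by (simp add: cardE S_def T_def)
qed

lemma products_large:
  assumes "prime p" "A \<subseteq> carrier (Fp p)" "B \<subseteq> carrier (Fp p)" "C \<subseteq> carrier (Fp p)"
    "card A = card B" "card B = card C" "real (card A) \<le> sqrt (real p)" "d \<in> carrier (Fp p)" "d \<noteq> \<zero>\<^bsub>Fp p\<^esub>"
  shows "implied_constant * real (card A) powr (1 + 1 / 26)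
       \<le> real (max (card (A <#>\<^bsub>Fp p\<^esub> B)) (card ((A +>\<^bsub>Fp p\<^esub> d) <#>\<^bsub>Fp p\<^esub> C)))"
  using worst_prime(2)[OF products_large_worst_prime assms(1)] assms(2-) unfolding products_large_def by blast

lemma translate_Fp:
  assumes "prime p" "A \<subseteq> carrier (Fp p)"
  shows "A +>\<^bsub>Fp p\<^esub> \<one>\<^bsub>Fp p\<^esub> \<subseteq> carrier (Fp p)" "card (A +>\<^bsub>Fp p\<^esub> \<one>\<^bsub>Fp p\<^esub>) = card A"
    "\<one>\<^bsub>Fp p\<^esub> \<in> carrier (Fp p)" "\<one>\<^bsub>Fp p\<^esub> \<noteq> \<zero>\<^bsub>Fp p\<^esub>"
proof -
  interpret residues_prime p "Fp p" by unfold_locales (rule assms(1))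
  show "A +>\<^bsub>Fp p\<^esub> \<one>\<^bsub>Fp p\<^esub> \<subseteq> carrier (Fp p)" using assms(2) one_closed by (rule a_r_coset_subset_G)
  have "A +>\<^bsub>Fp p\<^esub> \<one>\<^bsub>Fp p\<^esub> = (\<lambda>a. a \<oplus>\<^bsub>Fp p\<^esub> \<one>\<^bsub>Fp p\<^esub>) ` A" by (auto simp: a_r_coset_def')
  moreover have "inj_on (\<lambda>a. a \<oplus>\<^bsub>Fp p\<^esub> \<one>\<^bsub>Fp p\<^esub>) A"
    by (rule inj_onI) (use assms(2) one_closed in \<open>auto dest: add.right_cancel[THEN iffD1, rotated 3]\<close>)
  ultimately show "card (A +>\<^bsub>Fp p\<^esub> \<one>\<^bsub>Fp p\<^esub>) = card A" by (simp add: card_image)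
  show "\<one>\<^bsub>Fp p\<^esub> \<in> carrier (Fp p)" by (rule one_closed)
  show "\<one>\<^bsub>Fp p\<^esub> \<noteq> \<zero>\<^bsub>Fp p\<^esub>" by (rule one_not_zero)
qed

lemma set_mult_commute_Fp: "X <#>\<^bsub>Fp p\<^esub> Y = Y <#>\<^bsub>Fp p\<^esub> X"
  unfolding set_mult_def by (auto simp: residue_ring_simps) (metis mult.commute)+

theorem theorem1:
  shows "(\<exists>c::real. c > 0 \<and>
           (\<forall>(p::nat) A B C d. prime p \<longrightarrow>
              A \<subseteq> carrier (Fp p) \<longrightarrow> B \<subseteq> carrier (Fp p) \<longrightarrow> C \<subseteq> carrier (Fp p) \<longrightarrow>
              card A = card B \<longrightarrow> card B = card C \<longrightarrow> real (card A) \<le> sqrt (real p) \<longrightarrow>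
              d \<in> carrier (Fp p) \<longrightarrow> d \<noteq> \<zero>\<^bsub>Fp p\<^esub> \<longrightarrow>
              real (max (card (A <#>\<^bsub>Fp p\<^esub> B))
                        (card ((A +>\<^bsub>Fp p\<^esub> d) <#>\<^bsub>Fp p\<^esub> C)))
                \<ge> c * real (card A) powr (1 + 1 / 26)))
       \<and> (\<exists>c::real. c > 0 \<and>
           (\<forall>(p::nat) A. prime p \<longrightarrow>
              A \<subseteq> carrier (Fp p) \<longrightarrow> real (card A) \<le> sqrt (real p) \<longrightarrow>
              real (card (A <#>\<^bsub>Fp p\<^esub> (A +>\<^bsub>Fp p\<^esub> \<one>\<^bsub>Fp p\<^esub>)))
                \<ge> c * real (card A) powr (1 + 1 / 26)))
       \<and> (\<exists>c::real. c > 0 \<and>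
           (\<forall>(p::nat) A. prime p \<longrightarrow>
              A \<subseteq> carrier (Fp p) \<longrightarrow> real (card A) \<le> sqrt (real p) \<longrightarrow>
              real (max (card (A <#>\<^bsub>Fp p\<^esub> A))
                        (card ((A +>\<^bsub>Fp p\<^esub> \<one>\<^bsub>Fp p\<^esub>) <#>\<^bsub>Fp p\<^esub> (A +>\<^bsub>Fp p\<^esub> \<one>\<^bsub>Fp p\<^esub>))))
                \<ge> c * real (card A) powr (1 + 1 / 26)))"
proof (intro conjI; rule exI[of _ implied_constant]; intro conjI implied_constant_pos allI impI)
  fix p :: nat and A B C :: "int set" and d :: int
  assume "prime p" "A \<subseteq> carrier (Fp p)" "B \<subseteq> carrier (Fp p)" "C \<subseteq> carrier (Fp p)"
    "card A = card B" "card B = card C" "real (card A) \<le> sqrt (real p)" "d \<in> carrier (Fp p)" "d \<noteq> \<zero>\<^bsub>Fp p\<^esub>"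
  thus "implied_constant * real (card A) powr (1 + 1 / 26)
       \<le> real (max (card (A <#>\<^bsub>Fp p\<^esub> B)) (card ((A +>\<^bsub>Fp p\<^esub> d) <#>\<^bsub>Fp p\<^esub> C)))"
    by (rule products_large)
next
  fix p :: nat and A :: "int set"
  assume A: "prime p" "A \<subseteq> carrier (Fp p)" "real (card A) \<le> sqrt (real p)"
  note tr = translate_Fp[OF A(1,2)]
  \<comment> \<open>With B = A + 1, C = A and d = 1 the two product sets coincide by
    commutativity.\<close>
  have "implied_constant * real (card A) powr (1 + 1 / 26)
       \<le> real (max (card (A <#>\<^bsub>Fp p\<^esub> (A +>\<^bsub>Fp p\<^esub> \<one>\<^bsub>Fp p\<^esub>))) (card ((A +>\<^bsub>Fp p\<^esub> \<one>\<^bsub>Fp p\<^esub>) <#>\<^bsub>Fp p\<^esub> A)))"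
    by (rule products_large[OF A(1,2) tr(1) A(2) tr(2)[symmetric] tr(2) A(3) tr(3,4)])
  thus "implied_constant * real (card A) powr (1 + 1 / 26) \<le> real (card (A <#>\<^bsub>Fp p\<^esub> (A +>\<^bsub>Fp p\<^esub> \<one>\<^bsub>Fp p\<^esub>)))"
    unfolding set_mult_commute_Fp[where X = "A +>\<^bsub>Fp p\<^esub> \<one>\<^bsub>Fp p\<^esub>" and Y = A] max.idem .
next
  fix p :: nat and A :: "int set"
  assume A: "prime p" "A \<subseteq> carrier (Fp p)" "real (card A) \<le> sqrt (real p)"
  note tr = translate_Fp[OF A(1,2)]
  show "implied_constant * real (card A) powr (1 + 1 / 26)
       \<le> real (max (card (A <#>\<^bsub>Fp p\<^esub> A))
            (card ((A +>\<^bsub>Fp p\<^esub> \<one>\<^bsub>Fp p\<^esub>) <#>\<^bsub>Fp p\<^esub> (A +>\<^bsub>Fp p\<^esub> \<one>\<^bsub>Fp p\<^esub>))))"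
    \<comment> \<open>Here B = A, C = A + 1 and d = 1.\<close>
    by (rule products_large[OF A(1,2,2) tr(1) refl tr(2)[symmetric] A(3) tr(3,4)])
qed

end
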